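(* Let $\nu,\beta\in(0,1)$ and let $(\lambda_k)_{k\ge 1}$ be pairwise distinct positive real numbers. Consider the generalized Yule model in which genera appear following the mixed Poisson process up to a time transformation $M$ with parameter $\nu$, and the number of species in each genus evolves as an independent copy of the nonlinear time-fractional pure birth process $\mathcal{Y}$ with rates $(\lambda_k)_{k\ge1}$ and fractional exponent $\beta$. For $t>0$ let ${}_t\mathfrak{N}$ be the number of species at time $t$ in a genus chosen uniformly at random among those that have appeared up to time $t$. Then, for every $t>0$ and every integer $k\ge 1$, $$\mathbb{P}({}_t\mathfrak{N}=k)=\Gamma(\nu+1)\prod_{j=1}^{k-1}\lambda_j\;\sum_{m=1}^{k}\frac{E_{\beta,\nu+1}(-\lambda_m t^\beta)}{\prod_{l=1,\,l\neq m}^{k}(\lambda_l-\lambda_m)},$$ where empty products equal $1$.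
   Context: Mittag-Leffler function: $E_{\beta,\delta}(z)=\sum_{r=0}^\infty \frac{z^r}{\Gamma(\beta r+\delta)}$. Genera process $M$ with parameter $\nu\in(0,1)$: $M_t=N_{Wq(t)}$, where $N$ is a unit-rate homogeneous Poisson process, $q(t)=\mu t^\nu/\Gamma(1+\nu)$ for some constant $\mu>0$, and $W$ is a non-negative random variable independent of $N$, with density $f_W(w)=\frac{1}{\Gamma(1+\nu)}\phi\left(-\nu,1-\nu;\frac{-w}{\Gamma(1+\nu)}\right)$, $w>0$, $\phi(\alpha,\beta;z)=\sum_{r\ge0}\frac{z^r}{r!\,\Gamma(\alpha r+\beta)}$ being the Wright function. The jump times of $M$ are the times of appearance of genera. Species process $\mathcal{Y}$: let $(Y_t)_{t\ge0}$ be the nonlinear pure birth process on $\{1,2,\dots\}$ with $Y_0=1$ and birth rate $\lambda_k$ in state $k$. Let $(D_t)_{t\ge0}$ be an independent $\beta$-stable subordinator with Lévy measure $\frac{\beta}{\Gamma(1-\beta)}x^{-1-\beta}dx$ on $(0,\infty)$ and no drift, and $E_t=\inf\{s:D_s>t\}$. Then $\mathcal{Y}_t=Y_{E_t}$. Generalized Yule model: genera appear at the jump times of $M$; at the appearance time $T_i$ of the $i$-th genus a copy $\mathcal{Y}^{(i)}$ of $\mathcal{Y}$ starts (from a single species), so that the number of species in genus $i$ at time $t\ge T_i$ is $\mathcal{Y}^{(i)}_{t-T_i}$; the copies are independent of one another and of $M$. The random variable ${}_t\mathfrak{N}$ is defined conditionally on $M_t\ge1$: given $M_t\geq 1$, an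 index is chosen uniformly at random in $\{1,\dots,M_t\}$ (independently of everything else given $M_t$) and ${}_t\mathfrak{N}$ is the number of species at time $t$ in that genus; $\mathbb{P}({}_t\mathfrak{N}=k)$ is the corresponding conditional probability. *)

theory Defs
  imports "HOL-Probability.Probability"
begin

section \<open>Special functions\<close>

definition mittag_leffler :: "real \<Rightarrow> real \<Rightarrow> real \<Rightarrow> real" where
  "mittag_leffler b d z = (\<Sum>r. z ^ r / Gamma (b * real r + d))"

text \<open>The reciprocal \<open>rGamma\<close> vanishes at the poles of \<open>Gamma\<close>, which the argument
  \<open>a * r + b\<close> may hit when \<open>a < 0\<close>.\<close>

definition wright :: "real \<Rightarrow> real \<Rightarrow> real \<Rightarrow> real" where
  "wright a b z = (\<Sum>r. z ^ r / fact r * rGamma (a * real r + b))"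

section \<open>Sigma-algebras generated by random variables and processes\<close>

text \<open>The library notion \<open>indep_vars\<close> only covers families of random variables with one common
  value type, so independence of processes of different types is expressed by \<open>indep_sets\<close> on the
  generated sigma-algebras.\<close>

definition sigma_rv :: "'a measure \<Rightarrow> 'b measure \<Rightarrow> ('a \<Rightarrow> 'b) \<Rightarrow> 'a set set" where
  "sigma_rv \<Omega> S X = {X -` A \<inter> space \<Omega> | A. A \<in> sets S}"

definition sigma_process :: "'a measure \<Rightarrow> 'b measure \<Rightarrow> (real \<Rightarrow> 'a \<Rightarrow> 'b) \<Rightarrow> 'a set set" where
  "sigma_process \<Omega> S X = sigma_sets (space \<Omega>) (\<Union>t\<in>{0..}. sigma_rv \<Omega> S (X t))"

section \<open>Poisson process, subordinator, pure birth process\<close>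

definition independent_increments :: "'a measure \<Rightarrow> (real \<Rightarrow> 'a \<Rightarrow> real) \<Rightarrow> bool" where
  "independent_increments \<Omega> X \<longleftrightarrow>
     (\<forall>n. \<forall>u :: nat \<Rightarrow> real. 0 \<le> u 0 \<longrightarrow> (\<forall>i<n. u i \<le> u (Suc i)) \<longrightarrow>
        prob_space.indep_vars \<Omega> (\<lambda>_. borel) (\<lambda>i \<omega>. X (u (Suc i)) \<omega> - X (u i) \<omega>) {..<n})"

definition poisson_process :: "'a measure \<Rightarrow> real \<Rightarrow> (real \<Rightarrow> 'a \<Rightarrow> nat) \<Rightarrow> bool" where
  "poisson_process \<Omega> r N \<longleftrightarrow>
     (\<forall>t\<ge>0. N t \<in> measurable \<Omega> (count_space UNIV)) \<and>
     (\<forall>\<omega>\<in>space \<Omega>. N 0 \<omega> = 0 \<and> mono_on {0..} (\<lambda>t. N t \<omega>) \<and>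
        (\<forall>t\<ge>0. continuous (at_right t) (\<lambda>s. N s \<omega>))) \<and>
     independent_increments \<Omega> (\<lambda>t \<omega>. real (N t \<omega>)) \<and>
     (\<forall>s t. 0 \<le> s \<longrightarrow> s < t \<longrightarrow>
        distr \<Omega> (count_space UNIV) (\<lambda>\<omega>. N t \<omega> - N s \<omega>) = measure_pmf (poisson_pmf (r * (t - s))))"

text \<open>A (real-valued) subordinator with drift \<open>b\<close> and Levy measure \<open>\<Lambda>\<close>; its law is given by the
  Levy-Khintchine formula for the Laplace transform.\<close>

definition subordinator ::
  "'a measure \<Rightarrow> real \<Rightarrow> real measure \<Rightarrow> (real \<Rightarrow> 'a \<Rightarrow> real) \<Rightarrow> bool" where
  "subordinator \<Omega> b \<Lambda> D \<longleftrightarrow>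
     (\<forall>t\<ge>0. D t \<in> borel_measurable \<Omega>) \<and>
     (\<forall>\<omega>\<in>space \<Omega>. D 0 \<omega> = 0 \<and> mono_on {0..} (\<lambda>t. D t \<omega>) \<and>
        (\<forall>t\<ge>0. continuous (at_right t) (\<lambda>s. D s \<omega>))) \<and>
     independent_increments \<Omega> D \<and>
     (\<forall>s t. 0 \<le> s \<longrightarrow> s \<le> t \<longrightarrow>
        distr \<Omega> borel (\<lambda>\<omega>. D t \<omega> - D s \<omega>) = distr \<Omega> borel (D (t - s))) \<and>
     sets \<Lambda> = sets borel \<and> (AE x in \<Lambda>. 0 < x) \<and> integrable \<Lambda> (\<lambda>x. min 1 x) \<and>
     (\<forall>t\<ge>0. \<forall>s\<ge>0. (\<integral>\<omega>. exp (- s * D t \<omega>) \<partial>\<Omega>) =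
        exp (- t * (b * s + (\<integral>x. 1 - exp (- s * x) \<partial>\<Lambda>))))"

definition stable_levy_measure :: "real \<Rightarrow> real measure" where
  "stable_levy_measure \<beta> = density lborel
     (\<lambda>x. ennreal (indicator {0<..} x * (\<beta> / Gamma (1 - \<beta>) * x powr (- 1 - \<beta>))))"

definition stable_subordinator :: "'a measure \<Rightarrow> real \<Rightarrow> (real \<Rightarrow> 'a \<Rightarrow> real) \<Rightarrow> bool" where
  "stable_subordinator \<Omega> \<beta> D \<longleftrightarrow> subordinator \<Omega> 0 (stable_levy_measure \<beta>) D"

definition inverse_process :: "(real \<Rightarrow> 'a \<Rightarrow> real) \<Rightarrow> real \<Rightarrow> 'a \<Rightarrow> real" where
  "inverse_process D t \<omega> = Inf {s. 0 \<le> s \<and> t < D s \<omega>}"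

text \<open>The pure birth process started in state 1, described by its holding times: \<open>\<xi> k\<close> is the
  (exponential) time spent in state \<open>k\<close>, so state \<open>n\<close> is entered at time \<open>\<xi> 1 + \<dots> + \<xi> (n - 1)\<close>.
  The rates are arbitrary, so the process may explode; from the explosion time on it has the
  value \<open>\<infinity>\<close>. At negative times, where it plays no role, the formula gives the constant 0.\<close>

definition pure_birth_process ::
  "'a measure \<Rightarrow> (nat \<Rightarrow> real) \<Rightarrow> (real \<Rightarrow> 'a \<Rightarrow> enat) \<Rightarrow> bool" where
  "pure_birth_process \<Omega> rate Y \<longleftrightarrow>
     (\<exists>\<xi> :: nat \<Rightarrow> 'a \<Rightarrow> real.
        prob_space.indep_vars \<Omega> (\<lambda>_. borel) \<xi> {1..} \<and>
        (\<forall>k\<ge>1. distributed \<Omega> lborel (\<xi> k) (\<lambda>x. ennreal (exponential_density (rate k) x))) \<and>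
        (\<forall>k\<ge>1. \<forall>\<omega>\<in>space \<Omega>. 0 < \<xi> k \<omega>) \<and>
        (\<forall>t. \<forall>\<omega>\<in>space \<Omega>.
           Y t \<omega> = (SUP n \<in> {n. 1 \<le> n \<and> (\<Sum>j=1..<n. \<xi> j \<omega>) \<le> t}. enat n)))"

section \<open>The generalized Yule model\<close>

definition fractional_birth_process ::
  "'a measure \<Rightarrow> real \<Rightarrow> (nat \<Rightarrow> real) \<Rightarrow> (real \<Rightarrow> 'a \<Rightarrow> enat) \<Rightarrow> bool" where
  "fractional_birth_process \<Omega> \<beta> rate Z \<longleftrightarrow>
     (\<exists>Y D. pure_birth_process \<Omega> rate Y \<and> stable_subordinator \<Omega> \<beta> D \<and>
        prob_space.indep_set \<Omega>
          (sigma_process \<Omega> (count_space UNIV) Y) (sigma_process \<Omega> borel D) \<and>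
        (\<forall>t\<ge>0. \<forall>\<omega>\<in>space \<Omega>. Z t \<omega> = Y (inverse_process D t \<omega>) \<omega>))"

definition genera_mixing_density :: "real \<Rightarrow> real \<Rightarrow> real" where
  "genera_mixing_density \<nu> w =
     indicator {0<..} w * (1 / Gamma (1 + \<nu>) * wright (- \<nu>) (1 - \<nu>) (- w / Gamma (1 + \<nu>)))"

definition genera_process ::
  "'a measure \<Rightarrow> real \<Rightarrow> real \<Rightarrow> (real \<Rightarrow> 'a \<Rightarrow> nat) \<Rightarrow> bool" where
  "genera_process \<Omega> \<nu> \<mu> M \<longleftrightarrow>
     (\<exists>N W. poisson_process \<Omega> 1 N \<and>
        distributed \<Omega> lborel W (\<lambda>w. ennreal (genera_mixing_density \<nu> w)) \<and>
        (\<forall>\<omega>\<in>space \<Omega>. 0 \<le> W \<omega>) \<and>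
        prob_space.indep_set \<Omega>
          (sigma_process \<Omega> (count_space UNIV) N) (sigma_rv \<Omega> borel W) \<and>
        (\<forall>t\<ge>0. \<forall>\<omega>\<in>space \<Omega>. M t \<omega> = N (W \<omega> * (\<mu> * t powr \<nu> / Gamma (1 + \<nu>))) \<omega>))"

text \<open>The \<open>i\<close>-th jump time of a counting process, \<open>i \<ge> 1\<close>.\<close>

definition jump_time :: "(real \<Rightarrow> 'a \<Rightarrow> nat) \<Rightarrow> nat \<Rightarrow> 'a \<Rightarrow> real" where
  "jump_time M i \<omega> = Inf {s. 0 \<le> s \<and> i \<le> M s \<omega>}"

text \<open>\<open>Z i\<close> is the species process of the \<open>i\<close>-th genus, \<open>i \<ge> 1\<close>, in the time since its appearance.\<close>

definition yule_model ::
  "'a measure \<Rightarrow> real \<Rightarrow> real \<Rightarrow> real \<Rightarrow> (nat \<Rightarrow> real) \<Rightarrow>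
     (real \<Rightarrow> 'a \<Rightarrow> nat) \<Rightarrow> (nat \<Rightarrow> real \<Rightarrow> 'a \<Rightarrow> enat) \<Rightarrow> bool" where
  "yule_model \<Omega> \<nu> \<mu> \<beta> rate M Z \<longleftrightarrow>
     genera_process \<Omega> \<nu> \<mu> M \<and>
     (\<forall>i\<ge>1. fractional_birth_process \<Omega> \<beta> rate (Z i)) \<and>
     prob_space.indep_sets \<Omega>
       (\<lambda>i. if i = 0 then sigma_process \<Omega> (count_space UNIV) M
            else sigma_process \<Omega> (count_space UNIV) (Z i)) UNIV"

definition sigma_yule ::
  "'a measure \<Rightarrow> (real \<Rightarrow> 'a \<Rightarrow> nat) \<Rightarrow> (nat \<Rightarrow> real \<Rightarrow> 'a \<Rightarrow> enat) \<Rightarrow> 'a set set" where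
  "sigma_yule \<Omega> M Z = sigma_sets (space \<Omega>)
     (sigma_process \<Omega> (count_space UNIV) M \<union>
      (\<Union>i\<in>{1..}. sigma_process \<Omega> (count_space UNIV) (Z i)))"

text \<open>Given \<open>K = n \<ge> 1\<close>, the index \<open>I\<close> is uniform on \<open>{1..n}\<close> and conditionally independent of the
  sigma-algebra \<open>G\<close>.\<close>

definition uniform_choice ::
  "'a measure \<Rightarrow> 'a set set \<Rightarrow> ('a \<Rightarrow> nat) \<Rightarrow> ('a \<Rightarrow> nat) \<Rightarrow> bool" where
  "uniform_choice \<Omega> G K I \<longleftrightarrow>
     I \<in> measurable \<Omega> (count_space UNIV) \<and>
     (\<forall>\<omega>\<in>space \<Omega>. 1 \<le> K \<omega> \<longrightarrow> I \<omega> \<in> {1..K \<omega>}) \<and>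
     (\<forall>n\<ge>1. \<forall>i\<in>{1..n}. \<P>(\<omega> in \<Omega>. I \<omega> = i \<bar> K \<omega> = n) = 1 / real n) \<and>
     (\<forall>n\<ge>1. \<forall>i. \<forall>A\<in>G. \<P>(\<omega> in \<Omega>. I \<omega> = i \<and> \<omega> \<in> A \<bar> K \<omega> = n) =
        \<P>(\<omega> in \<Omega>. I \<omega> = i \<bar> K \<omega> = n) * \<P>(\<omega> in \<Omega>. \<omega> \<in> A \<bar> K \<omega> = n))"

text \<open>The number of species at time \<open>t\<close> in the genus with index \<open>I\<close>.\<close>

definition chosen_genus_size ::
  "(real \<Rightarrow> 'a \<Rightarrow> nat) \<Rightarrow> (nat \<Rightarrow> real \<Rightarrow> 'a \<Rightarrow> enat) \<Rightarrow> ('a \<Rightarrow> nat) \<Rightarrow> real \<Rightarrow> 'a \<Rightarrow> enat" where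
  "chosen_genus_size M Z I t \<omega> = Z (I \<omega>) (t - jump_time M (I \<omega>) \<omega>) \<omega>"

end

(*
  A general substitution principle does the conditioning: if a right-continuous family of events
  A(s) is independent of a random time T, then P(A(T)) = E[p(T)] with p(s) = P(A(s)). It is obtained
  by approximating T from the right on a grid, so no joint measurability or product space is needed.

  Applied to the Poisson process and its mixing variable W, it shows that the genera existing at
  time s, given n genera at time t, are binomial with success probability (s/t)^nu; the law of W is
  irrelevant. Hence the relative appearance time U of a uniformly chosen genus has distribution
  function u^nu.

  Applied to the pure birth process and the inverse stable subordinator E_s, it reduces the law of
  the species process to E[exp(-c E_s)]. Since the moments of exp(-D_x) determine its law, D_x and
  x^(1/beta) D_1 are equidistributed, so E_s has the law of (s / D_1)^beta; the negative moments of
  D_1 come from Fubini, and summing the exponential series gives E_{beta,1}(-c s^beta).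

  Applied to the chosen genus, it gives P(size = k) as the integral of the species law at age
  t (1 - U), and termwise Beta integrals turn E_{beta,1} into Gamma(nu+1) E_{beta,nu+1}.
*)
theory Submission
  imports Defs
begin

text \<open>Independence is given only for sigma-algebras generated by the values at fixed times, so
  nothing is known about a process jointly in time and outcome. Discrete state spaces and
  right-continuous paths make evaluation at a random time possible all the same. Both random times
  are first passage times, and a level event is not an event about the infimum defining the passage
  time T. It only lies between {T < y} and {T \<le> y}: this is so for {s < D_y} and the inverse
  subordinator, and for {I \<le> M_(x t)} and the appearance time of the chosen genus. One sandwich
  criterion for distribution functions handles both. The denominators of the theorem come from the
  partial fractions of the product of 1/(r_l - z), the shape of the Laplace transform of a sum of
  independent exponentials; distinct rates mean simple poles. Each birth probability is thus a fixed
  linear combination of exp(-r_m x). Both randomizations of time act linearly, so they transform the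
  exponentials and leave the coefficients alone.\<close>

section \<open>Sums of independent exponential variables\<close>

text \<open>The partial fraction decomposition of the product of 1/(r_l - z) as a function of z. The
  point z stays arbitrary in the induction because adding a node \<open>a\<close> uses the induction
  hypothesis twice, at z and at \<open>r a\<close>.\<close>

lemma partial_fractions_distinct:
  fixes z :: "'b :: field"
  assumes "finite A" "inj_on r A" "\<And>m. m \<in> A \<Longrightarrow> r m \<noteq> z"
  shows "(\<Sum>m\<in>A. 1 / ((r m - z) * (\<Prod>l\<in>A - {m}. r l - r m))) = (if A = {} then 0 else 1 / (\<Prod>l\<in>A. r l - z))"
  using assms
proof (induction A arbitrary: z rule: finite_induct)
  case empty
  then show ?case by simp
next
  case (insert a A)
  show ?case
  proof (cases "A = {}")
    case True
    then show ?thesis by simp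
  next
    case False
    have az: "r a \<noteq> z" and Az: "\<And>m. m \<in> A \<Longrightarrow> r m \<noteq> z" using insert.prems by auto
    have Aa: "r m \<noteq> r a" if "m \<in> A" for m using insert that by (auto simp: inj_on_def)
    have inj: "inj_on r A" using insert.prems by auto
    define c where "c m = (\<Prod>l\<in>A - {m}. r l - r m)" for m
    have c0: "c m \<noteq> 0" if "m \<in> A" for m
      using inj that insert.hyps by (auto simp: c_def inj_on_def)
    have 1: "(\<Prod>l\<in>insert a A - {m}. r l - r m) = (r a - r m) * c m" if "m \<in> A" for m
    proof -
      have "insert a A - {m} = insert a (A - {m})" using that insert.hyps by auto
      then show ?thesis using insert.hyps by (simp add: c_def)
    qed
    have 2: "insert a A - {a} = A" using insert.hyps by auto
    have IHz: "(\<Sum>m\<in>A. 1 / ((r m - z) * c m)) = 1 / (\<Prod>l\<in>A. r l - z)"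
      using insert.IH[OF inj Az] False by (simp add: c_def)
    have IHa: "(\<Sum>m\<in>A. 1 / ((r m - r a) * c m)) = 1 / (\<Prod>l\<in>A. r l - r a)"
      using insert.IH[OF inj Aa] False by (simp add: c_def)
    have "(\<Sum>m\<in>insert a A. 1 / ((r m - z) * (\<Prod>l\<in>insert a A - {m}. r l - r m)))
       = 1 / ((r a - z) * (\<Prod>l\<in>A. r l - r a)) + (\<Sum>m\<in>A. 1 / ((r m - z) * ((r a - r m) * c m)))"
      using insert.hyps 1 by (simp add: 2)
    \<comment> \<open>The two factors r_m - z and r_a - r_m add up to r_a - z, which does not depend
      on m. So each summand splits into one for the point z and one for the point r_a, with a common
      denominator.\<close>
    also have "(\<Sum>m\<in>A. 1 / ((r m - z) * ((r a - r m) * c m)))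
       = (\<Sum>m\<in>A. (1 / ((r m - z) * c m) - 1 / ((r m - r a) * c m)) / (r a - z))"
    proof (rule sum.cong[OF refl])
      fix m assume m: "m \<in> A"
      have eq: "1 / (x * (y * c)) = (1 / (x * c) - 1 / ((- y) * c)) / (x + y)" if "x \<noteq> 0" "y \<noteq> 0" "c \<noteq> 0" "x + y \<noteq> 0" for x y c :: 'b
      proof -
        have "1 / (x * c) - 1 / ((- y) * c) = (x + y) * (1 / (x * (y * c)))"
          using that by (simp add: field_simps)
        then show ?thesis using that by simp
      qed
      show "1 / ((r m - z) * ((r a - r m) * c m)) = (1 / ((r m - z) * c m) - 1 / ((r m - r a) * c m)) / (r a - z)"
        using eq[of "r m - z" "r a - r m" "c m"] Az[OF m] Aa[OF m] c0[OF m] az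
        by (simp only: minus_diff_eq) (simp add: eq_commute[of "r a" "r m"])
    qed
    \<comment> \<open>The second quotient cancels the summand of the new node
      \<open>a\<close>.\<close>
    also have "\<dots> = (1 / (\<Prod>l\<in>A. r l - z) - 1 / (\<Prod>l\<in>A. r l - r a)) / (r a - z)"
      by (simp only: sum_divide_distrib[symmetric] sum_subtractf IHz IHa)
    finally show ?thesis using insert.hyps by (simp add: diff_divide_distrib mult.commute)
  qed
qed

text \<open>The partial fraction coefficients of the preceding lemma; for n = k they are the
  reciprocals of the denominators in the theorem.\<close>

definition hypoexp_coeff :: "(nat \<Rightarrow> real) \<Rightarrow> nat \<Rightarrow> nat \<Rightarrow> real" where
  "hypoexp_coeff r n m = 1 / (\<Prod>l\<in>{1..n} - {m}. r l - r m)"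

text \<open>The coefficients have mixed signs, so nonnegativity cannot be read off; it is carried
  through the induction over the number of summands.\<close>

definition hypoexp_density :: "(nat \<Rightarrow> real) \<Rightarrow> nat \<Rightarrow> real \<Rightarrow> real" where
  "hypoexp_density r n x = (if x < 0 then 0
     else (\<Prod>j=1..n. r j) * (\<Sum>m=1..n. exp (- r m * x) * hypoexp_coeff r n m))"

lemma hypoexp_coeff_Suc:
  assumes "m \<in> {1..n}"
  shows "hypoexp_coeff r (Suc n) m = hypoexp_coeff r n m / (r (Suc n) - r m)"
proof -
  have "{1..Suc n} - {m} = insert (Suc n) ({1..n} - {m})" using assms by auto
  then show ?thesis by (simp add: hypoexp_coeff_def)
qed

text \<open>Partial fractions at the point z = r_(n+1). Equivalently, the n + 1 coefficients add up
  to zero: the density of at least two summands vanishes at 0.\<close>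

lemma hypoexp_coeff_Suc_last:
  assumes "inj_on r {1..}" "n \<ge> 1"
  shows "hypoexp_coeff r (Suc n) (Suc n) = - (\<Sum>m=1..n. hypoexp_coeff r n m / (r (Suc n) - r m))"
proof -
  have "(\<Sum>m\<in>{1..n}. 1 / ((r m - r (Suc n)) * (\<Prod>l\<in>{1..n} - {m}. r l - r m))) = 1 / (\<Prod>l\<in>{1..n}. r l - r (Suc n))"
  proof (subst partial_fractions_distinct)
    show "inj_on r {1..n}" using assms(1) by (rule inj_on_subset) auto
    show "r m \<noteq> r (Suc n)" if "m \<in> {1..n}" for m
      using inj_onD[OF assms(1), of m "Suc n"] that by auto
  qed (use assms in auto)
  moreover have "{1..Suc n} - {Suc n} = {1..n}" by auto
  moreover have "(\<Sum>m\<in>{1..n}. 1 / ((r m - r (Suc n)) * (\<Prod>l\<in>{1..n} - {m}. r l - r m)))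
      = (\<Sum>m=1..n. - (hypoexp_coeff r n m / (r (Suc n) - r m)))"
  proof (rule sum.cong[OF refl])
    fix m
    have "1 / ((r m - r (Suc n)) * p) = - (1 / p / (r (Suc n) - r m))" for p
      by (metis (no_types, opaque_lifting) divide_divide_eq_left minus_diff_eq minus_divide_right mult.commute)
    then show "1 / ((r m - r (Suc n)) * (\<Prod>l\<in>{1..n} - {m}. r l - r m)) = - (hypoexp_coeff r n m / (r (Suc n) - r m))"
      by (simp add: hypoexp_coeff_def)
  qed
  ultimately show ?thesis by (simp add: hypoexp_coeff_def sum_negf)
qed

text \<open>On [0, x] the integrand is a combination of exponentials in y with antiderivative
  \<open>F\<close>. The upper end contributes multiples of exp(-r_(n+1) x), whose total is given by
  \<open>hypoexp_coeff_Suc_last\<close>; the lower end contributes the exp(-r_m x), with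
  coefficients from \<open>hypoexp_coeff_Suc\<close>.\<close>

lemma hypoexp_convolution:
  assumes r: "\<And>j. j \<ge> 1 \<Longrightarrow> 0 < r j" "inj_on r {1..}" and n: "n \<ge> 1"
    and nn: "\<And>y. 0 \<le> hypoexp_density r n y"
  shows "(\<integral>\<^sup>+y. ennreal (hypoexp_density r n (x - y)) * ennreal (exponential_density (r (Suc n)) y) \<partial>lborel)
      = ennreal (hypoexp_density r (Suc n) x)" 
    and "0 \<le> hypoexp_density r (Suc n) x"
proof -
  let ?a = "r (Suc n)" and ?C = "\<Prod>j=1..n. r j"
  have a: "0 < ?a" using r by simp
  have ne: "?a \<noteq> r m" if "m \<in> {1..n}" for m using inj_onD[OF r(2), of "Suc n" m] that by auto
  define F where "F y = (\<Sum>m=1..n. ?C * ?a * hypoexp_coeff r n m * exp (- r m * x) * exp ((r m - ?a) * y) / (r m - ?a))" for y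
  have conv: "(\<integral>\<^sup>+y. ennreal (hypoexp_density r n (x - y)) * ennreal (exponential_density ?a y) \<partial>lborel)
      = ennreal (F x - F 0) \<and> F 0 \<le> F x" if x: "0 \<le> x"
  proof -
    define f where "f y = ?C * (\<Sum>m=1..n. exp (- r m * (x - y)) * hypoexp_coeff r n m) * (?a * exp (- ?a * y))" for y
    have f: "f y = hypoexp_density r n (x - y) * exponential_density ?a y" if "0 \<le> y" "y \<le> x" for y
      using that by (simp add: f_def hypoexp_density_def exponential_density_def mult_ac)
    have f0: "0 \<le> f y" if "0 \<le> y" "y \<le> x" for y
      unfolding f[OF that] using nn that a by (auto simp: exponential_density_def)
    have dF: "(F has_real_derivative f y) (at y within S)" for y S
    proof -
      have e: "exp (- r m * x) * exp ((r m - ?a) * y) = exp (- r m * (x - y)) * exp (- ?a * y)" for m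
        by (simp add: exp_add[symmetric] algebra_simps)
      have "(F has_real_derivative (\<Sum>m=1..n. ?C * ?a * hypoexp_coeff r n m * exp (- r m * x) * exp ((r m - ?a) * y))) (at y within S)"
        unfolding F_def
      proof (rule DERIV_sum)
        fix m assume "m \<in> {1..n}"
        then have "r m - ?a \<noteq> 0" using ne by force
        then show "((\<lambda>y. ?C * ?a * hypoexp_coeff r n m * exp (- r m * x) * exp ((r m - ?a) * y) / (r m - ?a)) has_real_derivative
            ?C * ?a * hypoexp_coeff r n m * exp (- r m * x) * exp ((r m - ?a) * y)) (at y within S)"
          by (auto intro!: derivative_eq_intros)
      qed
      also have "(\<Sum>m=1..n. ?C * ?a * hypoexp_coeff r n m * exp (- r m * x) * exp ((r m - ?a) * y))
          = (\<Sum>m=1..n. ?C * ?a * hypoexp_coeff r n m * (exp (- r m * (x - y)) * exp (- ?a * y)))"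
        by (simp only: mult.assoc e)
      also have "\<dots> = f y"
        unfolding f_def by (simp add: sum_distrib_left sum_distrib_right mult_ac)
      finally show ?thesis .
    qed
    have "(\<integral>\<^sup>+y. ennreal (hypoexp_density r n (x - y)) * ennreal (exponential_density ?a y) \<partial>lborel)
      = (\<integral>\<^sup>+y. ennreal (f y) * indicator {0..x} y \<partial>lborel)"
    proof (rule nn_integral_cong)
      fix y
      consider "0 \<le> y \<and> y \<le> x" | "y < 0" | "x < y" by linarith
      then show "ennreal (hypoexp_density r n (x - y)) * ennreal (exponential_density ?a y) = ennreal (f y) * indicator {0..x} y"
      proof cases
        case 1
        then show ?thesis using f[of y] nn by (simp add: ennreal_mult')
      qed (use x in \<open>auto simp: hypoexp_density_def exponential_density_def\<close>)
    qed
    also have "\<dots> = ennreal (F x - F 0)"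
      using dF f0 x by (intro nn_integral_FTC_Icc) (auto simp: f_def)
    finally show ?thesis
    proof
      show "F 0 \<le> F x"
        by (rule DERIV_nonneg_imp_nondecreasing[OF x]) (use dF f0 in blast)
    qed
  qed
  have val: "F x - F 0 = hypoexp_density r (Suc n) x" if x: "0 \<le> x"
  proof -
    have "F x - F 0 = (\<Sum>m=1..n. ?C * ?a * (hypoexp_coeff r n m / (?a - r m)) * (exp (- r m * x) - exp (- ?a * x)))"
      unfolding F_def sum_subtractf[symmetric]
    proof (rule sum.cong[OF refl])
      fix m assume m: "m \<in> {1..n}"
      have e: "exp (- r m * x) * exp ((r m - ?a) * x) = exp (- ?a * x)"
        by (simp add: exp_add[symmetric] algebra_simps)
      have "K * h * E * e1 / (r m - ?a) - K * h * E * 1 / (r m - ?a) = K * (h / (?a - r m)) * (E - E * e1)" for K h E e1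
        using ne[OF m] by (auto simp: divide_simps) (auto simp: algebra_simps)
      from this[of "?C * ?a" "hypoexp_coeff r n m" "exp (- r m * x)" "exp ((r m - ?a) * x)"]
      show "?C * ?a * hypoexp_coeff r n m * exp (- r m * x) * exp ((r m - ?a) * x) / (r m - ?a)
          - ?C * ?a * hypoexp_coeff r n m * exp (- r m * x) * exp ((r m - ?a) * 0) / (r m - ?a)
          = ?C * ?a * (hypoexp_coeff r n m / (?a - r m)) * (exp (- r m * x) - exp (- ?a * x))"
        unfolding e by (simp only: mult_zero_right exp_zero)
    qed
    also have "\<dots> = ?C * ?a * ((\<Sum>m=1..n. exp (- r m * x) * (hypoexp_coeff r n m / (?a - r m))) - exp (- ?a * x) * (\<Sum>m=1..n. hypoexp_coeff r n m / (?a - r m)))"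
      by (simp add: sum_distrib_left sum_subtractf right_diff_distrib diff_divide_distrib mult_ac)
    also have "\<dots> = ?C * ?a * ((\<Sum>m=1..n. exp (- r m * x) * hypoexp_coeff r (Suc n) m) + exp (- ?a * x) * hypoexp_coeff r (Suc n) (Suc n))"
      using hypoexp_coeff_Suc_last[OF r(2) n] hypoexp_coeff_Suc[of _ n r] by simp
    also have "\<dots> = hypoexp_density r (Suc n) x"
      using x by (simp add: hypoexp_density_def)
    finally show ?thesis .
  qed
  show "(\<integral>\<^sup>+y. ennreal (hypoexp_density r n (x - y)) * ennreal (exponential_density ?a y) \<partial>lborel)
      = ennreal (hypoexp_density r (Suc n) x)"
  proof (cases "0 \<le> x")
    case True
    then show ?thesis using conv val by simp
  next
    case False
    then have "ennreal (hypoexp_density r n (x - y)) * ennreal (exponential_density ?a y) = 0" for y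
      by (auto simp: hypoexp_density_def exponential_density_def)
    then show ?thesis using False by (simp only:) (simp add: hypoexp_density_def)
  qed
  show "0 \<le> hypoexp_density r (Suc n) x"
    using conv val by (cases "0 \<le> x") (auto simp: hypoexp_density_def)
qed

lemma hypoexp_density_measurable [measurable]: "hypoexp_density r n \<in> borel_measurable borel"
  unfolding hypoexp_density_def[abs_def] by measurable

lemma (in prob_space) indep_set_commute: "indep_set A B \<Longrightarrow> indep_set B A"
  unfolding indep_sets2_eq by (metis Int_commute mult.commute)

lemma (in prob_space) sum_exponentials_distributed:
  assumes r: "\<And>j. j \<ge> 1 \<Longrightarrow> 0 < r j" "inj_on r {1..}"
    and ind: "indep_vars (\<lambda>_. borel) \<xi> {1..}"
    and dist: "\<And>k. k \<ge> 1 \<Longrightarrow> distributed M lborel (\<xi> k) (\<lambda>x. ennreal (exponential_density (r k) x))"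
    and n: "n \<ge> 1"
  shows "distributed M lborel (\<lambda>\<omega>. \<Sum>j=1..n. \<xi> j \<omega>) (\<lambda>x. ennreal (hypoexp_density r n x)) \<and> (\<forall>x. 0 \<le> hypoexp_density r n x)"
  using n
proof (induction n rule: dec_induct)
  case base
  have "hypoexp_density r 1 = exponential_density (r 1)"
    by (auto simp: fun_eq_iff hypoexp_density_def exponential_density_def hypoexp_coeff_def mult_ac)
  then show ?case using dist[of 1] r(1)[of 1] by (simp add: exponential_density_def)
next
  case (step n)
  have iv: "indep_vars (\<lambda>_. borel) \<xi> (insert (Suc n) {1..n})"
    by (rule indep_vars_subset[OF ind]) auto
  have "indep_var borel (\<xi> (Suc n)) borel (\<lambda>\<omega>. \<Sum>j=1..n. \<xi> j \<omega>)"
    by (rule indep_vars_sum[OF _ _ iv]) auto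
  then have iv': "indep_var borel (\<lambda>\<omega>. \<Sum>j=1..n. \<xi> j \<omega>) borel (\<xi> (Suc n))"
    unfolding indep_var_eq using indep_set_commute by auto
  have dS: "distributed M lborel (\<lambda>\<omega>. (\<Sum>j=1..n. \<xi> j \<omega>) + \<xi> (Suc n) \<omega>)
     (\<lambda>x. \<integral>\<^sup>+y. ennreal (hypoexp_density r n (x - y)) * ennreal (exponential_density (r (Suc n)) y) \<partial>lborel)"
    using step.IH dist[of "Suc n"] by (intro distributed_convolution iv') auto
  then show ?case
    using hypoexp_convolution[OF r step.hyps(1)] step.IH by simp
qed

text \<open>Dividing each term of the density by -r_m gives an antiderivative \<open>F\<close> with
  F(0) = -1, so 1 - (F(x) - F(0)) is just -F(x).\<close>

lemma (in prob_space) sum_exponentials_tail: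
  assumes r: "\<And>j. j \<ge> 1 \<Longrightarrow> 0 < r j" "inj_on r {1..}"
    and ind: "indep_vars (\<lambda>_. borel) \<xi> {1..}"
    and dist: "\<And>k. k \<ge> 1 \<Longrightarrow> distributed M lborel (\<xi> k) (\<lambda>x. ennreal (exponential_density (r k) x))"
    and n: "n \<ge> 1" and x: "0 \<le> x"
  shows "prob {\<omega>\<in>space M. x < (\<Sum>j=1..n. \<xi> j \<omega>)} = (\<Prod>j=1..n. r j) * (\<Sum>m=1..n. exp (- r m * x) / r m * hypoexp_coeff r n m)"
proof -
  let ?S = "\<lambda>\<omega>. \<Sum>j=1..n. \<xi> j \<omega>"
  note * = sum_exponentials_distributed[OF r ind dist n]
  have D: "distributed M lborel ?S (\<lambda>x. ennreal (hypoexp_density r n x))" and nn: "\<And>x. 0 \<le> hypoexp_density r n x"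
    using * by auto
  have [measurable]: "?S \<in> borel_measurable M" using distributed_measurable[OF D] by simp
  define F where "F x = - ((\<Prod>j=1..n. r j) * (\<Sum>m=1..n. exp (- r m * x) / r m * hypoexp_coeff r n m))" for x
  define g where "g y = (\<Prod>j=1..n. r j) * (\<Sum>m=1..n. exp (- r m * y) * hypoexp_coeff r n m)" for y
  have g: "hypoexp_density r n y = g y" if "0 \<le> y" for y
    using that by (simp add: g_def hypoexp_density_def)
  have g0: "0 \<le> g y" if "0 \<le> y" for y using nn[of y] g[OF that] by simp
  have dF: "(F has_real_derivative g y) (at y within S)" for y S
    unfolding F_def g_def
    using r(1) by (auto intro!: derivative_eq_intros simp: sum_negf less_imp_neq[symmetric])
  have "emeasure M (?S -` {..x} \<inter> space M) = (\<integral>\<^sup>+y. ennreal (hypoexp_density r n y) * indicator {..x} y \<partial>lborel)"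
    using D by (rule distributed_emeasure) auto
  also have "\<dots> = (\<integral>\<^sup>+y. ennreal (g y) * indicator {0..x} y \<partial>lborel)"
    by (intro nn_integral_cong) (auto simp: indicator_def hypoexp_density_def g_def)
  also have "\<dots> = ennreal (F x - F 0)"
    using dF g0 x by (intro nn_integral_FTC_Icc) (auto simp: g_def)
  finally have "emeasure M (?S -` {..x} \<inter> space M) = ennreal (F x - F 0)" .
  moreover have "F 0 \<le> F x"
    by (rule DERIV_nonneg_imp_nondecreasing[OF x]) (use dF g0 in blast)
  ultimately have le: "prob (?S -` {..x} \<inter> space M) = F x - F 0"
    by (simp add: emeasure_eq_measure)
  \<comment> \<open>Partial fractions at z = 0: this is the statement that the density has total
    mass one.\<close>
  have "(\<Sum>m\<in>{1..n}. 1 / ((r m - 0) * (\<Prod>l\<in>{1..n} - {m}. r l - r m))) = 1 / (\<Prod>l\<in>{1..n}. r l - 0)"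
    using r n by (subst partial_fractions_distinct) (auto simp: inj_on_def less_imp_neq[symmetric])
  moreover have "(\<Prod>l\<in>{1..n}. r l) \<noteq> 0" using r(1) by (auto simp: less_imp_neq[symmetric])
  ultimately have F0: "F 0 = - 1"
    by (simp add: F_def hypoexp_coeff_def)
  have "prob {\<omega>\<in>space M. x < ?S \<omega>} = prob (space M - (?S -` {..x} \<inter> space M))"
    by (rule arg_cong[where f=prob]) auto
  also have "\<dots> = 1 - (F x - F 0)"
    by (subst prob_compl[OF measurable_sets[OF \<open>?S \<in> borel_measurable M\<close>]]) (simp_all only: le atMost_borel)
  finally show ?thesis unfolding F0 by (simp add: F_def)
qed


section \<open>Substituting an independent random time\<close>

text \<open>The \<open>+ 1\<close> places the grid point strictly to the right of x, hence at a
  positive time even when x = 0. The substitution principle can therefore do with independence at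
  positive times.\<close>

lemma floor_grid_limit:
  fixes x :: real
  assumes "0 \<le> x"
  defines "g \<equiv> \<lambda>n. (real (nat \<lfloor>real (Suc n) * x\<rfloor>) + 1) / real (Suc n)"
  shows "x < g n" "g n \<le> x + 1 / real (Suc n)"
proof -
  have f: "real (nat \<lfloor>real (Suc n) * x\<rfloor>) = of_int \<lfloor>real (Suc n) * x\<rfloor>" using assms by simp
  have "real (Suc n) * x < of_int \<lfloor>real (Suc n) * x\<rfloor> + 1" by linarith
  then show "x < g n" unfolding g_def f by (simp add: field_simps)
  have "of_int \<lfloor>real (Suc n) * x\<rfloor> + 1 \<le> real (Suc n) * x + 1" by linarith
  then have "g n \<le> (real (Suc n) * x + 1) / real (Suc n)" unfolding g_def f by (intro divide_right_mono) auto
  then show "g n \<le> x + 1 / real (Suc n)" by (simp add: add_divide_distrib)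
qed

text \<open>The event \<open>B\<close> leaves \<tau> free elsewhere: there a first passage time may
  be an unspecified infimum, and a chosen genus need not exist. Right continuity has the form suited
  to discrete states: membership does not change on a short interval to the right.\<close>

lemma (in prob_space) random_time_substitution:
  fixes A :: "real \<Rightarrow> 'a set" and \<tau> :: "'a \<Rightarrow> real"
  assumes B[measurable]: "B \<in> events" and \<tau>[measurable]: "\<tau> \<in> borel_measurable M"
    and \<tau>B: "\<And>\<omega>. \<omega> \<in> B \<Longrightarrow> 0 \<le> \<tau> \<omega>"
    and A: "\<And>s. 0 \<le> s \<Longrightarrow> A s \<in> events"
    and rc: "\<And>\<omega> s. \<omega> \<in> space M \<Longrightarrow> 0 \<le> s \<Longrightarrow> \<exists>\<delta>>0. \<forall>s'. s \<le> s' \<and> s' < s + \<delta> \<longrightarrow> (\<omega> \<in> A s' \<longleftrightarrow> \<omega> \<in> A s)"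
    and ind: "\<And>s J. 0 < s \<Longrightarrow> J \<in> sets borel \<Longrightarrow> prob (A s \<inter> (\<tau> -` J \<inter> B)) = prob (A s) * prob (\<tau> -` J \<inter> B)"
  shows "{\<omega>\<in>B. \<omega> \<in> A (\<tau> \<omega>)} \<in> events"
    and "(\<lambda>\<omega>. indicator B \<omega> * prob (A (\<tau> \<omega>))) \<in> borel_measurable M"
    and "prob {\<omega>\<in>B. \<omega> \<in> A (\<tau> \<omega>)} = (\<integral>\<omega>. indicator B \<omega> * prob (A (\<tau> \<omega>)) \<partial>M)"
proof -
  define q :: "nat \<Rightarrow> real \<Rightarrow> nat" where "q n x = nat \<lfloor>real (Suc n) * x\<rfloor>" for n x
  define g :: "nat \<Rightarrow> nat \<Rightarrow> real" where "g n j = (real j + 1) / real (Suc n)" for n j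
  have gpos: "0 < g n j" for n j by (simp add: g_def)
  then have g0: "0 \<le> g n j" for n j by (rule less_imp_le)
  note gl = floor_grid_limit[folded q_def, folded g_def]
  have Bs: "B \<subseteq> space M" using sets.sets_into_space[OF B] .
  have ev: "\<forall>\<^sub>F n in sequentially. \<omega> \<in> A (g n (q n x)) \<longleftrightarrow> \<omega> \<in> A x" if \<omega>: "\<omega> \<in> space M" and x: "0 \<le> x" for \<omega> x
  proof -
    obtain d where d: "d > 0" "\<forall>s'. x \<le> s' \<and> s' < x + d \<longrightarrow> (\<omega> \<in> A s' \<longleftrightarrow> \<omega> \<in> A x)" using rc[OF \<omega> x] by blast
    obtain n0 where n0: "inverse (real (Suc n0)) < d" using reals_Archimedean[OF d(1)] by blast
    have "\<omega> \<in> A (g n (q n x)) \<longleftrightarrow> \<omega> \<in> A x" if "n \<ge> n0" for n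
    proof -
      have "1 / real (Suc n) \<le> inverse (real (Suc n0))"
        unfolding inverse_eq_divide using that by (intro divide_left_mono) auto
      then have "x \<le> g n (q n x) \<and> g n (q n x) < x + d" using gl[OF x, of n] n0 by linarith
      then show ?thesis using d(2) by blast
    qed
    then show ?thesis unfolding eventually_sequentially by blast
  qed
  have [measurable]: "A (g n j) \<in> events" for n j using A g0 by auto
  have q_meas[measurable]: "q n \<in> measurable borel (count_space UNIV)" for n
    unfolding q_def[abs_def] by measurable
  have plim: "(\<lambda>n. prob (A (g n (q n x)))) \<longlonglongrightarrow> prob (A x)" if x: "0 \<le> x" for x
  proof -
    have "(\<lambda>n. \<integral>\<omega>. indicator (A (g n (q n x))) \<omega> \<partial>M) \<longlonglongrightarrow> (\<integral>\<omega>. indicator (A x) \<omega> \<partial>M :: real)"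
    proof (rule integral_dominated_convergence[where w="\<lambda>_. 1"])
      show "AE \<omega> in M. (\<lambda>n. indicator (A (g n (q n x))) \<omega> :: real) \<longlonglongrightarrow> indicator (A x) \<omega>"
      proof (rule AE_I2)
        fix \<omega> assume "\<omega> \<in> space M"
        show "(\<lambda>n. indicator (A (g n (q n x))) \<omega> :: real) \<longlonglongrightarrow> indicator (A x) \<omega>"
          by (rule tendsto_eventually, rule eventually_mono[OF ev[OF \<open>\<omega> \<in> space M\<close> x]]) (auto simp: indicator_def)
      qed
    qed (use A[OF x] in \<open>auto simp: indicator_def\<close>)
    then show ?thesis using A[OF x] by simp
  qed
  \<comment> \<open>The outcomes whose time falls into grid cell j. There the approximating time is
    the constant \<open>g n j\<close>, so the independence hypothesis applies to a deterministic
    time.\<close>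
  define C where "C n j = (\<lambda>\<omega>. q n (\<tau> \<omega>)) -` {j} \<inter> B" for n j
  have [measurable]: "C n j \<in> events" for n j
  proof -
    have "C n j = {\<omega>\<in>space M. \<omega> \<in> B \<and> q n (\<tau> \<omega>) = j}" using Bs by (auto simp: C_def)
    then show ?thesis by simp
  qed
  define E where "E n = {\<omega>\<in>B. \<omega> \<in> A (g n (q n (\<tau> \<omega>)))}" for n
  have E_eq: "E n = (\<Union>j. A (g n j) \<inter> C n j)" for n by (auto simp: E_def C_def)
  have [measurable]: "E n \<in> events" for n unfolding E_eq by measurable
  have dC: "disjoint_family (C n)" for n by (auto simp: disjoint_family_on_def C_def)
  have pC: "prob (A (g n j) \<inter> C n j) = prob (A (g n j)) * prob (C n j)" for n j
  proof -
    have "C n j = \<tau> -` (q n -` {j}) \<inter> B" by (auto simp: C_def)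
    moreover have "q n -` {j} \<in> sets borel"
      using measurable_sets[OF q_meas, of "{j}" n] by simp
    ultimately show ?thesis using ind[OF gpos] by metis
  qed
  have m2[measurable]: "(\<lambda>\<omega>. prob (A (g n (q n (\<tau> \<omega>))))) \<in> borel_measurable M" for n
    by (rule measurable_compose[of "\<lambda>\<omega>. q n (\<tau> \<omega>)" M "count_space UNIV"]) simp_all
  have "emeasure M (E n) = (\<integral>\<^sup>+\<omega>. ennreal (indicator B \<omega> * prob (A (g n (q n (\<tau> \<omega>))))) \<partial>M)" for n
  proof -
    have "emeasure M (E n) = (\<Sum>j. emeasure M (A (g n j) \<inter> C n j))"
      unfolding E_eq using dC[of n] by (intro suminf_emeasure[symmetric]) (auto simp: disjoint_family_on_def)
    also have "\<dots> = (\<Sum>j. \<integral>\<^sup>+\<omega>. ennreal (prob (A (g n j))) * indicator (C n j) \<omega> \<partial>M)"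
      by (simp add: emeasure_eq_measure pC ennreal_mult nn_integral_cmult)
    also have "\<dots> = (\<integral>\<^sup>+\<omega>. (\<Sum>j. ennreal (prob (A (g n j))) * indicator (C n j) \<omega>) \<partial>M)"
      by (rule nn_integral_suminf[symmetric]) measurable
    also have "\<dots> = (\<integral>\<^sup>+\<omega>. ennreal (indicator B \<omega> * prob (A (g n (q n (\<tau> \<omega>))))) \<partial>M)"
    proof (rule nn_integral_cong)
      fix \<omega>
      show "(\<Sum>j. ennreal (prob (A (g n j))) * indicator (C n j) \<omega>) = ennreal (indicator B \<omega> * prob (A (g n (q n (\<tau> \<omega>)))))"
      proof (cases "\<omega> \<in> B")
        case True
        then have "\<omega> \<in> C n (q n (\<tau> \<omega>))" by (simp add: C_def)
        from suminf_cmult_indicator[OF dC this, of "\<lambda>j. ennreal (prob (A (g n j)))"] True show ?thesis by simp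
      next
        case False
        then show ?thesis by (auto simp: C_def)
      qed
    qed
    finally show ?thesis .
  qed
  then have En: "prob (E n) = (\<integral>\<omega>. indicator B \<omega> * prob (A (g n (q n (\<tau> \<omega>)))) \<partial>M)" for n
    by (subst integral_eq_nn_integral) (auto simp: measure_def)
  have pt: "(\<lambda>n. indicator B \<omega> * prob (A (g n (q n (\<tau> \<omega>))))) \<longlonglongrightarrow> indicator B \<omega> * prob (A (\<tau> \<omega>))" for \<omega>
    using plim[OF \<tau>B] by (cases "\<omega> \<in> B") auto
  \<comment> \<open>No regularity of s \<mapsto> P(A(s)) is assumed; measurability of its value at
    \<tau> is inherited from the countably valued approximations.\<close>
  show m: "(\<lambda>\<omega>. indicator B \<omega> * prob (A (\<tau> \<omega>))) \<in> borel_measurable M"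
    by (rule borel_measurable_LIMSEQ_real[OF pt]) measurable
  let ?L = "{\<omega>\<in>B. \<omega> \<in> A (\<tau> \<omega>)}"
  have iL: "(\<lambda>n. indicator (E n) \<omega> :: real) \<longlonglongrightarrow> indicator ?L \<omega>" if "\<omega> \<in> space M" for \<omega>
  proof (cases "\<omega> \<in> B")
    case True
    show ?thesis
      by (rule tendsto_eventually, rule eventually_mono[OF ev[OF \<open>\<omega> \<in> space M\<close> \<tau>B[OF True]]])
         (auto simp: indicator_def E_def True)
  next
    case False
    then show ?thesis by (simp add: E_def)
  qed
  have "(indicator ?L :: 'a \<Rightarrow> real) \<in> borel_measurable M"
    by (rule borel_measurable_LIMSEQ_real[OF iL]) measurable
  then have "?L \<inter> space M \<in> events" by (simp add: borel_measurable_indicator_iff)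
  moreover have "?L \<inter> space M = ?L" using Bs by auto
  ultimately show L[measurable]: "?L \<in> events" by simp
  have "(\<lambda>n. prob (E n)) \<longlonglongrightarrow> prob ?L"
  proof -
    have "(\<lambda>n. \<integral>\<omega>. indicator (E n) \<omega> \<partial>M) \<longlonglongrightarrow> (\<integral>\<omega>. indicator ?L \<omega> \<partial>M :: real)"
    proof (rule integral_dominated_convergence[where w="\<lambda>_. 1"])
      show "AE \<omega> in M. (\<lambda>n. indicator (E n) \<omega> :: real) \<longlonglongrightarrow> indicator ?L \<omega>"
        by (rule AE_I2) (rule iL)
    qed (use L in \<open>simp_all add: indicator_le_1\<close>)
    then show ?thesis using L by simp
  qed
  moreover have "(\<lambda>n. prob (E n)) \<longlonglongrightarrow> (\<integral>\<omega>. indicator B \<omega> * prob (A (\<tau> \<omega>)) \<partial>M)"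
    unfolding En
  proof (rule integral_dominated_convergence[where w="\<lambda>_. 1"])
    show "AE \<omega> in M. (\<lambda>n. indicator B \<omega> * prob (A (g n (q n (\<tau> \<omega>))))) \<longlonglongrightarrow> indicator B \<omega> * prob (A (\<tau> \<omega>))"
      by (rule AE_I2) (rule pt)
    show "AE \<omega> in M. norm (indicator B \<omega> * prob (A (g n (q n (\<tau> \<omega>))))) \<le> 1" for n
      by (rule AE_I2) (auto simp: indicator_def)
  qed (use m in \<open>simp_all only: integrable_const, measurable\<close>)
  ultimately show "prob ?L = (\<integral>\<omega>. indicator B \<omega> * prob (A (\<tau> \<omega>)) \<partial>M)"
    by (rule LIMSEQ_unique)
qed

section \<open>Uniqueness of distributions\<close>

text \<open>Moving the argument by 1/(n+1) absorbs the difference between open and closed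
  half-lines, and right continuity of the distribution functions removes the shift. The hypotheses
  are what a level event between {T < x} and {T \<le> x} provides.\<close>

lemma real_distribution_eq_sandwich:
  assumes "real_distribution M1" "real_distribution M2"
    and 1: "\<And>x. measure M1 {..<x} \<le> measure M2 {..<x}"
    and 2: "\<And>x. measure M2 {..<x} \<le> measure M1 {..x}"
  shows "M1 = M2"
proof (rule cdf_unique[OF assms(1,2)], rule ext)
  interpret M1: real_distribution M1 by fact
  interpret M2: real_distribution M2 by fact
  fix x
  have r: "filterlim (\<lambda>n. x + 1 / real (Suc n)) (at_right x) sequentially"
    unfolding filterlim_at
    using LIMSEQ_inverse_real_of_nat_add[of x] by (auto simp: field_simps inverse_eq_divide)
  have t1: "(\<lambda>n. cdf M1 (x + 1 / real (Suc n))) \<longlonglongrightarrow> cdf M1 x"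
    using filterlim_compose[OF M1.cdf_is_right_cont[of x, unfolded continuous_within] r] .
  have t2: "(\<lambda>n. cdf M2 (x + 1 / real (Suc n))) \<longlonglongrightarrow> cdf M2 x"
    using filterlim_compose[OF M2.cdf_is_right_cont[of x, unfolded continuous_within] r] .
  have m: "measure N {..x} \<le> measure N {..<x + 1 / real (Suc n)}" "measure N {..<y} \<le> measure N {..y}"
    if "real_distribution N" for N y n
  proof -
    interpret N: real_distribution N by fact
    show "measure N {..x} \<le> measure N {..<x + 1 / real (Suc n)}" by (intro N.finite_measure_mono) (auto intro: le_less_trans)
    show "measure N {..<y} \<le> measure N {..y}" by (intro N.finite_measure_mono) auto
  qed
  show "cdf M1 x = cdf M2 x"
  proof (rule antisym)
    have "cdf M1 x \<le> cdf M2 (x + 1 / real (Suc n))" for n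
      unfolding cdf_def using m(1)[OF assms(1)] 1 m(2)[OF assms(2)] order_trans by meson
    then show "cdf M1 x \<le> cdf M2 x" by (intro LIMSEQ_le_const[OF t2]) auto
    have "cdf M2 x \<le> cdf M1 (x + 1 / real (Suc n))" for n
      unfolding cdf_def using m(1)[OF assms(2)] 2 order_trans by meson
    then show "cdf M2 x \<le> cdf M1 x" by (intro LIMSEQ_le_const[OF t1]) auto
  qed
qed

text \<open>The characteristic function is the power series in u whose coefficients are the moments
  over n!. On [0,1] the n-th term is bounded by |u|^n / n!, which permits integration term by
  term.\<close>

lemma moments_determine_unit_interval:
  assumes "real_distribution M1" "real_distribution M2"
    and s1: "AE x in M1. 0 \<le> x \<and> x \<le> 1" and s2: "AE x in M2. 0 \<le> x \<and> x \<le> 1"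
    and m: "\<And>n. (\<integral>x. x ^ n \<partial>M1) = (\<integral>x. x ^ n \<partial>M2)"
  shows "M1 = M2"
proof (rule Levy_uniqueness[OF assms(1,2)], rule ext)
  fix u
  have *: "char M u = (\<Sum>n. (\<i> * complex_of_real u) ^ n /\<^sub>R fact n * complex_of_real (\<integral>x. x ^ n \<partial>M))"
    if M: "real_distribution M" and s: "AE x in M. 0 \<le> x \<and> x \<le> 1" for M
  proof -
    interpret real_distribution M by fact
    have xb: "AE x in M. \<bar>x ^ n\<bar> \<le> 1" for n
      using s by eventually_elim (auto simp: power_le_one)
    have int: "integrable M (\<lambda>x. x ^ n)" for n
      by (rule integrable_const_bound[where B=1]) (use xb in auto)
    have int': "integrable M (\<lambda>x. (\<i> * complex_of_real (u * x)) ^ n /\<^sub>R fact n)" for n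
    proof (rule integrable_const_bound[where B="\<bar>u\<bar> ^ n / fact n"])
      show "AE x in M. cmod ((\<i> * complex_of_real (u * x)) ^ n /\<^sub>R fact n) \<le> \<bar>u\<bar> ^ n / fact n"
        using xb[of n]
        by eventually_elim (auto simp: norm_mult norm_power power_mult_distrib abs_mult power_abs divide_simps mult_left_le)
    qed measurable
    have "char M u = (\<integral>x. (\<Sum>n. (\<i> * complex_of_real (u * x)) ^ n /\<^sub>R fact n) \<partial>M)"
      unfolding char_def exp_def ..
    also have "\<dots> = (\<Sum>n. \<integral>x. (\<i> * complex_of_real (u * x)) ^ n /\<^sub>R fact n \<partial>M)"
    proof (rule integral_suminf[OF int'])
      show "AE x in M. summable (\<lambda>n. cmod ((\<i> * complex_of_real (u * x)) ^ n /\<^sub>R fact n))"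
        using summable_norm_exp by (intro AE_I2) blast
      show "summable (\<lambda>n. \<integral>x. cmod ((\<i> * complex_of_real (u * x)) ^ n /\<^sub>R fact n) \<partial>M)"
      proof (rule summable_comparison_test'[where N=0])
        show "summable (\<lambda>n. \<bar>u\<bar> ^ n / fact n)"
          using summable_exp[of "\<bar>u\<bar>"] by (simp add: field_simps)
        fix n
        have "\<bar>\<integral>x. cmod ((\<i> * complex_of_real (u * x)) ^ n /\<^sub>R fact n) \<partial>M\<bar> \<le> (\<integral>x. \<bar>u\<bar> ^ n / fact n \<partial>M)"
          unfolding abs_of_nonneg[OF Bochner_Integration.integral_nonneg, OF norm_ge_zero]
        proof (rule integral_mono_AE)
          show "AE x in M. cmod ((\<i> * complex_of_real (u * x)) ^ n /\<^sub>R fact n) \<le> \<bar>u\<bar> ^ n / fact n"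
            using xb[of n]
            by eventually_elim (auto simp: norm_mult norm_power power_mult_distrib abs_mult power_abs divide_simps mult_left_le)
        qed (intro integrable_norm int', simp)
        then show "norm (\<integral>x. cmod ((\<i> * complex_of_real (u * x)) ^ n /\<^sub>R fact n) \<partial>M) \<le> \<bar>u\<bar> ^ n / fact n"
          using prob_space by simp
      qed
    qed
    also have "\<dots> = (\<Sum>n. (\<i> * complex_of_real u) ^ n /\<^sub>R fact n * complex_of_real (\<integral>x. x ^ n \<partial>M))"
    proof (rule suminf_cong)
      fix n
      have "(\<integral>x. (\<i> * complex_of_real (u * x)) ^ n /\<^sub>R fact n \<partial>M) = (\<integral>x. (\<i> * complex_of_real u) ^ n /\<^sub>R fact n * complex_of_real (x ^ n) \<partial>M)"
        by (rule Bochner_Integration.integral_cong) (auto simp: power_mult_distrib)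
      also have "\<dots> = (\<i> * complex_of_real u) ^ n /\<^sub>R fact n * complex_of_real (\<integral>x. x ^ n \<partial>M)"
        by (subst integral_mult_right_zero, subst integral_complex_of_real) simp
      finally show "(\<integral>x. (\<i> * complex_of_real (u * x)) ^ n /\<^sub>R fact n \<partial>M) = (\<i> * complex_of_real u) ^ n /\<^sub>R fact n * complex_of_real (\<integral>x. x ^ n \<partial>M)" .
    qed
    finally show ?thesis .
  qed
  show "char M1 u = char M2 u"
    using *[OF assms(1) s1] *[OF assms(2) s2] m by simp
qed


section \<open>Mittag-Leffler functions and Gamma integrals\<close>

text \<open>With x = b r + d, this is the quotient of consecutive Gamma factors in a Mittag-Leffler
  series; the bound decays like x^(-b).\<close>

lemma Gamma_quotient_bound:
  fixes x b :: real
  assumes "0 < x" "0 < b" "b < 1"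
  shows "Gamma x / Gamma (x + b) \<le> (x + b) powr (1 - b) / x"
proof -
  have g: "Gamma (x + b) > 0" "Gamma x > 0" using assms by (auto intro: Gamma_real_pos)
  \<comment> \<open>log-convexity, with \<open>x + 1\<close> written as a convex combination of \<open>x + b\<close> and \<open>x + b + 1\<close>\<close>
  have "(ln \<circ> Gamma) ((1 - (1 - b)) *\<^sub>R (x + b) + (1 - b) *\<^sub>R (x + b + 1))
     \<le> (1 - (1 - b)) * (ln \<circ> Gamma) (x + b) + (1 - b) * (ln \<circ> Gamma) (x + b + 1)"
    using assms by (intro convex_onD[OF log_convex_Gamma_real]) auto
  also have "(1 - (1 - b)) *\<^sub>R (x + b) + (1 - b) *\<^sub>R (x + b + 1) = x + 1" by (simp add: algebra_simps)
  also have "Gamma (x + b + 1) = (x + b) * Gamma (x + b)" using assms by (intro Gamma_plus1) (auto elim: nonpos_Ints_cases)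
  then have "(ln \<circ> Gamma) (x + b + 1) = ln (x + b) + ln (Gamma (x + b))"
    using ln_mult_pos[of "x + b" "Gamma (x + b)"] assms g(1) by simp
  finally have "ln (Gamma (x + 1)) \<le> ln (Gamma (x + b)) + (1 - b) * ln (x + b)"
    by (simp add: algebra_simps)
  also have "Gamma (x + 1) = x * Gamma x" using assms by (intro Gamma_plus1) (auto elim: nonpos_Ints_cases)
  also have "(1 - b) * ln (x + b) = ln ((x + b) powr (1 - b))" using assms by (simp add: ln_powr)
  also have "ln (Gamma (x + b)) + ln ((x + b) powr (1 - b)) = ln (Gamma (x + b) * (x + b) powr (1 - b))"
    using ln_mult_pos[of "Gamma (x + b)" "(x + b) powr (1 - b)"] assms g(1) by simp
  finally have "x * Gamma x \<le> Gamma (x + b) * (x + b) powr (1 - b)"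
    using assms g by (subst (asm) ln_le_cancel_iff) auto
  then show ?thesis using assms g by (simp add: field_simps)
qed

text \<open>Ratio test: consecutive terms have a quotient of order |z| x^(-b) with x = b r + d,
  which falls below 1/2 for large r whatever z is.\<close>

lemma summable_mittag_leffler:
  fixes z b d :: real
  assumes b: "0 < b" "b < 1" and d: "0 < d"
  shows "summable (\<lambda>r. \<bar>z\<bar> ^ r / Gamma (b * real r + d))"
proof -
  have "((\<lambda>x. \<bar>z\<bar> * ((x + b) powr (1 - b) / x)) \<longlongrightarrow> \<bar>z\<bar> * 0) at_top"
  proof (intro tendsto_mult tendsto_const)
    have "((\<lambda>x. (1 + b / x) powr (1 - b) * x powr (-b)) \<longlongrightarrow> (1 + 0) powr (1 - b) * 0) at_top"
      using b by (intro tendsto_intros tendsto_neg_powr tendsto_divide_0[OF tendsto_const] filterlim_at_top_imp_at_infinity filterlim_ident) auto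
    moreover have "\<forall>\<^sub>F x in at_top. (1 + b / x) powr (1 - b) * x powr (-b) = (x + b) powr (1 - b) / x"
      using eventually_gt_at_top[of 0]
    proof eventually_elim
      case (elim x)
      have "(1 + b / x) = (x + b) / x" using elim by (simp add: field_simps)
      then have "(1 + b / x) powr (1 - b) * x powr (-b) = (x + b) powr (1 - b) / (x powr (1 - b) * x powr b)"
        using elim b by (simp add: powr_divide powr_minus field_simps)
      also have "x powr (1 - b) * x powr b = x" using elim by (simp add: powr_add[symmetric])
      finally show ?case .
    qed
    ultimately show "((\<lambda>x. (x + b) powr (1 - b) / x) \<longlongrightarrow> 0) at_top"
      by (simp add: tendsto_cong)
  qed
  then have "\<forall>\<^sub>F x in at_top. \<bar>z\<bar> * ((x + b) powr (1 - b) / x) < 1/2"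
    by (rule order_tendstoD) simp
  moreover have "filterlim (\<lambda>r::nat. b * real r + d) at_top sequentially"
    using filterlim_tendsto_add_at_top[OF tendsto_const filterlim_tendsto_pos_mult_at_top[OF tendsto_const b(1) filterlim_real_sequentially], of d]
    by (simp add: add.commute)
  ultimately have "\<forall>\<^sub>F r in sequentially. \<bar>z\<bar> * ((b * real r + d + b) powr (1 - b) / (b * real r + d)) < 1/2"
    by (rule eventually_compose_filterlim)
  then obtain N where N: "\<And>r. r \<ge> N \<Longrightarrow> \<bar>z\<bar> * ((b * real r + d + b) powr (1 - b) / (b * real r + d)) < 1/2"
    by (auto simp: eventually_sequentially)
  show ?thesis
  proof (rule summable_ratio_test[of "1/2" N])
    fix r assume r: "r \<ge> N"
    let ?x = "b * real r + d"
    have x: "?x > 0" using b d by (simp add: add_nonneg_pos)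
    have g: "Gamma ?x > 0" "Gamma (?x + b) > 0" using x b by (auto intro: Gamma_real_pos)
    have e: "b * real (Suc r) + d = ?x + b" by (simp add: algebra_simps)
    have "\<bar>z\<bar> * (Gamma ?x / Gamma (?x + b)) \<le> \<bar>z\<bar> * ((?x + b) powr (1 - b) / ?x)"
      using Gamma_quotient_bound[OF x b] by (intro mult_left_mono) auto
    also have "\<dots> \<le> 1/2" using N[OF r] by simp
    finally have "(\<bar>z\<bar> * (Gamma ?x / Gamma (?x + b))) * (\<bar>z\<bar> ^ r / Gamma ?x) \<le> 1/2 * (\<bar>z\<bar> ^ r / Gamma ?x)"
      using g by (intro mult_right_mono) auto
    then show "norm (\<bar>z\<bar> ^ Suc r / Gamma (b * real (Suc r) + d)) \<le> 1/2 * norm (\<bar>z\<bar> ^ r / Gamma ?x)"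
      unfolding e using g by (simp add: abs_mult)
  qed simp
qed

text \<open>Used twice: with V a negative power of D_1 and the exponential series, and with V a
  power of the relative age and the series of E_{b,1}. In both cases only the moments of V are
  known.\<close>

lemma sums_integral_power_series:
  fixes V :: "'a \<Rightarrow> real"
  assumes int: "\<And>r. integrable M (\<lambda>x. V x ^ r)" and nn: "AE x in M. 0 \<le> V x"
    and m: "\<And>r. (\<integral>x. V x ^ r \<partial>M) = m r"
    and s: "AE x in M. summable (\<lambda>r. \<bar>a r\<bar> * V x ^ r)" and sm: "summable (\<lambda>r. \<bar>a r\<bar> * m r)"
  shows "(\<lambda>r. a r * m r) sums (\<integral>x. (\<Sum>r. a r * V x ^ r) \<partial>M)"
    and "integrable M (\<lambda>x. \<Sum>r. a r * V x ^ r)"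
proof -
  have 1: "integrable M (\<lambda>x. a r * V x ^ r)" for r using int by simp
  have 2: "AE x in M. summable (\<lambda>r. norm (a r * V x ^ r))"
    using s nn by eventually_elim (simp add: abs_mult)
  have "(\<integral>x. norm (a r * V x ^ r) \<partial>M) = \<bar>a r\<bar> * m r" for r
  proof -
    have "(\<integral>x. norm (a r * V x ^ r) \<partial>M) = (\<integral>x. \<bar>a r\<bar> * V x ^ r \<partial>M)"
    proof (rule integral_cong_AE)
      show "AE x in M. norm (a r * V x ^ r) = \<bar>a r\<bar> * V x ^ r"
        using nn by eventually_elim (simp add: abs_mult)
    qed (use int in auto)
    then show ?thesis using m by simp
  qed
  then have 3: "summable (\<lambda>r. \<integral>x. norm (a r * V x ^ r) \<partial>M)" using sm by simp
  show "(\<lambda>r. a r * m r) sums (\<integral>x. (\<Sum>r. a r * V x ^ r) \<partial>M)"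
    using sums_integral[OF 1 2 3] m by simp
  show "integrable M (\<lambda>x. \<Sum>r. a r * V x ^ r)" by (rule integrable_suminf[OF 1 2 3])
qed

section \<open>Euler integrals and the exponent of the stable subordinator\<close>

lemma nn_integral_powr_Icc:
  assumes "0 < a" "0 \<le> y"
  shows "(\<integral>\<^sup>+x. ennreal (indicator {0..y} x * x powr (a - 1)) \<partial>lborel) = ennreal (y powr a / a)"
  using nn_integral_has_integral_lebesgue[OF _ has_integral_powr_from_0[of "a - 1" y]] assms by simp

text \<open>Read from right to left, this writes a negative power of u as a mixture of the
  exponentials exp(-u x). Negative moments of a random variable thereby become accessible from its
  Laplace transform.\<close>

lemma nn_integral_Gamma_scaled:
  assumes "0 < a" "0 < u"
  shows "(\<integral>\<^sup>+x. ennreal (indicator {0<..} x * (x powr (a - 1) * exp (- u * x))) \<partial>lborel) = ennreal (Gamma a * u powr (- a))"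
proof -
  have "(\<integral>\<^sup>+x. ennreal (indicator {0..} x * x powr (a - 1) / exp x) \<partial>lborel)
     = ennreal \<bar>u\<bar> * (\<integral>\<^sup>+x. ennreal (indicator {0..} (0 + u * x) * (0 + u * x) powr (a - 1) / exp (0 + u * x)) \<partial>lborel)"
    using assms by (intro nn_integral_real_affine) auto
  also have "(\<integral>\<^sup>+x. ennreal (indicator {0..} (0 + u * x) * (0 + u * x) powr (a - 1) / exp (0 + u * x)) \<partial>lborel)
    = (\<integral>\<^sup>+x. ennreal (u powr (a - 1)) * ennreal (indicator {0<..} x * (x powr (a - 1) * exp (- u * x))) \<partial>lborel)"
  proof (rule nn_integral_cong)
    fix x :: real
    consider "x > 0" | "x = 0" | "x < 0" by linarith
    then show "ennreal (indicator {0..} (0 + u * x) * (0 + u * x) powr (a - 1) / exp (0 + u * x))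
      = ennreal (u powr (a - 1)) * ennreal (indicator {0<..} x * (x powr (a - 1) * exp (- u * x)))"
    proof cases
      case 1
      then show ?thesis using assms
        by (simp add: ennreal_mult'[symmetric] powr_mult exp_minus field_simps)
    next
      case 3
      then have "u * x < 0" using assms by (simp add: mult_pos_neg)
      then show ?thesis using 3 by simp
    qed simp
  qed
  also have "\<dots> = ennreal (u powr (a - 1)) * (\<integral>\<^sup>+x. ennreal (indicator {0<..} x * (x powr (a - 1) * exp (- u * x))) \<partial>lborel)"
    by (rule nn_integral_cmult) measurable
  finally have eq: "ennreal (Gamma a) = ennreal (u powr a) * (\<integral>\<^sup>+x. ennreal (indicator {0<..} x * (x powr (a - 1) * exp (- u * x))) \<partial>lborel)"
    using assms by (simp add: Gamma_conv_nn_integral_real[symmetric] mult.assoc[symmetric] ennreal_mult'[symmetric] powr_mult_base)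
  have "ennreal (u powr (- a)) * ennreal (Gamma a) = (ennreal (u powr (- a)) * ennreal (u powr a)) * (\<integral>\<^sup>+x. ennreal (indicator {0<..} x * (x powr (a - 1) * exp (- u * x))) \<partial>lborel)"
    by (simp add: eq mult.assoc)
  also have "ennreal (u powr (- a)) * ennreal (u powr a) = 1"
    using assms by (simp add: ennreal_mult'[symmetric] powr_add[symmetric])
  finally show ?thesis using assms by (simp add: ennreal_mult'[symmetric] mult.commute)
qed

text \<open>Write \<open>1 - exp (- s x)\<close> as the integral of \<open>x exp (- u x)\<close> over \<open>u\<close> in \<open>[0, s]\<close> and exchange the integrals.\<close>

lemma stable_levy_exponent:
  assumes b: "0 < b" "b < 1" and s: "0 \<le> s"
  shows "(\<integral>x. 1 - exp (- s * x) \<partial>stable_levy_measure b) = s powr b"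
proof -
  define c where "c = b / Gamma (1 - b)"
  have c: "c > 0" using b by (simp add: c_def Gamma_real_pos)
  let ?d = "\<lambda>x. indicator {0<..} x * (c * x powr (- 1 - b))"
  have 1: "ennreal (?d x * (1 - exp (- s * x)))
     = (\<integral>\<^sup>+u. ennreal (c * indicator {0..s} u) * ennreal (indicator {0<..} x * (x powr ((1 - b) - 1) * exp (- u * x))) \<partial>lborel)" for x
  proof (cases "x > 0")
    case False
    then show ?thesis by simp
  next
    case True
    have "(\<integral>\<^sup>+u. ennreal (c * indicator {0..s} u) * ennreal (indicator {0<..} x * (x powr ((1 - b) - 1) * exp (- u * x))) \<partial>lborel)
      = (\<integral>\<^sup>+u. ennreal (c * x powr (- 1 - b) * (x * exp (- x * u))) * indicator {0..s} u \<partial>lborel)"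
    proof (rule nn_integral_cong)
      fix u
      have "x powr (1 - b - 1) = x powr (-1 - b) * x" using True powr_mult_base[of x "-1-b"] by (simp add: mult.commute)
      then show "ennreal (c * indicator {0..s} u) * ennreal (indicator {0<..} x * (x powr ((1 - b) - 1) * exp (- u * x)))
        = ennreal (c * x powr (- 1 - b) * (x * exp (- x * u))) * indicator {0..s} u"
        using True c by (auto simp: indicator_def ennreal_mult'[symmetric] mult_ac)
    qed
    also have "\<dots> = ennreal (- (c * x powr (- 1 - b) * exp (- x * s)) - (- (c * x powr (- 1 - b) * exp (- x * 0))))"
    proof (rule nn_integral_FTC_Icc)
      show "0 \<le> c * x powr (- 1 - b) * (x * exp (- x * u))" for u
        using c True by (intro mult_nonneg_nonneg) auto
    qed (use s in \<open>auto intro!: derivative_eq_intros\<close>)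
    also have "\<dots> = ennreal (?d x * (1 - exp (- s * x)))"
      using True by (simp add: algebra_simps)
    finally show ?thesis ..
  qed
  have nn: "0 \<le> ?d x * (1 - exp (- s * x))" for x
    using c s by (auto simp: indicator_def)
  have "(\<integral>x. 1 - exp (- s * x) \<partial>stable_levy_measure b) = (\<integral>x. ?d x * (1 - exp (- s * x)) \<partial>lborel)"
    unfolding stable_levy_measure_def c_def[symmetric] using c by (subst integral_density) (auto simp: indicator_def)
  also have "\<dots> = enn2real (\<integral>\<^sup>+x. ennreal (?d x * (1 - exp (- s * x))) \<partial>lborel)"
    using nn by (intro integral_eq_nn_integral) auto
  also have "(\<integral>\<^sup>+x. ennreal (?d x * (1 - exp (- s * x))) \<partial>lborel)
    = (\<integral>\<^sup>+u. \<integral>\<^sup>+x. ennreal (c * indicator {0..s} u) * ennreal (indicator {0<..} x * (x powr ((1 - b) - 1) * exp (- u * x))) \<partial>lborel \<partial>lborel)"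
    unfolding 1 by (rule lborel_pair.Fubini') measurable
  also have "\<dots> = (\<integral>\<^sup>+u. ennreal b * ennreal (indicator {0..s} u * u powr (b - 1)) \<partial>lborel)"
  \<comment> \<open>The factor Gamma(1-b) cancels against the constant c and leaves b u^(b-1). The
    point u = 0 must be left out: for u = 0 the inner integral is infinite, whereas
    \<open>0 powr (b - 1)\<close> is 0.\<close>
  proof (rule nn_integral_cong_AE, rule eventually_mono[OF AE_lborel_singleton[of 0]])
    fix u :: real assume "u \<noteq> 0"
    then consider "u > 0" | "u < 0" by linarith
    then show "(\<integral>\<^sup>+x. ennreal (c * indicator {0..s} u) * ennreal (indicator {0<..} x * (x powr ((1 - b) - 1) * exp (- u * x))) \<partial>lborel)
       = ennreal b * ennreal (indicator {0..s} u * u powr (b - 1))"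
    proof cases
      case 1
      have g: "Gamma (1 - b) \<noteq> 0" using Gamma_real_pos[of "1 - b"] b by linarith
      have "(\<integral>\<^sup>+x. ennreal (c * indicator {0..s} u) * ennreal (indicator {0<..} x * (x powr ((1 - b) - 1) * exp (- u * x))) \<partial>lborel)
        = ennreal (c * indicator {0..s} u) * ennreal (Gamma (1 - b) * u powr (- (1 - b)))"
        using b 1 by (subst nn_integral_cmult) (simp_all only: nn_integral_Gamma_scaled[of "1 - b" u], measurable)
      also have "\<dots> = ennreal b * ennreal (indicator {0..s} u * u powr (b - 1))"
        using g b by (auto simp: c_def indicator_def ennreal_mult'[symmetric])
      finally show ?thesis .
    qed simp
  qed
  also have "\<dots> = ennreal b * ennreal (s powr b / b)"
    using b s by (subst nn_integral_cmult) (simp_all add: nn_integral_powr_Icc)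
  finally show ?thesis using b by (simp add: ennreal_mult'[symmetric])
qed

text \<open>Writing \<open>exp (- x\<^sup>b)\<close> as a tail integral of \<open>exp (- y)\<close> avoids the substitution \<open>y = x\<^sup>b\<close>.\<close>

lemma nn_integral_powr_exp_powr:
  assumes p: "0 < p" and b: "0 < b"
  shows "(\<integral>\<^sup>+x. ennreal (indicator {0<..} x * (x powr (p - 1) * exp (- (x powr b)))) \<partial>lborel) = ennreal (Gamma (p / b + 1) / p)"
proof -
  have 1: "ennreal (indicator {0<..} x * (x powr (p - 1) * exp (- (x powr b))))
     = (\<integral>\<^sup>+y. ennreal (indicator {0<..} x * x powr (p - 1)) * ennreal (exp (- y) * indicator {x powr b..} y) \<partial>lborel)" for x
  proof -
    have "(\<integral>\<^sup>+y. ennreal (exp (- y)) * indicator {x powr b..} y \<partial>lborel) = ennreal (0 - (- exp (- (x powr b))))"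
    proof (rule nn_integral_FTC_atLeast)
      have "((\<lambda>y::real. - exp (- y)) \<longlongrightarrow> - 0) at_top"
        by (intro tendsto_minus filterlim_compose[OF exp_at_bot] filterlim_uminus_at_bot_at_top)
      then show "((\<lambda>y::real. - exp (- y)) \<longlongrightarrow> 0) at_top" by simp
    qed (auto intro!: derivative_eq_intros)
    then have "(\<integral>\<^sup>+y. ennreal (exp (- y) * indicator {x powr b..} y) \<partial>lborel) = ennreal (exp (- (x powr b)))"
      by (simp add: ennreal_mult' ennreal_indicator)
    then show ?thesis
      by (subst nn_integral_cmult) (auto simp: ennreal_mult'[symmetric] indicator_def)
  qed
  have "(\<integral>\<^sup>+x. ennreal (indicator {0<..} x * (x powr (p - 1) * exp (- (x powr b)))) \<partial>lborel)
     = (\<integral>\<^sup>+y. \<integral>\<^sup>+x. ennreal (indicator {0<..} x * x powr (p - 1)) * ennreal (exp (- y) * indicator {x powr b..} y) \<partial>lborel \<partial>lborel)"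
    unfolding 1 by (rule lborel_pair.Fubini') (auto simp: indicator_def cong: measurable_cong_sets)
  also have "\<dots> = (\<integral>\<^sup>+y. ennreal (1 / p) * ennreal (indicator {0..} y * y powr (p / b + 1 - 1) / exp y) \<partial>lborel)"
  proof (rule nn_integral_cong)
    fix y :: real
    show "(\<integral>\<^sup>+x. ennreal (indicator {0<..} x * x powr (p - 1)) * ennreal (exp (- y) * indicator {x powr b..} y) \<partial>lborel)
       = ennreal (1 / p) * ennreal (indicator {0..} y * y powr (p / b + 1 - 1) / exp y)"
    proof (cases "0 \<le> y")
      case False
      then have "\<not> x powr b \<le> y" for x
        using powr_ge_zero[of x b] by linarith
      then have "indicator {x powr b..} y = (0::real)" for x
        by (simp add: indicator_def)
      then show ?thesis using False by simp
    next
      case True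
      have "(\<integral>\<^sup>+x. ennreal (indicator {0<..} x * x powr (p - 1)) * ennreal (exp (- y) * indicator {x powr b..} y) \<partial>lborel)
         = (\<integral>\<^sup>+x. ennreal (exp (- y)) * ennreal (indicator {0..y powr (1 / b)} x * x powr (p - 1)) \<partial>lborel)"
      proof (rule nn_integral_cong_AE, rule eventually_mono[OF AE_lborel_singleton[of 0]])
        fix x :: real assume x0: "x \<noteq> 0"
        have "x powr b \<le> y \<longleftrightarrow> x \<le> y powr (1 / b)" if "x > 0"
        proof
          assume "x powr b \<le> y"
          then have "(x powr b) powr (1 / b) \<le> y powr (1 / b)" using b by (intro powr_mono2) auto
          then show "x \<le> y powr (1 / b)" using that b by (simp add: powr_powr)
        next
          assume "x \<le> y powr (1 / b)"
          then have "x powr b \<le> (y powr (1 / b)) powr b" using b that by (intro powr_mono2) auto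
          then show "x powr b \<le> y" using True b by (simp add: powr_powr)
        qed
        then show "ennreal (indicator {0<..} x * x powr (p - 1)) * ennreal (exp (- y) * indicator {x powr b..} y)
          = ennreal (exp (- y)) * ennreal (indicator {0..y powr (1 / b)} x * x powr (p - 1))"
          using x0 by (auto simp: indicator_def ennreal_mult'[symmetric] mult.commute)
      qed
      also have "\<dots> = ennreal (exp (- y)) * ennreal ((y powr (1 / b)) powr p / p)"
        using p by (subst nn_integral_cmult) (simp_all add: nn_integral_powr_Icc)
      also have "\<dots> = ennreal (1 / p) * ennreal (indicator {0..} y * y powr (p / b + 1 - 1) / exp y)"
        using True p by (simp add: ennreal_mult'[symmetric] powr_powr exp_minus field_simps)
      finally show ?thesis .
    qed
  qed
  also have "\<dots> = ennreal (1 / p) * ennreal (Gamma (p / b + 1))"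
    using p b by (subst nn_integral_cmult) (simp_all only: Gamma_conv_nn_integral_real[of "p / b + 1"] add_pos_pos divide_pos_pos zero_less_one, measurable)
  finally show ?thesis using p by (simp add: ennreal_mult'[symmetric])
qed

text \<open>The law of the appearance time of a uniformly chosen genus, relative to the time of observation.\<close>

definition genus_age_law :: "real \<Rightarrow> real measure" where
  "genus_age_law n = density lborel (\<lambda>u. ennreal (indicator {0<..<1} u * (n * u powr (n - 1))))"

lemma genus_age_law_atMost:
  assumes n: "0 < n" and x: "0 \<le> x" "x \<le> 1"
  shows "emeasure (genus_age_law n) {..x} = ennreal (x powr n)"
    and "emeasure (genus_age_law n) {..<x} = ennreal (x powr n)"
proof -
  have *: "(\<integral>\<^sup>+u. ennreal (indicator {0<..<1} u * (n * u powr (n - 1))) * indicator A u \<partial>lborel) = ennreal (x powr n)"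
    if A: "A = {..x} \<or> A = {..<x}" for A
  proof -
    have "(\<integral>\<^sup>+u. ennreal (indicator {0<..<1} u * (n * u powr (n - 1))) * indicator A u \<partial>lborel)
      = (\<integral>\<^sup>+u. ennreal n * ennreal (indicator {0..x} u * u powr (n - 1)) \<partial>lborel)"
    proof (rule nn_integral_cong_AE)
      have "AE u in lborel. u \<noteq> 0 \<and> u \<noteq> 1 \<and> u \<noteq> x"
        using AE_lborel_singleton[of 0] AE_lborel_singleton[of 1] AE_lborel_singleton[of x] by eventually_elim auto
      then show "AE u in lborel. ennreal (indicator {0<..<1} u * (n * u powr (n - 1))) * indicator A u
          = ennreal n * ennreal (indicator {0..x} u * u powr (n - 1))"
        by eventually_elim (use A x n in \<open>auto simp: indicator_def ennreal_mult'[symmetric]\<close>)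
    qed
    also have "\<dots> = ennreal n * ennreal (x powr n / n)"
      using n x by (subst nn_integral_cmult) (simp_all add: nn_integral_powr_Icc)
    finally show ?thesis using n by (simp add: ennreal_mult'[symmetric])
  qed
  show "emeasure (genus_age_law n) {..x} = ennreal (x powr n)"
    unfolding genus_age_law_def by (subst emeasure_density) (auto simp: *)
  show "emeasure (genus_age_law n) {..<x} = ennreal (x powr n)"
    unfolding genus_age_law_def by (subst emeasure_density) (auto simp: *)
qed

lemma AE_genus_age_law: "AE u in genus_age_law n. 0 < u \<and> u < 1"
  unfolding genus_age_law_def by (subst AE_density) (auto simp: indicator_def)

lemma sets_genus_age_law [simp, measurable_cong]: "sets (genus_age_law n) = sets borel"
  by (simp add: genus_age_law_def)

lemma space_genus_age_law [simp]: "space (genus_age_law n) = UNIV"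
  by (simp add: genus_age_law_def)

lemma real_distribution_genus_age_law:
  assumes "0 < n" shows "real_distribution (genus_age_law n)"
proof -
  have "emeasure (genus_age_law n) UNIV = emeasure (genus_age_law n) {..1}"
  proof (rule emeasure_eq_AE)
    show "AE u in genus_age_law n. (u \<in> UNIV) = (u \<in> {..1})"
      using AE_genus_age_law[of n] by eventually_elim simp
  qed simp_all
  also have "\<dots> = 1" using genus_age_law_atMost(1)[OF assms, of 1] by simp
  finally have "prob_space (genus_age_law n)" by (intro prob_spaceI) simp
  then show ?thesis
    by (simp add: real_distribution_def real_distribution_axioms_def)
qed

text \<open>This is n B(n, a+1), with n Gamma(n) = Gamma(n+1). It is the source of the factor
  Gamma(\<nu>+1) in the theorem.\<close>

lemma genus_age_law_moment:
  assumes n: "0 < n" and a: "0 \<le> a"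
  shows "integrable (genus_age_law n) (\<lambda>u. (1 - u) powr a)"
    and "(\<integral>u. (1 - u) powr a \<partial>genus_age_law n) = Gamma (n + 1) * Gamma (a + 1) / Gamma (a + n + 1)"
proof -
  have "(\<integral>\<^sup>+u. ennreal ((1 - u) powr a) \<partial>genus_age_law n)
    = (\<integral>\<^sup>+u. ennreal n * ennreal (indicator {0..1} u * (u powr (n - 1) * (1 - u) powr (a + 1 - 1))) \<partial>lborel)"
  proof -
    have "AE u in lborel. u \<noteq> 0 \<and> u \<noteq> (1::real)"
      using AE_lborel_singleton[of 0] AE_lborel_singleton[of 1] by eventually_elim auto
    then have "AE u in lborel. ennreal (indicator {0<..<1} u * (n * u powr (n - 1))) * ennreal ((1 - u) powr a)
      = ennreal n * ennreal (indicator {0..1} u * (u powr (n - 1) * (1 - u) powr (a + 1 - 1)))"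
      by eventually_elim (use n in \<open>auto simp: indicator_def ennreal_mult'[symmetric] mult_ac\<close>)
    then show ?thesis
      unfolding genus_age_law_def by (subst nn_integral_density) (auto intro!: nn_integral_cong_AE)
  qed
  also have "\<dots> = ennreal n * ennreal (Beta n (a + 1))"
    using nn_integral_has_integral_lebesgue[OF _ has_integral_Beta_real[of n "a + 1"]] n a
    by (subst nn_integral_cmult) auto
  also have "\<dots> = ennreal (Gamma (n + 1) * Gamma (a + 1) / Gamma (a + n + 1))"
  proof -
    have "Gamma (n + 1) = n * Gamma n" using n by (intro Gamma_plus1) (auto elim: nonpos_Ints_cases)
    then show ?thesis using n by (simp add: Beta_def ennreal_mult'[symmetric] add_ac mult_ac)
  qed
  finally have *: "(\<integral>\<^sup>+u. ennreal ((1 - u) powr a) \<partial>genus_age_law n) = ennreal (Gamma (n + 1) * Gamma (a + 1) / Gamma (a + n + 1))" .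
  have nn: "0 \<le> Gamma (n + 1) * Gamma (a + 1) / Gamma (a + n + 1)"
    using n a by (intro divide_nonneg_nonneg mult_nonneg_nonneg less_imp_le[OF Gamma_real_pos]) auto
  have "integrable (genus_age_law n) (\<lambda>u. (1 - u) powr a) \<and> (\<integral>u. (1 - u) powr a \<partial>genus_age_law n) = Gamma (n + 1) * Gamma (a + 1) / Gamma (a + n + 1)"
    using * nn by (subst nn_integral_eq_integrable[symmetric]) (auto simp: genus_age_law_def)
  then show "integrable (genus_age_law n) (\<lambda>u. (1 - u) powr a)"
    and "(\<integral>u. (1 - u) powr a \<partial>genus_age_law n) = Gamma (n + 1) * Gamma (a + 1) / Gamma (a + n + 1)" by auto
qed

text \<open>The moment of order b r has the numerator Gamma(b r + 1), which cancels the denominator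
  in E_{b,1}, and the denominator Gamma(b r + n + 1), which is the one in E_{b,n+1}.\<close>

lemma integral_mittag_leffler_genus_age:
  assumes n: "0 < n" and b: "0 < b" "b < 1" and t: "0 < t"
  shows "(\<integral>u. mittag_leffler b 1 (- c * (t * (1 - u)) powr b) \<partial>genus_age_law n) = Gamma (n + 1) * mittag_leffler b (n + 1) (- c * t powr b)"
    and "integrable (genus_age_law n) (\<lambda>u. mittag_leffler b 1 (- c * (t * (1 - u)) powr b))"
proof -
  let ?M = "genus_age_law n"
  define a where "a r = (- c * t powr b) ^ r / Gamma (b * real r + 1)" for r
  define V where "V u = (1 - u) powr b" for u :: real
  \<comment> \<open>Not true at u = 1 with r = 0: there the left side is \<open>0 ^ 0\<close>, which
    is 1, and the right side is \<open>0 powr 0\<close>, which is 0.\<close>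
  have V: "AE u in ?M. V u ^ r = (1 - u) powr (b * real r)" for r
    using AE_genus_age_law[of n] by eventually_elim (simp add: V_def powr_powr[symmetric] powr_realpow)
  have [measurable]: "(\<lambda>u. V u ^ r) \<in> borel_measurable ?M" "(\<lambda>u. (1 - u) powr (b * real r)) \<in> borel_measurable ?M" for r
    unfolding V_def by (auto simp: genus_age_law_def)
  have int: "integrable ?M (\<lambda>u. V u ^ r)" for r
    using integrable_cong_AE[OF _ _ V[of r]] genus_age_law_moment(1)[OF n, of "b * real r"] b by simp
  have m: "(\<integral>u. V u ^ r \<partial>?M) = Gamma (n + 1) * Gamma (b * real r + 1) / Gamma (b * real r + n + 1)" for r
    using integral_cong_AE[OF _ _ V[of r]] genus_age_law_moment(2)[OF n, of "b * real r"] b by simp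
  have g: "Gamma (b * real r + 1) > 0" "Gamma (b * real r + n + 1) > 0" for r
    using b n by (auto intro!: Gamma_real_pos add_nonneg_pos)
  have g1: "Gamma (n + 1) > 0" using n by (auto intro!: Gamma_real_pos)
  have am: "\<bar>a r\<bar> = \<bar>c * t powr b\<bar> ^ r / Gamma (b * real r + 1)" for r
    using g(1)[of r] by (simp add: a_def power_abs abs_mult)
  have sm: "summable (\<lambda>r. \<bar>a r\<bar> * (Gamma (n + 1) * Gamma (b * real r + 1) / Gamma (b * real r + n + 1)))"
  proof -
    have "summable (\<lambda>r. Gamma (n + 1) * (\<bar>c * t powr b\<bar> ^ r / Gamma (b * real r + (n + 1))))"
      using summable_mittag_leffler[OF b, of "n + 1"] n by (intro summable_mult) auto
    moreover have "\<bar>a r\<bar> * (Gamma (n + 1) * Gamma (b * real r + 1) / Gamma (b * real r + n + 1))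
        = Gamma (n + 1) * (\<bar>c * t powr b\<bar> ^ r / Gamma (b * real r + (n + 1)))" for r
      unfolding am using g(1)[of r] by (simp add: add.assoc)
    ultimately show ?thesis by simp
  qed
  have s: "AE u in ?M. summable (\<lambda>r. \<bar>a r\<bar> * V u ^ r)"
  proof (rule AE_I2)
    fix u
    have "summable (\<lambda>r. \<bar>c * t powr b * V u\<bar> ^ r / Gamma (b * real r + 1))"
      using b by (intro summable_mittag_leffler) auto
    moreover have "\<bar>a r\<bar> * V u ^ r = \<bar>c * t powr b * V u\<bar> ^ r / Gamma (b * real r + 1)" for r
      unfolding am by (simp add: V_def abs_mult power_mult_distrib)
    ultimately show "summable (\<lambda>r. \<bar>a r\<bar> * V u ^ r)" by simp
  qed
  have nn: "AE u in ?M. 0 \<le> V u" by (simp add: V_def)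
  note S = sums_integral_power_series[OF int nn m s sm]
  have e: "AE u in ?M. mittag_leffler b 1 (- c * (t * (1 - u)) powr b) = (\<Sum>r. a r * V u ^ r)"
    using AE_genus_age_law[of n]
  proof eventually_elim
    case (elim u)
    have "(- c * (t * (1 - u)) powr b) ^ r / Gamma (b * real r + 1) = a r * V u ^ r" for r
    proof -
      have "- c * (t * (1 - u)) powr b = (- c * t powr b) * V u" using elim t by (simp add: powr_mult V_def)
      then show ?thesis by (simp only: power_mult_distrib a_def times_divide_eq_left)
    qed
    then show ?case by (simp only: mittag_leffler_def)
  qed
  have meas[measurable]: "(\<lambda>u. mittag_leffler b 1 (- c * (t * (1 - u)) powr b)) \<in> borel_measurable ?M"
    unfolding mittag_leffler_def by (simp add: genus_age_law_def)
  have "(\<integral>u. mittag_leffler b 1 (- c * (t * (1 - u)) powr b) \<partial>?M) = (\<integral>u. (\<Sum>r. a r * V u ^ r) \<partial>?M)"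
    by (intro integral_cong_AE e meas borel_measurable_integrable S(2))
  also have "\<dots> = (\<Sum>r. a r * (Gamma (n + 1) * Gamma (b * real r + 1) / Gamma (b * real r + n + 1)))"
    using sums_unique[OF S(1)] .
  also have "\<dots> = (\<Sum>r. Gamma (n + 1) * ((- c * t powr b) ^ r / Gamma (b * real r + (n + 1))))"
  proof (rule suminf_cong)
    fix r
    show "a r * (Gamma (n + 1) * Gamma (b * real r + 1) / Gamma (b * real r + n + 1)) = Gamma (n + 1) * ((- c * t powr b) ^ r / Gamma (b * real r + (n + 1)))"
      unfolding a_def using g(1)[of r] by (simp add: add.assoc)
  qed
  also have "\<dots> = Gamma (n + 1) * mittag_leffler b (n + 1) (- c * t powr b)"
    unfolding mittag_leffler_def
  proof (rule suminf_mult)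
    have "summable (\<lambda>r. \<bar>- c * t powr b\<bar> ^ r / Gamma (b * real r + (n + 1)))"
      using b n by (intro summable_mittag_leffler) auto
    moreover have "norm ((- c * t powr b) ^ r / Gamma (b * real r + (n + 1))) = \<bar>- c * t powr b\<bar> ^ r / Gamma (b * real r + (n + 1))" for r
      using g(2)[of r] by (simp add: power_abs abs_mult add.assoc)
    ultimately show "summable (\<lambda>r. (- c * t powr b) ^ r / Gamma (b * real r + (n + 1)))"
      by - (rule summable_norm_cancel, simp only:)
  qed
  finally show "(\<integral>u. mittag_leffler b 1 (- c * (t * (1 - u)) powr b) \<partial>?M) = Gamma (n + 1) * mittag_leffler b (n + 1) (- c * t powr b)" .
  show "integrable ?M (\<lambda>u. mittag_leffler b 1 (- c * (t * (1 - u)) powr b))"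
  proof (rule integrable_cong_AE_imp[OF S(2) meas])
    show "AE u in ?M. (\<Sum>r. a r * V u ^ r) = mittag_leffler b 1 (- c * (t * (1 - u)) powr b)"
      using e by eventually_elim (rule sym)
  qed
qed


section \<open>The inverse stable subordinator\<close>

text \<open>On the event that the set is empty, the infimum is the fixed but unspecified real \<open>Inf {}\<close>.\<close>

lemma hitting_time_measurable:
  fixes P :: "real \<Rightarrow> 'a \<Rightarrow> bool"
  assumes P: "\<And>s. 0 \<le> s \<Longrightarrow> {\<omega>\<in>space N. P s \<omega>} \<in> sets N"
    and mono: "\<And>\<omega> s s'. \<omega> \<in> space N \<Longrightarrow> 0 \<le> s \<Longrightarrow> s \<le> s' \<Longrightarrow> P s \<omega> \<Longrightarrow> P s' \<omega>"
  shows "(\<lambda>\<omega>. Inf {s. 0 \<le> s \<and> P s \<omega>}) \<in> borel_measurable N"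
proof (rule borel_measurableI_less)
  fix y :: real
  let ?c = "Inf {} :: real"
  let ?S = "\<lambda>\<omega>. {s. 0 \<le> s \<and> P s \<omega>}"
  have bdd: "bdd_below (?S \<omega>)" for \<omega> by (auto intro!: bdd_belowI[of _ 0])
  have ne: "?S \<omega> \<noteq> {} \<longleftrightarrow> (\<exists>n::nat. P (real n) \<omega>)" if "\<omega> \<in> space N" for \<omega>
  proof
    assume "?S \<omega> \<noteq> {}"
    then obtain s where s: "0 \<le> s" "P s \<omega>" by auto
    obtain n where "s \<le> real n" using real_arch_simple by blast
    then show "\<exists>n::nat. P (real n) \<omega>" using mono[OF that s(1) _ s(2)] by blast
  next
    assume "\<exists>n::nat. P (real n) \<omega>"
    then show "?S \<omega> \<noteq> {}" using of_nat_0_le_iff by blast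
  qed
  \<comment> \<open>Monotonicity moves a witness s < y up to a rational time before y, so countably
    many events describe the condition.\<close>
  have lt: "Inf (?S \<omega>) < y \<longleftrightarrow> (\<exists>q\<in>\<rat> \<inter> {0..<y}. P q \<omega>)" if \<omega>: "\<omega> \<in> space N" and n: "?S \<omega> \<noteq> {}" for \<omega>
  proof
    assume "Inf (?S \<omega>) < y"
    then obtain s where s: "s \<in> ?S \<omega>" "s < y" using cInf_less_iff[OF n bdd] by blast
    obtain q where "q \<in> \<rat>" "s < q" "q < y" using Rats_dense_in_real[OF s(2)] by blast
    then show "\<exists>q\<in>\<rat> \<inter> {0..<y}. P q \<omega>" using s mono[OF \<omega>, of s q] by (intro bexI[of _ q]) auto
  next
    assume "\<exists>q\<in>\<rat> \<inter> {0..<y}. P q \<omega>"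
    then show "Inf (?S \<omega>) < y" using cInf_less_iff[OF n bdd] by auto
  qed
  let ?E = "{\<omega>\<in>space N. \<exists>n\<in>(UNIV::nat set). P (real n) \<omega>}"
  have "{\<omega>\<in>space N. Inf (?S \<omega>) < y} = (?E \<inter> {\<omega>\<in>space N. \<exists>q\<in>\<rat> \<inter> {0..<y}. P q \<omega>}) \<union> ((space N - ?E) \<inter> {\<omega>\<in>space N. ?c < y})"
    (is "?L = ?R")
  proof (rule set_eqI)
    fix \<omega>
    show "\<omega> \<in> ?L \<longleftrightarrow> \<omega> \<in> ?R"
    proof (cases "\<omega> \<in> space N \<and> ?S \<omega> \<noteq> {}")
      case True
      then show ?thesis using lt[of \<omega>] ne[of \<omega>] by simp
    next
      case False
      then show ?thesis
      proof (cases "\<omega> \<in> space N")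
        case True
        then have e: "?S \<omega> = {}" using False by blast
        then show ?thesis using True ne[OF True] unfolding mem_Collect_eq e by simp
      qed simp
    qed
  qed
  moreover have "?E \<in> sets N" using P by (intro sets.sets_Collect_countable_Bex) auto
  moreover have "(\<Union>q\<in>\<rat> \<inter> {0..<y}. {\<omega>\<in>space N. P q \<omega>}) \<in> sets N"
    by (rule sets.countable_UN''[OF countable_Int1[OF countable_rat]]) (auto intro: P)
  then have "{\<omega>\<in>space N. \<exists>q\<in>\<rat> \<inter> {0..<y}. P q \<omega>} \<in> sets N"
    by (rule back_subst[of "\<lambda>A. A \<in> sets N"]) auto
  ultimately show "{\<omega>\<in>space N. Inf (?S \<omega>) < y} \<in> sets N" by simp
qed

lemma inverse_process_measurable:
  assumes D: "\<And>x. 0 \<le> x \<Longrightarrow> D x \<in> borel_measurable N"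
    and mono: "\<And>\<omega>. \<omega> \<in> space N \<Longrightarrow> mono_on {0..} (\<lambda>x. D x \<omega>)"
  shows "inverse_process D s \<in> borel_measurable N"
  unfolding inverse_process_def[abs_def]
proof (rule hitting_time_measurable)
  show "{\<omega>\<in>space N. s < D x \<omega>} \<in> sets N" if "0 \<le> x" for x
    using D[OF that] by measurable
  show "s < D x' \<omega>" if "\<omega> \<in> space N" "0 \<le> x" "x \<le> x'" "s < D x \<omega>" for \<omega> x x'
    using mono_onD[OF mono[OF that(1)], of x x'] that by auto
qed

section \<open>Tails, self-similarity and negative moments of the stable subordinator\<close>

locale stable_subordinator_space = prob_space +
  fixes b :: real and D :: "real \<Rightarrow> 'a \<Rightarrow> real"
  assumes b: "0 < b" "b < 1" and D: "stable_subordinator M b D"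
begin

lemma D_meas [measurable]: "0 \<le> x \<Longrightarrow> D x \<in> borel_measurable M"
  using D by (simp add: stable_subordinator_def subordinator_def)

lemma D_mono: "\<omega> \<in> space M \<Longrightarrow> mono_on {0..} (\<lambda>x. D x \<omega>)"
  using D by (simp add: stable_subordinator_def subordinator_def)

lemma D_nonneg: "\<omega> \<in> space M \<Longrightarrow> 0 \<le> x \<Longrightarrow> 0 \<le> D x \<omega>"
  using D mono_onD[OF D_mono, of \<omega> 0 x] by (simp add: stable_subordinator_def subordinator_def)

lemma D_laplace: "0 \<le> x \<Longrightarrow> 0 \<le> s \<Longrightarrow> (\<integral>\<omega>. exp (- s * D x \<omega>) \<partial>M) = exp (- x * s powr b)"
  using D stable_levy_exponent[OF b, of s] by (simp add: stable_subordinator_def subordinator_def)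

lemma D_laplace_integrable:
  assumes "0 \<le> x" "0 \<le> s" shows "integrable M (\<lambda>\<omega>. exp (- s * D x \<omega>))"
proof (rule integrable_const_bound[where B=1])
  show "AE \<omega> in M. norm (exp (- s * D x \<omega>)) \<le> 1"
    using D_nonneg assms by (intro AE_I2) simp
qed (use assms in measurable)

text \<open>Markov's inequality for exp(-s D_x). Letting s grow with a = 0 gives positivity, letting
  x grow with s = 1 gives unboundedness.\<close>

lemma D_tail_bound:
  assumes "0 \<le> x" "0 \<le> s" shows "prob {\<omega>\<in>space M. D x \<omega> \<le> a} \<le> exp (s * a) * exp (- x * s powr b)"
proof -
  have [measurable]: "D x \<in> borel_measurable M" using assms by measurable
  have "prob {\<omega>\<in>space M. D x \<omega> \<le> a} = (\<integral>\<omega>. indicator {\<omega>\<in>space M. D x \<omega> \<le> a} \<omega> \<partial>M)" by simp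
  also have "\<dots> \<le> (\<integral>\<omega>. exp (s * a) * exp (- s * D x \<omega>) \<partial>M)"
  proof (rule integral_mono)
    fix \<omega>
    show "indicator {\<omega>\<in>space M. D x \<omega> \<le> a} \<omega> \<le> exp (s * a) * exp (- s * D x \<omega>)"
      using assms mult_left_mono[of "D x \<omega>" a s] by (auto simp: indicator_def exp_add[symmetric])
  qed (use D_laplace_integrable[OF assms] in \<open>auto simp: integrable_indicator_iff emeasure_eq_measure\<close>)
  finally show ?thesis using D_laplace[OF assms] by simp
qed

lemma D_pos: "AE \<omega> in M. 0 < D 1 \<omega>"
proof -
  have [measurable]: "D 1 \<in> borel_measurable M" by measurable
  have "(\<lambda>n. exp (- (real n powr b))) \<longlonglongrightarrow> 0"
  proof (intro filterlim_compose[OF exp_at_bot] filterlim_compose[OF filterlim_uminus_at_bot_at_top] filterlim_at_top[THEN iffD2] allI)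
    fix Z :: real
    have "\<forall>\<^sub>F n in sequentially. real n \<ge> (max Z 0) powr (1 / b)"
      using filterlim_real_sequentially by (auto simp: filterlim_at_top)
    then show "\<forall>\<^sub>F n in sequentially. Z \<le> real n powr b"
    proof eventually_elim
      case (elim n)
      then have "((max Z 0) powr (1 / b)) powr b \<le> real n powr b" using b by (intro powr_mono2) auto
      then show ?case using b by (simp add: powr_powr)
    qed
  qed
  moreover have "prob {\<omega>\<in>space M. D 1 \<omega> \<le> 0} \<le> exp (- (real n powr b))" for n
    using D_tail_bound[of 1 "real n" 0] by simp
  ultimately have "prob {\<omega>\<in>space M. D 1 \<omega> \<le> 0} \<le> 0" by (intro LIMSEQ_le_const) auto
  then have "prob {\<omega>\<in>space M. \<not> 0 < D 1 \<omega>} = 0" by (simp add: not_less measure_le_0_iff)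
  then show ?thesis by (subst AE_iff_measurable[OF _ refl]) (auto simp: emeasure_eq_measure)
qed

text \<open>Guarantees that almost surely \<open>inverse_process\<close> is the infimum of a
  nonempty set. Natural times keep the exceptional event measurable.\<close>

lemma D_unbounded: "AE \<omega> in M. \<exists>n::nat. a < D (real n) \<omega>"
proof -
  have [measurable]: "D (real n) \<in> borel_measurable M" for n by measurable
  let ?B = "{\<omega>\<in>space M. \<not> (\<exists>n::nat. a < D (real n) \<omega>)}"
  have "(\<lambda>n. exp a * exp (- real n)) \<longlonglongrightarrow> exp a * 0"
    by (intro tendsto_mult tendsto_const filterlim_compose[OF exp_at_bot] filterlim_compose[OF filterlim_uminus_at_bot_at_top] filterlim_real_sequentially) 
  moreover have "prob ?B \<le> exp a * exp (- real n)" for n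
  proof -
    have "prob ?B \<le> prob {\<omega>\<in>space M. D (real n) \<omega> \<le> a}" by (intro finite_measure_mono) (auto simp: not_less)
    then show ?thesis using D_tail_bound[of "real n" 1 a] by simp
  qed
  ultimately have "prob ?B \<le> exp a * 0" by (rule LIMSEQ_le_const[OF _ exI, OF _ allI, OF _ impI])
  then have "prob ?B = 0" by (simp add: measure_le_0_iff)
  then show ?thesis by (subst AE_iff_measurable[OF _ refl]) (auto simp: emeasure_eq_measure)
qed

lemma D_scaling:
  assumes x: "0 < x"
  shows "prob {\<omega>\<in>space M. a < D x \<omega>} = prob {\<omega>\<in>space M. a < x powr (1 / b) * D 1 \<omega>}"
proof -
  let ?c = "x powr (1 / b)"
  have [measurable]: "D x \<in> borel_measurable M" "D 1 \<in> borel_measurable M" using x by auto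
  let ?X = "\<lambda>\<omega>. exp (- D x \<omega>)" and ?Y = "\<lambda>\<omega>. exp (- (?c * D 1 \<omega>))"
  have "distr M borel ?X = distr M borel ?Y"
  proof (rule moments_determine_unit_interval)
    show "real_distribution (distr M borel ?X)" "real_distribution (distr M borel ?Y)"
      by (auto intro!: real_distribution_distr)
    show "AE y in distr M borel ?X. 0 \<le> y \<and> y \<le> 1"
      using x D_nonneg by (subst AE_distr_iff) auto
    show "AE y in distr M borel ?Y. 0 \<le> y \<and> y \<le> 1"
      using x D_nonneg by (subst AE_distr_iff) auto
    fix n
    have "(\<integral>y. y ^ n \<partial>distr M borel ?X) = (\<integral>\<omega>. exp (- real n * D x \<omega>) \<partial>M)"
      by (subst integral_distr) (auto simp: exp_of_nat_mult[symmetric])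
    also have "\<dots> = exp (- x * real n powr b)" using x by (intro D_laplace) auto
    \<comment> \<open>Self-similarity in one line: x n^b = (n x^(1/b))^b turns the exponent at time
      x into the exponent at time 1.\<close>
    also have "\<dots> = exp (- 1 * (real n * ?c) powr b)"
      using x b by (simp add: powr_mult powr_powr mult.commute)
    also have "\<dots> = (\<integral>\<omega>. exp (- (real n * ?c) * D 1 \<omega>) \<partial>M)" using x by (intro D_laplace[symmetric]) auto
    also have "\<dots> = (\<integral>y. y ^ n \<partial>distr M borel ?Y)"
      by (subst integral_distr) (auto simp: exp_of_nat_mult[symmetric] mult_ac)
    finally show "(\<integral>y. y ^ n \<partial>distr M borel ?X) = (\<integral>y. y ^ n \<partial>distr M borel ?Y)" .
  qed
  \<comment> \<open>Since y \<mapsto> exp(-y) is strictly decreasing, {a < D_x} is the event that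
    exp(-D_x) lies below exp(-a).\<close>
  then have "measure (distr M borel ?X) {..<exp (- a)} = measure (distr M borel ?Y) {..<exp (- a)}" by simp
  then show ?thesis
    by (simp add: measure_distr vimage_def Int_def conj_commute)
qed

text \<open>D_1^(-p) is a Gamma integral of exp(-x D_1); taking the expectation inside leaves the
  integral of x^(p-1) exp(-x^b), which is elementary. The values are the moments of the
  Mittag-Leffler distribution.\<close>

lemma D_negative_moments:
  shows "integrable M (\<lambda>\<omega>. (D 1 \<omega> powr (- b)) ^ r)"
    and "(\<integral>\<omega>. (D 1 \<omega> powr (- b)) ^ r \<partial>M) = fact r / Gamma (b * real r + 1)"
proof -
  have [measurable]: "D 1 \<in> borel_measurable M" by simp
  have "integrable M (\<lambda>\<omega>. (D 1 \<omega> powr (- b)) ^ r) \<and> (\<integral>\<omega>. (D 1 \<omega> powr (- b)) ^ r \<partial>M) = fact r / Gamma (b * real r + 1)"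
  \<comment> \<open>For r = 0 the exponent p would be 0, where the Gamma integral diverges.\<close>
  proof (cases "r = 0")
    case True
    then show ?thesis by (simp add: prob_space)
  next
    case False
    define p where "p = b * real r"
    have p: "0 < p" using False b by (simp add: p_def)
    have g: "Gamma p > 0" "Gamma (p + 1) > 0" using p by (auto intro: Gamma_real_pos)
    interpret P: pair_sigma_finite M lborel ..
    have "(\<integral>\<^sup>+\<omega>. ennreal (Gamma p) * ennreal ((D 1 \<omega> powr (- b)) ^ r) \<partial>M)
      = (\<integral>\<^sup>+\<omega>. \<integral>\<^sup>+x. ennreal (indicator {0<..} x * (x powr (p - 1) * exp (- D 1 \<omega> * x))) \<partial>lborel \<partial>M)"
    proof (rule nn_integral_cong_AE)
      show "AE \<omega> in M. ennreal (Gamma p) * ennreal ((D 1 \<omega> powr (- b)) ^ r)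
        = (\<integral>\<^sup>+x. ennreal (indicator {0<..} x * (x powr (p - 1) * exp (- D 1 \<omega> * x))) \<partial>lborel)"
        using D_pos
      proof eventually_elim
        case (elim \<omega>)
        have "(D 1 \<omega> powr (- b)) ^ r = D 1 \<omega> powr (- p)"
          using elim by (simp add: p_def powr_powr[symmetric] powr_realpow[symmetric] del: powr_powr) (simp add: powr_powr)
        then show ?case using nn_integral_Gamma_scaled[OF p elim] g by (simp add: ennreal_mult')
      qed
    qed
    also have "\<dots> = (\<integral>\<^sup>+x. \<integral>\<^sup>+\<omega>. ennreal (indicator {0<..} x * (x powr (p - 1) * exp (- D 1 \<omega> * x))) \<partial>M \<partial>lborel)"
      by (rule P.Fubini'[symmetric]) measurable
    also have "\<dots> = (\<integral>\<^sup>+x. ennreal (indicator {0<..} x * (x powr (p - 1) * exp (- (x powr b)))) \<partial>lborel)"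
    proof (rule nn_integral_cong)
      fix x :: real
      show "(\<integral>\<^sup>+\<omega>. ennreal (indicator {0<..} x * (x powr (p - 1) * exp (- D 1 \<omega> * x))) \<partial>M)
         = ennreal (indicator {0<..} x * (x powr (p - 1) * exp (- (x powr b))))"
      proof (cases "0 < x")
        case True
        have "(\<integral>\<^sup>+\<omega>. ennreal (indicator {0<..} x * (x powr (p - 1) * exp (- D 1 \<omega> * x))) \<partial>M)
          = (\<integral>\<^sup>+\<omega>. ennreal (x powr (p - 1)) * ennreal (exp (- x * D 1 \<omega>)) \<partial>M)"
          using True by (intro nn_integral_cong) (simp add: ennreal_mult' mult.commute)
        also have "\<dots> = ennreal (x powr (p - 1)) * (\<integral>\<^sup>+\<omega>. ennreal (exp (- x * D 1 \<omega>)) \<partial>M)"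
          by (rule nn_integral_cmult) measurable
        also have "(\<integral>\<^sup>+\<omega>. ennreal (exp (- x * D 1 \<omega>)) \<partial>M) = ennreal (exp (- (x powr b)))"
          using True D_laplace[of 1 x] D_laplace_integrable[of 1 x] by (subst nn_integral_eq_integral) auto
        finally show ?thesis using True by (simp add: ennreal_mult')
      qed simp
    qed
    also have "\<dots> = ennreal (Gamma (real r + 1) / p)"
      using nn_integral_powr_exp_powr[OF p b(1)] b by (simp add: p_def)
    finally have 1: "ennreal (Gamma p) * (\<integral>\<^sup>+\<omega>. ennreal ((D 1 \<omega> powr (- b)) ^ r) \<partial>M) = ennreal (fact r / p)"
      by (simp add: nn_integral_cmult Gamma_fact add.commute)
    have "(\<integral>\<^sup>+\<omega>. ennreal ((D 1 \<omega> powr (- b)) ^ r) \<partial>M) = ennreal (1 / Gamma p) * (ennreal (Gamma p) * (\<integral>\<^sup>+\<omega>. ennreal ((D 1 \<omega> powr (- b)) ^ r) \<partial>M))"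
      using g by (simp add: mult.assoc[symmetric] ennreal_mult'[symmetric])
    also have "\<dots> = ennreal (1 / Gamma p * (fact r / p))"
      unfolding 1 using g by (simp add: ennreal_mult'[symmetric])
    also have "1 / Gamma p * (fact r / p) = fact r / Gamma (b * real r + 1)"
    proof -
      have "Gamma (p + 1) = p * Gamma p" using p by (intro Gamma_plus1) (auto elim: nonpos_Ints_cases)
      then show ?thesis by (simp add: p_def mult.commute)
    qed
    finally have "(\<integral>\<^sup>+\<omega>. ennreal ((D 1 \<omega> powr (- b)) ^ r) \<partial>M) = ennreal (fact r / Gamma (b * real r + 1))" .
    moreover have "0 \<le> fact r / Gamma (b * real r + 1)" using g by (simp add: p_def)
    ultimately show ?thesis
      by (subst nn_integral_eq_integrable[symmetric]) auto
  qed
  then show "integrable M (\<lambda>\<omega>. (D 1 \<omega> powr (- b)) ^ r)"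
    and "(\<integral>\<omega>. (D 1 \<omega> powr (- b)) ^ r \<partial>M) = fact r / Gamma (b * real r + 1)" by auto
qed

section \<open>First passage times of the subordinator\<close>

lemma inverse_meas [measurable]: "inverse_process D s \<in> borel_measurable M"
  by (rule inverse_process_measurable) (auto simp: D_mono)

text \<open>The witness n excludes the infimum of the empty set. Together with
  \<open>inverse_le\<close> this yields the two inclusions that place {s < D_y} between {E_s < y}
  and {E_s \<le> y}.\<close>

lemma inverse_less:
  assumes \<omega>: "\<omega> \<in> space M" and n: "s < D (real n) \<omega>" and y: "inverse_process D s \<omega> < y"
  shows "0 < y \<and> s < D y \<omega>"
proof -
  let ?S = "{x. 0 \<le> x \<and> s < D x \<omega>}"
  have "real n \<in> ?S" using n by simp
  then have "?S \<noteq> {}" by blast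
  then obtain x where x: "x \<in> ?S" "x < y"
    using y cInf_lessD[of ?S y] unfolding inverse_process_def by blast
  then show ?thesis using mono_onD[OF D_mono[OF \<omega>], of x y] by auto
qed

lemma inverse_le:
  assumes "0 \<le> y" "s < D y \<omega>"
  shows "inverse_process D s \<omega> \<le> y"
  unfolding inverse_process_def using assms by (intro cInf_lower) (auto intro!: bdd_belowI[of _ 0])

lemma inverse_nonneg: "s < D (real n) \<omega> \<Longrightarrow> 0 \<le> inverse_process D s \<omega>"
  unfolding inverse_process_def by (rule cInf_greatest) (use of_nat_0_le_iff in blast)+

lemma AE_inverse_nonneg: "AE \<omega> in M. 0 \<le> inverse_process D s \<omega>"
  using D_unbounded[of s] by eventually_elim (auto intro: inverse_nonneg)

text \<open>For y > 0, s^b D_1^(-b) < y means s < y^(1/b) D_1. By scaling this has the probability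
  of {s < D_y}, the event between {E_s < y} and {E_s \<le> y}. For y \<le> 0 the two left-hand
  measures are zero.\<close>

lemma inverse_law:
  assumes s: "0 < s"
  shows "distr M borel (inverse_process D s) = distr M borel (\<lambda>\<omega>. s powr b * D 1 \<omega> powr (- b))"
proof (rule real_distribution_eq_sandwich)
  let ?E = "inverse_process D s" and ?V = "\<lambda>\<omega>. s powr b * D 1 \<omega> powr (- b)"
  have [measurable]: "D 1 \<in> borel_measurable M" by simp
  show "real_distribution (distr M borel ?E)" "real_distribution (distr M borel ?V)"
    by (auto intro!: real_distribution_distr)
  have V: "prob {\<omega>\<in>space M. ?V \<omega> < y} = prob {\<omega>\<in>space M. s < D y \<omega>}" if y: "0 < y" for y
  proof -
    have "prob {\<omega>\<in>space M. ?V \<omega> < y} = prob {\<omega>\<in>space M. s < y powr (1 / b) * D 1 \<omega>}"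
    proof (rule finite_measure_eq_AE)
      show "AE \<omega> in M. (\<omega> \<in> {\<omega>\<in>space M. ?V \<omega> < y}) = (\<omega> \<in> {\<omega>\<in>space M. s < y powr (1 / b) * D 1 \<omega>})"
        using D_pos
      proof eventually_elim
        case (elim \<omega>)
        have "?V \<omega> < y \<longleftrightarrow> s powr b < y * D 1 \<omega> powr b" using elim by (simp add: powr_minus field_simps)
        also have "y * D 1 \<omega> powr b = (y powr (1 / b) * D 1 \<omega>) powr b" using elim y b by (simp add: powr_mult powr_powr)
        also have "s powr b < \<dots> \<longleftrightarrow> s < y powr (1 / b) * D 1 \<omega>"
          using s y elim b powr_less_mono2[of b s "y powr (1 / b) * D 1 \<omega>"] powr_mono2[of b "y powr (1 / b) * D 1 \<omega>" s]
          by (cases "s < y powr (1 / b) * D 1 \<omega>") (auto simp: not_less)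
        finally show ?case by simp
      qed
    qed simp_all
    also have "\<dots> = prob {\<omega>\<in>space M. s < D y \<omega>}" using D_scaling[OF y] by simp
    finally show ?thesis .
  qed
  fix y
  have mE: "measure (distr M borel ?E) {..<y} = prob {\<omega>\<in>space M. ?E \<omega> < y}"
           "measure (distr M borel ?E) {..y} = prob {\<omega>\<in>space M. ?E \<omega> \<le> y}"
           "measure (distr M borel ?V) {..<y} = prob {\<omega>\<in>space M. ?V \<omega> < y}"
    by (simp_all add: measure_distr vimage_def Int_def conj_commute)
  have [measurable]: "0 < y \<Longrightarrow> D y \<in> borel_measurable M" by simp
  show "measure (distr M borel ?E) {..<y} \<le> measure (distr M borel ?V) {..<y}"
  proof (cases "0 < y")
    case True
    have "prob {\<omega>\<in>space M. ?E \<omega> < y} \<le> prob {\<omega>\<in>space M. s < D y \<omega>}"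
    proof (rule finite_measure_mono_AE)
      show "AE \<omega> in M. \<omega> \<in> {\<omega>\<in>space M. ?E \<omega> < y} \<longrightarrow> \<omega> \<in> {\<omega>\<in>space M. s < D y \<omega>}"
        using D_unbounded[of s] by eventually_elim (use inverse_less in blast)
    qed (use True in measurable)
    then show ?thesis unfolding mE using V[OF True] by simp
  next
    case False
    have "prob {\<omega>\<in>space M. ?E \<omega> < y} = prob {}"
    proof (rule finite_measure_eq_AE)
      show "AE \<omega> in M. (\<omega> \<in> {\<omega>\<in>space M. ?E \<omega> < y}) = (\<omega> \<in> {})"
        using AE_inverse_nonneg[of s] by eventually_elim (use False in auto)
    qed simp_all
    then show ?thesis unfolding mE by simp
  qed
  show "measure (distr M borel ?V) {..<y} \<le> measure (distr M borel ?E) {..y}"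
  proof (cases "0 < y")
    case True
    have "prob {\<omega>\<in>space M. s < D y \<omega>} \<le> prob {\<omega>\<in>space M. ?E \<omega> \<le> y}"
      using True inverse_le[of y s] by (intro finite_measure_mono) auto
    then show ?thesis unfolding mE using V[OF True] by simp
  next
    case False
    have "0 \<le> ?V \<omega>" for \<omega> by simp
    then have "{\<omega>\<in>space M. ?V \<omega> < y} = {}" using False by (auto simp: not_less intro: order_trans)
    then show ?thesis unfolding mE by (simp only:) simp
  qed
qed

text \<open>The moments carry a factor r! that cancels the one in the exponential series; what
  remains is the Mittag-Leffler series.\<close>

lemma inverse_laplace:
  assumes s: "0 < s"
  shows "(\<integral>\<omega>. exp (- c * inverse_process D s \<omega>) \<partial>M) = mittag_leffler b 1 (- c * s powr b)"
    and "integrable M (\<lambda>\<omega>. exp (- c * inverse_process D s \<omega>))"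
proof -
  have [measurable]: "D 1 \<in> borel_measurable M" by simp
  define z where "z = - c * s powr b"
  let ?V = "\<lambda>\<omega>. D 1 \<omega> powr (- b)"
  have g: "Gamma (b * real r + 1) > 0" for r using b by (auto intro!: Gamma_real_pos add_nonneg_pos)
  have es: "exp (z * v) = (\<Sum>r. z ^ r / fact r * v ^ r)" for v
    by (simp add: exp_def power_mult_distrib field_simps)
  have s1: "AE \<omega> in M. summable (\<lambda>r. \<bar>z ^ r / fact r\<bar> * ?V \<omega> ^ r)"
  proof (rule AE_I2)
    fix \<omega>
    have "summable (\<lambda>r. inverse (fact r) * \<bar>z * ?V \<omega>\<bar> ^ r)" by (rule summable_exp)
    moreover have "inverse (fact r) * \<bar>z * ?V \<omega>\<bar> ^ r = \<bar>z ^ r / fact r\<bar> * ?V \<omega> ^ r" for r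
      by (simp add: abs_mult power_mult_distrib power_abs field_simps)
    ultimately show "summable (\<lambda>r. \<bar>z ^ r / fact r\<bar> * ?V \<omega> ^ r)" by simp
  qed
  have s2: "summable (\<lambda>r. \<bar>z ^ r / fact r\<bar> * (fact r / Gamma (b * real r + 1)))"
    using summable_mittag_leffler[OF b, of 1 z] by (simp add: power_abs)
  note S = sums_integral_power_series[OF D_negative_moments(1) _ D_negative_moments(2) s1 s2]
  have e: "(\<lambda>y. exp (- c * y)) \<in> borel_measurable borel" by measurable
  have i1: "integrable M (\<lambda>\<omega>. exp (- c * (s powr b * ?V \<omega>)))"
  proof -
    have "integrable M (\<lambda>\<omega>. exp (z * ?V \<omega>))" unfolding es by (rule S(2)) simp
    then show ?thesis by (simp only: z_def mult.assoc)
  qed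
  have "integrable (distr M borel (\<lambda>\<omega>. s powr b * ?V \<omega>)) (\<lambda>y. exp (- c * y))"
    using i1 by (subst integrable_distr_eq) auto
  then show "integrable M (\<lambda>\<omega>. exp (- c * inverse_process D s \<omega>))"
    unfolding inverse_law[OF s, symmetric] by (subst (asm) integrable_distr_eq) auto
  have "(\<integral>\<omega>. exp (- c * inverse_process D s \<omega>) \<partial>M) = (\<integral>y. exp (- c * y) \<partial>distr M borel (inverse_process D s))"
    by (subst integral_distr) auto
  also have "\<dots> = (\<integral>\<omega>. exp (- c * (s powr b * ?V \<omega>)) \<partial>M)"
    unfolding inverse_law[OF s] by (subst integral_distr) auto
  also have "\<dots> = (\<integral>\<omega>. (\<Sum>r. z ^ r / fact r * ?V \<omega> ^ r) \<partial>M)"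
    unfolding es[symmetric] by (simp only: z_def mult.assoc)
  also have "\<dots> = (\<Sum>r. z ^ r / fact r * (fact r / Gamma (b * real r + 1)))"
    by (rule sums_unique[OF S(1)]) simp
  also have "\<dots> = mittag_leffler b 1 z" by (simp add: mittag_leffler_def)
  finally show "(\<integral>\<omega>. exp (- c * inverse_process D s \<omega>) \<partial>M) = mittag_leffler b 1 (- c * s powr b)"
    by (simp add: z_def)
qed

end


section \<open>The fractional pure birth process\<close>

text \<open>\<open>sigma_process\<close> packaged as a measure, so that \<open>measurable\<close>
  can express that a functional of the path, such as a passage time, depends on this process
  alone.\<close>

definition process_algebra :: "'a measure \<Rightarrow> 'b measure \<Rightarrow> (real \<Rightarrow> 'a \<Rightarrow> 'b) \<Rightarrow> 'a measure" where
  "process_algebra \<Omega> S X = sigma (space \<Omega>) (\<Union>t\<in>{0..}. sigma_rv \<Omega> S (X t))"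

lemma space_process_algebra [simp]: "space (process_algebra \<Omega> S X) = space \<Omega>"
  unfolding process_algebra_def by (intro space_measure_of) (auto simp: sigma_rv_def)

lemma sets_process_algebra: "sets (process_algebra \<Omega> S X) = sigma_process \<Omega> S X"
  unfolding process_algebra_def sigma_process_def by (intro sets_measure_of) (auto simp: sigma_rv_def)

lemma measurable_process_algebra:
  assumes "0 \<le> t" "space S = UNIV"
  shows "X t \<in> measurable (process_algebra \<Omega> S X) S"
proof (rule measurableI)
  fix A assume "A \<in> sets S"
  then have "X t -` A \<inter> space \<Omega> \<in> sigma_process \<Omega> S X"
    unfolding sigma_process_def using assms(1) by (intro sigma_sets.Basic) (auto simp: sigma_rv_def)
  then show "X t -` A \<inter> space (process_algebra \<Omega> S X) \<in> sets (process_algebra \<Omega> S X)"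
    by (simp add: sets_process_algebra)
qed (use assms in auto)

lemma sigma_process_eventI:
  assumes "0 \<le> t"
  shows "{\<omega>\<in>space \<Omega>. P (X t \<omega>)} \<in> sigma_process \<Omega> (count_space UNIV) X"
proof -
  have "X t \<in> measurable (process_algebra \<Omega> (count_space UNIV) X) (count_space UNIV)"
    using assms by (intro measurable_process_algebra) auto
  from measurable_sets[OF this, of "{x. P x}"]
  show ?thesis by (simp add: sets_process_algebra vimage_def Int_def conj_commute)
qed

text \<open>The distance from x to the first S_n beyond x serves as \<delta>. If no S_n lies beyond
  x, the path has exploded and every \<delta> will do.\<close>

lemma counting_path_right_continuous:
  fixes S :: "nat \<Rightarrow> real"
  assumes mono: "\<And>n m. 1 \<le> n \<Longrightarrow> n \<le> m \<Longrightarrow> S n \<le> S m"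
  shows "\<exists>\<delta>>0. \<forall>x'. x \<le> x' \<and> x' < x + \<delta> \<longrightarrow> {n. 1 \<le> n \<and> S n \<le> x'} = {n. 1 \<le> n \<and> S n \<le> x}"
proof (cases "\<exists>n\<ge>1. x < S n")
  case False
  then have "S n \<le> x" if "1 \<le> n" for n using that by (meson not_less)
  then show ?thesis by (intro exI[of _ 1]) force
next
  case True
  define n0 where "n0 = (LEAST n. 1 \<le> n \<and> x < S n)"
  have n0: "1 \<le> n0" "x < S n0" using LeastI_ex[of "\<lambda>n. 1 \<le> n \<and> x < S n"] True by (auto simp: n0_def)
  have least: "S n \<le> x" if "1 \<le> n" "n < n0" for n
    using not_less_Least[of n "\<lambda>n. 1 \<le> n \<and> x < S n"] that by (auto simp: n0_def)
  show ?thesis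
  proof (intro exI[of _ "S n0 - x"] conjI allI impI)
    show "0 < S n0 - x" using n0 by simp
    fix x' assume "x \<le> x' \<and> x' < x + (S n0 - x)"
    then have x': "x \<le> x'" "x' < S n0" by auto
    have "n < n0" if "1 \<le> n" "S n \<le> x'" for n
    proof (rule ccontr)
      assume "\<not> n < n0"
      then have "S n0 \<le> S n" using mono[OF n0(1), of n] by simp
      then show False using x' that by simp
    qed
    then have eq: "S n \<le> x' \<longleftrightarrow> S n \<le> x" if "1 \<le> n" for n
      by (metis least order_trans that x'(1))
    show "{n. 1 \<le> n \<and> S n \<le> x'} = {n. 1 \<le> n \<and> S n \<le> x}"
      by (rule Collect_cong, rule conj_cong[OF refl], rule eq)
  qed
qed

text \<open>A finite supremum means that some S_n lies beyond x, and the first such n is Suc k.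
  \<open>S 1 \<le> x\<close> rules out the empty index set.\<close>

lemma counting_path_eq_iff:
  fixes S :: "nat \<Rightarrow> real"
  assumes mono: "\<And>n m. 1 \<le> n \<Longrightarrow> n \<le> m \<Longrightarrow> S n \<le> S m" and S1: "S 1 \<le> x" and k: "1 \<le> k"
  shows "(SUP n\<in>{n. 1 \<le> n \<and> S n \<le> x}. enat n) = enat k \<longleftrightarrow> S k \<le> x \<and> x < S (Suc k)"
proof -
  have val: "(SUP n\<in>{n. 1 \<le> n \<and> S n \<le> x}. enat n) = enat m" if "1 \<le> m" "S m \<le> x" "x < S (Suc m)" for m
  proof (rule antisym)
    show "(SUP n\<in>{n. 1 \<le> n \<and> S n \<le> x}. enat n) \<le> enat m"
    proof (rule SUP_least)
      fix n assume "n \<in> {n. 1 \<le> n \<and> S n \<le> x}"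
      then show "enat n \<le> enat m" using mono[of "Suc m" n] that by (cases "n \<le> m") auto
    qed
    show "enat m \<le> (SUP n\<in>{n. 1 \<le> n \<and> S n \<le> x}. enat n)" using that by (intro SUP_upper) auto
  qed
  show ?thesis
  proof
    assume eq: "(SUP n\<in>{n. 1 \<le> n \<and> S n \<le> x}. enat n) = enat k"
    have "\<exists>n\<ge>1. x < S n"
    proof (rule ccontr)
      assume "\<not> (\<exists>n\<ge>1. x < S n)"
      then have "S (Suc k) \<le> x" by (auto simp: not_less)
      then have "enat (Suc k) \<le> (SUP n\<in>{n. 1 \<le> n \<and> S n \<le> x}. enat n)" by (intro SUP_upper) auto
      then show False using eq by simp
    qed
    define n0 where "n0 = (LEAST n. 1 \<le> n \<and> x < S n)"
    have n0: "1 \<le> n0" "x < S n0" using LeastI_ex[of "\<lambda>n. 1 \<le> n \<and> x < S n"] \<open>\<exists>n\<ge>1. x < S n\<close> by (auto simp: n0_def)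
    then have "n0 \<noteq> 1" using S1 by auto
    then obtain m where m: "n0 = Suc m" "1 \<le> m" using n0 by (cases n0) auto
    have "S m \<le> x"
      using not_less_Least[of m "\<lambda>n. 1 \<le> n \<and> x < S n"] m by (auto simp: n0_def)
    then show "S k \<le> x \<and> x < S (Suc k)" using val[of m] m n0 eq by auto
  qed (use val k in blast)
qed

text \<open>For x \<ge> 0 this is \<open>hypoexp_density r k x / r k\<close>: state k is left at
  rate r_k, so the density of the departure time is r_k times the probability of being
  there.\<close>

definition birth_prob :: "(nat \<Rightarrow> real) \<Rightarrow> nat \<Rightarrow> real \<Rightarrow> real" where
  "birth_prob r k x = (\<Prod>j=1..k-1. r j) * (\<Sum>m=1..k. exp (- r m * x) * hypoexp_coeff r k m)"

text \<open>State k is occupied at time x when the first k - 1 holding times sum to at most x and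
  the first k to more than x. The events that these sums exceed x are nested, so the probability is
  a difference of two tails.\<close>

lemma (in prob_space) pure_birth_law:
  assumes r: "\<And>j. j \<ge> 1 \<Longrightarrow> 0 < r j" "inj_on r {1..}" and Y: "pure_birth_process M r Y"
    and x: "0 \<le> x" and k: "1 \<le> k"
  shows "prob {\<omega>\<in>space M. Y x \<omega> = enat k} = birth_prob r k x"
proof -
  obtain \<xi> where ind: "indep_vars (\<lambda>_. borel) \<xi> {1..}"
    and dist: "\<And>k. k \<ge> 1 \<Longrightarrow> distributed M lborel (\<xi> k) (\<lambda>x. ennreal (exponential_density (r k) x))"
    and pos: "\<And>k \<omega>. k \<ge> 1 \<Longrightarrow> \<omega> \<in> space M \<Longrightarrow> 0 < \<xi> k \<omega>"
    and Y: "\<And>t \<omega>. \<omega> \<in> space M \<Longrightarrow> Y t \<omega> = (SUP n\<in>{n. 1 \<le> n \<and> (\<Sum>j=1..<n. \<xi> j \<omega>) \<le> t}. enat n)"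
    using Y unfolding pure_birth_process_def by auto
  let ?S = "\<lambda>n \<omega>. \<Sum>j=1..<n. \<xi> j \<omega>"
  have mono: "?S n \<omega> \<le> ?S m \<omega>" if "\<omega> \<in> space M" "n \<le> m" for n m \<omega>
    using that pos by (intro sum_mono2) (auto intro: less_imp_le)
  have [measurable]: "\<xi> j \<in> borel_measurable M" if "j \<ge> 1" for j
    using distributed_measurable[OF dist[OF that]] by simp
  have Sm[measurable]: "?S n \<in> borel_measurable M" for n by measurable
  have tail: "prob {\<omega>\<in>space M. x < ?S (Suc n) \<omega>} = (\<Prod>j=1..n. r j) * (\<Sum>m=1..n. exp (- r m * x) / r m * hypoexp_coeff r n m)"
    if "n \<ge> 1" for n
    using sum_exponentials_tail[OF r ind dist that x] by (simp add: atLeastLessThanSuc_atLeastAtMost)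
  have "prob {\<omega>\<in>space M. Y x \<omega> = enat k} = prob ({\<omega>\<in>space M. x < ?S (Suc k) \<omega>} - {\<omega>\<in>space M. x < ?S k \<omega>})"
  proof (rule arg_cong[where f=prob], rule set_eqI)
    fix \<omega>
    have "Y x \<omega> = enat k \<longleftrightarrow> ?S k \<omega> \<le> x \<and> x < ?S (Suc k) \<omega>" if "\<omega> \<in> space M"
      unfolding Y[OF that] using mono[OF that] x k by (intro counting_path_eq_iff) auto
    then show "\<omega> \<in> {\<omega>\<in>space M. Y x \<omega> = enat k} \<longleftrightarrow> \<omega> \<in> {\<omega>\<in>space M. x < ?S (Suc k) \<omega>} - {\<omega>\<in>space M. x < ?S k \<omega>}"
      by auto
  qed
  also have "\<dots> = prob {\<omega>\<in>space M. x < ?S (Suc k) \<omega>} - prob {\<omega>\<in>space M. x < ?S k \<omega>}"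
  proof (rule finite_measure_Diff)
    show "{\<omega>\<in>space M. x < ?S k \<omega>} \<subseteq> {\<omega>\<in>space M. x < ?S (Suc k) \<omega>}"
      using mono[of _ k "Suc k"] by force
  qed measurable
  also have "\<dots> = birth_prob r k x"
  proof (cases "k = 1")
    case True
    then show ?thesis using tail[of 1] r(1)[of 1] x by (simp add: birth_prob_def)
  next
    case False
    then obtain n where n: "k = Suc n" "n \<ge> 1" using k by (cases k) auto
    let ?A = "\<Prod>j=1..n. r j"
    have rk: "r k \<noteq> 0" using r(1)[OF k] by simp
    have rm: "r m \<noteq> 0" "r k \<noteq> r m" if "m \<in> {1..n}" for m
      using r(1)[of m] inj_onD[OF r(2), of k m] that n by auto
    have "prob {\<omega>\<in>space M. x < ?S (Suc k) \<omega>} - prob {\<omega>\<in>space M. x < ?S k \<omega>}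
       = ?A * r k * ((\<Sum>m=1..n. exp (- r m * x) / r m * hypoexp_coeff r k m) + exp (- r k * x) / r k * hypoexp_coeff r k k)
          - ?A * (\<Sum>m=1..n. exp (- r m * x) / r m * hypoexp_coeff r n m)"
      using tail[OF k] tail[OF n(2)] by (simp add: n(1))
    also have "\<dots> = ?A * ((\<Sum>m=1..n. r k * (exp (- r m * x) / r m * hypoexp_coeff r k m) - exp (- r m * x) / r m * hypoexp_coeff r n m) + r k * (exp (- r k * x) / r k * hypoexp_coeff r k k))"
      by (simp only: sum_subtractf sum_distrib_left[symmetric]) (simp only: algebra_simps)
    also have "(\<Sum>m=1..n. r k * (exp (- r m * x) / r m * hypoexp_coeff r k m) - exp (- r m * x) / r m * hypoexp_coeff r n m)
       = (\<Sum>m=1..n. exp (- r m * x) * hypoexp_coeff r k m)"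
    proof (rule sum.cong[OF refl])
      fix m assume m: "m \<in> {1..n}"
      \<comment> \<open>Here c is r_k and a is r_m. The two tails combine by c/(c-a) - 1 = a/(c-a),
        and the numerator cancels the 1/r_m that stems from integrating the density.\<close>
      have "c * (E / a * (h / (c - a))) - E / a * h = E * (h / (c - a))" if "a \<noteq> 0" "c \<noteq> a" for a c E h :: real
      proof -
        have "c * (E / a * (h / (c - a))) - E / a * h = (E / a * h) * (c / (c - a) - 1)" by (simp add: algebra_simps)
        also have "c / (c - a) - 1 = a / (c - a)" using that by (simp add: field_simps)
        finally show ?thesis using that by simp
      qed
      from this[OF rm[OF m]] show "r k * (exp (- r m * x) / r m * hypoexp_coeff r k m) - exp (- r m * x) / r m * hypoexp_coeff r n m
          = exp (- r m * x) * hypoexp_coeff r k m"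
        using hypoexp_coeff_Suc[OF m, of r] n(1) by simp
    qed
    also have "r k * (exp (- r k * x) / r k * hypoexp_coeff r k k) = exp (- r k * x) * hypoexp_coeff r k k" using rk by simp
    finally show ?thesis by (simp add: birth_prob_def n(1))
  qed
  finally show ?thesis .
qed

section \<open>Path regularity of the species process\<close>

lemma pure_birth_path:
  assumes "pure_birth_process M r Y"
  shows "\<exists>\<xi> :: nat \<Rightarrow> _ \<Rightarrow> real. (\<forall>k\<ge>1. \<forall>\<omega>\<in>space M. 0 < \<xi> k \<omega>) \<and> (\<forall>t. \<forall>\<omega>\<in>space M. Y t \<omega> = (SUP n\<in>{n. 1 \<le> n \<and> (\<Sum>j=1..<n. \<xi> j \<omega>) \<le> t}. enat n))"
  using assms unfolding pure_birth_process_def by (elim exE conjE) (intro exI conjI)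

lemma pure_birth_right_continuous:
  assumes Y: "pure_birth_process M r Y" and \<omega>: "\<omega> \<in> space M"
  shows "\<exists>\<delta>>0. \<forall>x'. x \<le> x' \<and> x' < x + \<delta> \<longrightarrow> Y x' \<omega> = Y x \<omega>"
proof -
  obtain \<xi> :: "nat \<Rightarrow> _ \<Rightarrow> real" where \<xi>: "(\<forall>k\<ge>1. \<forall>\<omega>\<in>space M. 0 < \<xi> k \<omega>) \<and> (\<forall>t. \<forall>\<omega>\<in>space M. Y t \<omega> = (SUP n\<in>{n. 1 \<le> n \<and> (\<Sum>j=1..<n. \<xi> j \<omega>) \<le> t}. enat n))"
    using pure_birth_path[OF Y] by (elim exE)
  then have pos: "\<And>k \<omega>. k \<ge> 1 \<Longrightarrow> \<omega> \<in> space M \<Longrightarrow> 0 < \<xi> k \<omega>"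
    and Y: "\<And>t \<omega>. \<omega> \<in> space M \<Longrightarrow> Y t \<omega> = (SUP n\<in>{n. 1 \<le> n \<and> (\<Sum>j=1..<n. \<xi> j \<omega>) \<le> t}. enat n)"
    by (elim conjE, simp)+
  have "\<exists>\<delta>>0. \<forall>x'. x \<le> x' \<and> x' < x + \<delta> \<longrightarrow> {n. 1 \<le> n \<and> (\<Sum>j=1..<n. \<xi> j \<omega>) \<le> x'} = {n. 1 \<le> n \<and> (\<Sum>j=1..<n. \<xi> j \<omega>) \<le> x}"
  proof (rule counting_path_right_continuous)
    fix n m :: nat assume "n \<le> m"
    then show "(\<Sum>j=1..<n. \<xi> j \<omega>) \<le> (\<Sum>j=1..<m. \<xi> j \<omega>)"
      using \<omega> pos by (intro sum_mono2) (auto intro: less_imp_le)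
  qed
  then obtain \<delta> where "\<delta> > 0"
    and eq: "\<And>x'. x \<le> x' \<and> x' < x + \<delta> \<Longrightarrow> {n. 1 \<le> n \<and> (\<Sum>j=1..<n. \<xi> j \<omega>) \<le> x'} = {n. 1 \<le> n \<and> (\<Sum>j=1..<n. \<xi> j \<omega>) \<le> x}"
    by blast
  have "Y x' \<omega> = Y x \<omega>" if "x \<le> x' \<and> x' < x + \<delta>" for x'
    by (simp only: Y[OF \<omega>] eq[OF that])
  then show ?thesis using \<open>\<delta> > 0\<close> by blast
qed

text \<open>Negative times do occur as values of \<open>inverse_process\<close>, namely \<open>Inf {}\<close> for bounded subordinator paths.\<close>

lemma pure_birth_negative:
  assumes Y: "pure_birth_process M r Y" and \<omega>: "\<omega> \<in> space M" and x: "x < 0"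
  shows "Y x \<omega> = 0"
proof -
  obtain \<xi> :: "nat \<Rightarrow> _ \<Rightarrow> real" where \<xi>: "(\<forall>k\<ge>1. \<forall>\<omega>\<in>space M. 0 < \<xi> k \<omega>) \<and> (\<forall>t. \<forall>\<omega>\<in>space M. Y t \<omega> = (SUP n\<in>{n. 1 \<le> n \<and> (\<Sum>j=1..<n. \<xi> j \<omega>) \<le> t}. enat n))"
    using pure_birth_path[OF Y] by (elim exE)
  then have pos: "\<And>k \<omega>. k \<ge> 1 \<Longrightarrow> \<omega> \<in> space M \<Longrightarrow> 0 < \<xi> k \<omega>"
    and Y: "\<And>t \<omega>. \<omega> \<in> space M \<Longrightarrow> Y t \<omega> = (SUP n\<in>{n. 1 \<le> n \<and> (\<Sum>j=1..<n. \<xi> j \<omega>) \<le> t}. enat n)"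
    by (elim conjE, simp)+
  have "0 \<le> (\<Sum>j=1..<n. \<xi> j \<omega>)" for n
    using pos \<omega> by (intro sum_nonneg) (auto intro: less_imp_le)
  then have "{n. 1 \<le> n \<and> (\<Sum>j=1..<n. \<xi> j \<omega>) \<le> x} = {}" using x by (auto simp: not_le intro: less_le_trans)
  then show ?thesis unfolding Y[OF \<omega>] by (simp only:) (simp add: bot_enat_def)
qed

text \<open>A nearly optimal x with s < D_x stays admissible for all levels below D_x. If no x is
  admissible at s, none is at higher levels, and the value stays the constant
  \<open>Inf {}\<close>.\<close>

lemma inverse_process_right_continuous:
  assumes \<epsilon>: "0 < \<epsilon>"
  shows "\<exists>\<delta>>0. \<forall>s'. s \<le> s' \<and> s' < s + \<delta> \<longrightarrow>
    inverse_process D s \<omega> \<le> inverse_process D s' \<omega> \<and> inverse_process D s' \<omega> < inverse_process D s \<omega> + \<epsilon>"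
proof -
  let ?S = "\<lambda>s. {x. 0 \<le> x \<and> s < D x \<omega>}"
  have bdd: "bdd_below (?S s)" for s by (auto intro!: bdd_belowI[of _ 0])
  show ?thesis
  proof (cases "?S s = {}")
    case True
    have S: "?S s' = ?S s" if s': "s \<le> s'" for s'
    proof -
      have "?S s' \<subseteq> ?S s" using s' by auto
      then show ?thesis using True by blast
    qed
    show ?thesis
    proof (intro exI[of _ 1] conjI allI impI)
      fix s' assume "s \<le> s' \<and> s' < s + 1"
      then have "inverse_process D s' \<omega> = inverse_process D s \<omega>"
        unfolding inverse_process_def by (intro arg_cong[where f=Inf] S) simp
      then show "inverse_process D s \<omega> \<le> inverse_process D s' \<omega>" "inverse_process D s' \<omega> < inverse_process D s \<omega> + \<epsilon>"
        using \<epsilon> by linarith+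
    qed simp
  next
    case False
    then obtain x where x: "x \<in> ?S s" "x < Inf (?S s) + \<epsilon>"
      using cInf_lessD[of "?S s" "Inf (?S s) + \<epsilon>"] \<epsilon> by auto
    have "Inf (?S s) \<le> Inf (?S s') \<and> Inf (?S s') < Inf (?S s) + \<epsilon>" if s': "s \<le> s'" "s' < s + (D x \<omega> - s)" for s'
    proof
      have xs: "x \<in> ?S s'" using x s' by auto
      then show "Inf (?S s) \<le> Inf (?S s')" using s' by (intro cInf_superset_mono bdd) auto
      show "Inf (?S s') < Inf (?S s) + \<epsilon>" using cInf_lower[OF xs bdd] x(2) by simp
    qed
    moreover have "0 < D x \<omega> - s" using x(1) by simp
    ultimately show ?thesis unfolding inverse_process_def by blast
  qed
qed

text \<open>Right of s the inverse stays at or above E_s and close to it, that is, inside the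
  interval on which the birth process keeps its value.\<close>

lemma fractional_birth_right_continuous:
  assumes Z: "fractional_birth_process M b r Z" and \<omega>: "\<omega> \<in> space M" and s: "0 \<le> s"
  shows "\<exists>\<delta>>0. \<forall>s'. s \<le> s' \<and> s' < s + \<delta> \<longrightarrow> Z s' \<omega> = Z s \<omega>"
proof -
  obtain Y D where Y: "pure_birth_process M r Y"
    and Z': "\<forall>t\<ge>0. \<forall>\<omega>\<in>space M. Z t \<omega> = Y (inverse_process D t \<omega>) \<omega>"
    using Z unfolding fractional_birth_process_def by blast
  have Z: "Z t \<omega> = Y (inverse_process D t \<omega>) \<omega>" if "0 \<le> t" "\<omega> \<in> space M" for t \<omega>
    using Z' that by simp
  obtain \<epsilon> where \<epsilon>: "\<epsilon> > 0"
      "\<forall>x'. inverse_process D s \<omega> \<le> x' \<and> x' < inverse_process D s \<omega> + \<epsilon> \<longrightarrow> Y x' \<omega> = Y (inverse_process D s \<omega>) \<omega>"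
    using pure_birth_right_continuous[OF Y \<omega>, of "inverse_process D s \<omega>"] by (elim exE conjE)
  obtain \<delta> where "\<delta> > 0" and \<delta>: "\<forall>s'. s \<le> s' \<and> s' < s + \<delta> \<longrightarrow>
    inverse_process D s \<omega> \<le> inverse_process D s' \<omega> \<and> inverse_process D s' \<omega> < inverse_process D s \<omega> + \<epsilon>"
    using inverse_process_right_continuous[OF \<epsilon>(1), of s D \<omega>] by (elim exE conjE)
  have "Z s' \<omega> = Z s \<omega>" if s': "s \<le> s' \<and> s' < s + \<delta>" for s'
  proof -
    have "Y (inverse_process D s' \<omega>) \<omega> = Y (inverse_process D s \<omega>) \<omega>"
      using \<epsilon>(2)[rule_format, OF \<delta>[rule_format, OF s']] .
    moreover have "0 \<le> s'" using s s' by simp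
    ultimately show ?thesis by (simp only: Z[OF _ \<omega>] s)
  qed
  then show ?thesis using \<open>\<delta> > 0\<close> by (intro exI[of _ \<delta>] conjI allI impI)
qed

definition fractional_birth_prob :: "real \<Rightarrow> (nat \<Rightarrow> real) \<Rightarrow> nat \<Rightarrow> real \<Rightarrow> real" where
  "fractional_birth_prob b r k s =
     (\<Prod>j=1..k-1. r j) * (\<Sum>m=1..k. mittag_leffler b 1 (- r m * s powr b) * hypoexp_coeff r k m)"

text \<open>\<open>birth_prob\<close> is linear in the functions exp(-r_m x), so averaging over E_s
  only replaces each of them by its Laplace value E_{b,1}(-r_m s^b).\<close>

lemma (in prob_space) fractional_birth_law:
  assumes r: "\<And>j. j \<ge> 1 \<Longrightarrow> 0 < r j" "inj_on r {1..}" and b: "0 < b" "b < 1"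
    and Z: "fractional_birth_process M b r Z" and s: "0 < s" and k: "1 \<le> k"
  shows "prob {\<omega>\<in>space M. Z s \<omega> = enat k} = fractional_birth_prob b r k s"
proof -
  obtain Y D where Y: "pure_birth_process M r Y" and D: "stable_subordinator M b D"
    and ind: "indep_set (sigma_process M (count_space UNIV) Y) (sigma_process M borel D)"
    and Z': "\<forall>t\<ge>0. \<forall>\<omega>\<in>space M. Z t \<omega> = Y (inverse_process D t \<omega>) \<omega>"
    using Z unfolding fractional_birth_process_def by blast
  have Z: "Z t \<omega> = Y (inverse_process D t \<omega>) \<omega>" if "0 \<le> t" "\<omega> \<in> space M" for t \<omega>
    using Z' that by simp
  interpret stable_subordinator_space M b D by unfold_locales (use b D in auto)
  let ?E = "inverse_process D s" and ?A = "\<lambda>x. {\<omega>\<in>space M. Y x \<omega> = enat k}"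
  \<comment> \<open>On a bounded subordinator path E_s is \<open>Inf {}\<close>, which may be
    negative.\<close>
  let ?B = "{\<omega>\<in>space M. 0 \<le> ?E \<omega>}"
  have Em: "?E \<in> borel_measurable (process_algebra M borel D)"
    by (rule inverse_process_measurable) (auto intro: measurable_process_algebra simp: D_mono)
  have A: "?A x \<in> sigma_process M (count_space UNIV) Y" if "0 \<le> x" for x
    using sigma_process_eventI[OF that, of M "\<lambda>y. y = enat k" Y] by simp
  have B: "?E -` J \<inter> ?B \<in> sigma_process M borel D" if J: "J \<in> sets borel" for J
  proof -
    have "?E -` (J \<inter> {0..}) \<inter> space (process_algebra M borel D) \<in> sets (process_algebra M borel D)"
      using J by (intro measurable_sets[OF Em]) auto
    moreover have "?E -` (J \<inter> {0..}) \<inter> space (process_algebra M borel D) = ?E -` J \<inter> ?B" by auto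
    ultimately show ?thesis by (simp add: sets_process_algebra)
  qed
  have "prob {\<omega>\<in>?B. \<omega> \<in> ?A (?E \<omega>)} = (\<integral>\<omega>. indicator ?B \<omega> * prob (?A (?E \<omega>)) \<partial>M)"
  proof (rule random_time_substitution(3))
    show "?A x \<in> events" if "0 \<le> x" for x using A[OF that] indep_setD_ev1[OF ind] by auto
    show "\<exists>\<delta>>0. \<forall>x'. x \<le> x' \<and> x' < x + \<delta> \<longrightarrow> (\<omega> \<in> ?A x' \<longleftrightarrow> \<omega> \<in> ?A x)" if "\<omega> \<in> space M" "0 \<le> x" for \<omega> x
      using pure_birth_right_continuous[OF Y that(1), of x] by (metis (mono_tags, lifting) mem_Collect_eq)
    show "prob (?A x \<inter> (?E -` J \<inter> ?B)) = prob (?A x) * prob (?E -` J \<inter> ?B)" if "0 < x" "J \<in> sets borel" for x J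
      using indep_setD[OF ind A[OF less_imp_le[OF that(1)]] B[OF that(2)]] .
  qed auto
  also have "\<dots> = (\<integral>\<omega>. birth_prob r k (?E \<omega>) \<partial>M)"
  proof (rule integral_cong_AE)
    show "AE \<omega> in M. indicator ?B \<omega> * prob (?A (?E \<omega>)) = birth_prob r k (?E \<omega>)"
      using AE_inverse_nonneg[of s] AE_space by eventually_elim (simp add: pure_birth_law[OF r Y _ k])
    show "(\<lambda>\<omega>. birth_prob r k (?E \<omega>)) \<in> borel_measurable M"
      unfolding birth_prob_def by measurable
    show "(\<lambda>\<omega>. indicator ?B \<omega> * prob (?A (?E \<omega>))) \<in> borel_measurable M"
    proof (rule measurable_cong[THEN iffD1])
      show "(\<lambda>\<omega>. indicator ?B \<omega> * birth_prob r k (?E \<omega>)) \<in> borel_measurable M"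
        unfolding birth_prob_def by measurable
      show "indicator ?B \<omega> * birth_prob r k (?E \<omega>) = indicator ?B \<omega> * prob (?A (?E \<omega>))" if "\<omega> \<in> space M" for \<omega>
        using pure_birth_law[OF r Y _ k, of "?E \<omega>"] by (auto simp: indicator_def)
    qed
  qed
  also have "\<dots> = fractional_birth_prob b r k s"
    unfolding birth_prob_def fractional_birth_prob_def
    using inverse_laplace[OF s] by simp
  also have "{\<omega>\<in>?B. \<omega> \<in> ?A (?E \<omega>)} = {\<omega>\<in>space M. Z s \<omega> = enat k}"
  proof (rule set_eqI)
    fix \<omega>
    \<comment> \<open>Restricting to \<open>?B\<close> loses nothing: at a negative argument the
      birth process is 0, and k is at least 1.\<close>
    have "0 \<le> ?E \<omega>" if "\<omega> \<in> space M" "Y (?E \<omega>) \<omega> = enat k"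
      using pure_birth_negative[OF Y that(1), of "?E \<omega>"] that(2) k by (cases "0 \<le> ?E \<omega>") (auto simp: zero_enat_def)
    then show "\<omega> \<in> {\<omega>\<in>?B. \<omega> \<in> ?A (?E \<omega>)} \<longleftrightarrow> \<omega> \<in> {\<omega>\<in>space M. Z s \<omega> = enat k}"
      using s Z by auto
  qed
  finally show ?thesis .
qed


section \<open>The genera process\<close>

context prob_space
begin

lemma poisson_process_increment:
  assumes N: "poisson_process M 1 N" and st: "0 \<le> s" "s < t"
  shows "prob {\<omega>\<in>space M. N t \<omega> - N s \<omega> = m} = (t - s) ^ m / fact m * exp (- (t - s))"
proof -
  have [measurable]: "N t \<in> measurable M (count_space UNIV)" "N s \<in> measurable M (count_space UNIV)"
    using N st by (auto simp: poisson_process_def)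
  have d: "distr M (count_space UNIV) (\<lambda>\<omega>. N t \<omega> - N s \<omega>) = measure_pmf (poisson_pmf (1 * (t - s)))"
    using N st unfolding poisson_process_def by blast
  have "(\<lambda>\<omega>. N t \<omega> - N s \<omega>) \<in> measurable M (count_space UNIV)" by measurable
  then have "prob {\<omega>\<in>space M. N t \<omega> - N s \<omega> = m} = measure (distr M (count_space UNIV) (\<lambda>\<omega>. N t \<omega> - N s \<omega>)) {m}"
    by (simp add: measure_distr vimage_def Int_def conj_commute)
  also have "\<dots> = (t - s) ^ m / fact m * exp (- (t - s))"
    unfolding d using st by (simp add: measure_pmf_single)
  finally show ?thesis .
qed

lemma poisson_process_marginal:
  assumes N: "poisson_process M 1 N" and t: "0 < t"
  shows "prob {\<omega>\<in>space M. N t \<omega> = m} = t ^ m / fact m * exp (- t)"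
proof -
  have "{\<omega>\<in>space M. N t \<omega> = m} = {\<omega>\<in>space M. N t \<omega> - N 0 \<omega> = m}"
    using N by (auto simp: poisson_process_def)
  then show ?thesis using poisson_process_increment[OF N, of 0 t m] t by simp
qed

lemma poisson_process_two_times:
  assumes N: "poisson_process M 1 N" and ab: "0 < a" "a < c" and j: "j \<le> n"
  shows "prob {\<omega>\<in>space M. N a \<omega> = j \<and> N c \<omega> = n} =
    (a ^ j / fact j * exp (- a)) * ((c - a) ^ (n - j) / fact (n - j) * exp (- (c - a)))"
proof -
  have N0: "N 0 \<omega> = 0" and mono: "mono_on {0..} (\<lambda>t. N t \<omega>)" if "\<omega> \<in> space M" for \<omega>
    using N that by (auto simp: poisson_process_def)
  \<comment> \<open>The partition 0 < a < c, whose increments are N_a and N_c - N_a.\<close>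
  define u :: "nat \<Rightarrow> real" where "u i = (if i = 0 then 0 else if i = 1 then a else c)" for i
  have u: "u 0 = 0" "u (Suc 0) = a" "u (Suc (Suc 0)) = c" by (auto simp: u_def)
  let ?X = "\<lambda>i \<omega>. real (N (u (Suc i)) \<omega>) - real (N (u i) \<omega>)"
  have ind: "indep_vars (\<lambda>_. borel) ?X {..<2}"
  proof -
    have "independent_increments M (\<lambda>t \<omega>. real (N t \<omega>))" using N by (simp add: poisson_process_def)
    from this[unfolded independent_increments_def, rule_format, of u 2]
    show ?thesis using ab by (simp add: u_def)
  qed
  define A :: "nat \<Rightarrow> real set" where "A i = (if i = 0 then {real j} else {real (n - j)})" for i
  have two: "{..<2::nat} = {0, Suc 0}" by auto
  have "prob (\<Inter>i\<in>{..<2}. ?X i -` A i \<inter> space M) = (\<Prod>i\<in>{..<2}. prob (?X i -` A i \<inter> space M))"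
    by (rule indep_varsD[OF ind]) (auto simp: A_def two)
  then have *: "prob ((?X 0 -` A 0 \<inter> space M) \<inter> (?X (Suc 0) -` A (Suc 0) \<inter> space M)) = prob (?X 0 -` A 0 \<inter> space M) * prob (?X (Suc 0) -` A (Suc 0) \<inter> space M)"
    unfolding two by simp
  have 0: "?X 0 -` A 0 \<inter> space M = {\<omega>\<in>space M. N a \<omega> = j}"
    using N0 by (auto simp: u A_def)
  have Nac: "N a \<omega> \<le> N c \<omega>" if "\<omega> \<in> space M" for \<omega>
    using mono_onD[OF mono[OF that], of a c] ab by simp
  \<comment> \<open>Monotone paths make the truncated subtraction on the naturals agree with the
    real difference.\<close>
  have 1: "?X (Suc 0) -` A (Suc 0) \<inter> space M = {\<omega>\<in>space M. N c \<omega> - N a \<omega> = n - j}"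
    using Nac by (auto simp: u A_def of_nat_diff[symmetric] simp del: of_nat_diff)
  have "{\<omega>\<in>space M. N a \<omega> = j \<and> N c \<omega> = n} = {\<omega>\<in>space M. N a \<omega> = j} \<inter> {\<omega>\<in>space M. N c \<omega> - N a \<omega> = n - j}"
    using Nac j by fastforce
  then show ?thesis
    using * poisson_process_marginal[OF N ab(1), of j] poisson_process_increment[OF N _ ab(2), of "n - j"] ab
    unfolding 0 1 by simp
qed

text \<open>Given n points in [0, w c], each lies in [0, w a] with probability a/c, independently;
  \<open>Bernstein n j\<close> is the binomial weight. The powers and exponentials of w cancel. For
  w = 0 both events are empty because n is positive.\<close>

lemma poisson_process_thinning:
  assumes N: "poisson_process M 1 N" and ac: "0 < a" "a < c" and w: "0 \<le> w" and n: "1 \<le> n" "j \<le> n"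
  shows "prob {\<omega>\<in>space M. N (w * a) \<omega> = j \<and> N (w * c) \<omega> = n} = Bernstein n j (a / c) * prob {\<omega>\<in>space M. N (w * c) \<omega> = n}"
proof (cases "w = 0")
  case True
  then have "{\<omega>\<in>space M. N (w * a) \<omega> = j \<and> N (w * c) \<omega> = n} = {}" "{\<omega>\<in>space M. N (w * c) \<omega> = n} = {}"
    using N n by (auto simp: poisson_process_def)
  then show ?thesis by (simp only: measure_empty mult_zero_right)
next
  case False
  then have w: "0 < w" using w by simp
  have 1: "prob {\<omega>\<in>space M. N (w * a) \<omega> = j \<and> N (w * c) \<omega> = n} =
    ((w * a) ^ j / fact j * exp (- (w * a))) * ((w * c - w * a) ^ (n - j) / fact (n - j) * exp (- (w * c - w * a)))"
    using w ac n by (intro poisson_process_two_times[OF N]) auto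
  have 2: "prob {\<omega>\<in>space M. N (w * c) \<omega> = n} = (w * c) ^ n / fact n * exp (- (w * c))"
    using w ac by (intro poisson_process_marginal[OF N]) auto
  have e: "exp (- (w * a)) * exp (- (w * c - w * a)) = exp (- (w * c))" by (simp add: exp_add[symmetric])
  have c: "1 - a / c = (c - a) / c" using ac by (simp add: field_simps)
  have p: "(w * c) ^ n = w ^ j * w ^ (n - j) * (c ^ j * c ^ (n - j))"
    using n(2) by (simp add: power_mult_distrib power_add[symmetric])
  have f: "real (n choose j) = fact n / (fact j * fact (n - j))" using n(2) by (rule binomial_fact)
  have cc: "(w * c - w * a) ^ (n - j) = w ^ (n - j) * (c - a) ^ (n - j)"
    by (simp add: power_mult_distrib[symmetric] algebra_simps)
  have "prob {\<omega>\<in>space M. N (w * a) \<omega> = j \<and> N (w * c) \<omega> = n}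
    = (w * a) ^ j / fact j * ((w * c - w * a) ^ (n - j) / fact (n - j)) * (exp (- (w * a)) * exp (- (w * c - w * a)))"
    unfolding 1 by (simp only: mult_ac)
  also have "\<dots> = Bernstein n j (a / c) * ((w * c) ^ n / fact n * exp (- (w * c)))"
    unfolding e Bernstein_def c p f cc using ac w by (simp add: power_divide power_mult_distrib)
  finally show ?thesis unfolding 2 .
qed

end

text \<open>The naturals carry the discrete topology, so convergence to f(t) means eventual
  equality.\<close>

lemma discrete_right_continuous:
  fixes f :: "real \<Rightarrow> nat"
  assumes "continuous (at_right t) f"
  shows "\<exists>\<delta>>0. \<forall>s. t \<le> s \<and> s < t + \<delta> \<longrightarrow> f s = f t"
proof -
  have "(f \<longlongrightarrow> f t) (at_right t)" using assms by (simp add: continuous_within)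
  then have "\<forall>\<^sub>F s in at_right t. f s = f t" by (simp add: tendsto_discrete)
  then obtain b where b: "b > t" "\<And>y. y > t \<Longrightarrow> y < b \<Longrightarrow> f y = f t"
    by (auto simp: eventually_at_right_field)
  show ?thesis
  proof (intro exI[of _ "b - t"] conjI allI impI)
    fix s assume "t \<le> s \<and> s < t + (b - t)"
    then show "f s = f t" using b(2)[of s] by (cases "s = t") auto
  qed (use b in simp)
qed

section \<open>The mixed Poisson process of genera\<close>

lemma genera_time_change:
  fixes \<mu> \<nu> :: real
  assumes "0 < \<mu>" "0 < \<nu>"
  defines "q \<equiv> \<lambda>t. \<mu> * t powr \<nu> / Gamma (1 + \<nu>)"
  shows "q 0 = 0" "0 < t \<Longrightarrow> 0 < q t" "0 \<le> s \<Longrightarrow> s \<le> t \<Longrightarrow> q s \<le> q t" "0 < s \<Longrightarrow> s < t \<Longrightarrow> q s < q t"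
    "0 < s \<Longrightarrow> 0 < t \<Longrightarrow> q s / q t = (s / t) powr \<nu>"
proof -
  have g: "Gamma (1 + \<nu>) > 0" using assms by (intro Gamma_real_pos) auto
  show "q 0 = 0" by (simp add: q_def)
  show "0 < q t" if "0 < t" using that assms(1) g by (simp add: q_def)
  show "q s \<le> q t" if "0 \<le> s" "s \<le> t"
    unfolding q_def using that assms(1,2) g by (intro divide_right_mono mult_left_mono powr_mono2) auto
  show "q s < q t" if "0 < s" "s < t"
    unfolding q_def using that assms(1,2) g by (intro divide_strict_right_mono mult_strict_left_mono powr_less_mono2) auto
  show "q s / q t = (s / t) powr \<nu>" if "0 < s" "0 < t"
    unfolding q_def using that assms(1) g by (simp add: powr_divide)
qed

locale genera_space = prob_space +
  fixes \<mu> \<nu> :: real and G :: "real \<Rightarrow> 'a \<Rightarrow> nat"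
  assumes params: "0 < \<mu>" "0 < \<nu>" and G: "genera_process M \<nu> \<mu> G"
begin

definition q :: "real \<Rightarrow> real" where "q t = \<mu> * t powr \<nu> / Gamma (1 + \<nu>)"

lemma ex_mixed_poisson: "\<exists>N W. poisson_process M 1 N \<and> W \<in> borel_measurable M \<and> (\<forall>\<omega>\<in>space M. 0 \<le> W \<omega>) \<and>
    indep_set (sigma_process M (count_space UNIV) N) (sigma_rv M borel W) \<and>
    (\<forall>t\<ge>0. \<forall>\<omega>\<in>space M. G t \<omega> = N (W \<omega> * q t) \<omega>)"
proof -
  obtain N W where "poisson_process M 1 N" "distributed M lborel W (\<lambda>w. ennreal (genera_mixing_density \<nu> w))"
     "\<forall>\<omega>\<in>space M. 0 \<le> W \<omega>"
     "indep_set (sigma_process M (count_space UNIV) N) (sigma_rv M borel W)"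
     "\<forall>t\<ge>0. \<forall>\<omega>\<in>space M. G t \<omega> = N (W \<omega> * (\<mu> * t powr \<nu> / Gamma (1 + \<nu>))) \<omega>"
    using G unfolding genera_process_def by blast
  then show ?thesis
    by (intro exI[of _ N] exI[of _ W]) (auto simp: q_def dest: distributed_measurable)
qed

lemma genera_mono:
  assumes \<omega>: "\<omega> \<in> space M" and s: "0 \<le> s" "s \<le> t"
  shows "G s \<omega> \<le> G t \<omega>"
proof -
  obtain N W where N: "poisson_process M 1 N" and W: "\<forall>\<omega>\<in>space M. 0 \<le> W \<omega>"
    and GN: "\<forall>t\<ge>0. \<forall>\<omega>\<in>space M. G t \<omega> = N (W \<omega> * q t) \<omega>"
    using ex_mixed_poisson by blast
  have q: "0 \<le> q s" "q s \<le> q t"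
    using genera_time_change(1)[OF params] genera_time_change(3)[OF params, of 0 s] genera_time_change(3)[OF params, of s t] s by (auto simp: q_def)
  have "mono_on {0..} (\<lambda>t. N t \<omega>)" using N \<omega> by (simp add: poisson_process_def)
  from mono_onD[OF this, of "W \<omega> * q s" "W \<omega> * q t"] show ?thesis
    using GN W \<omega> s q by (auto intro: mult_left_mono)
qed

text \<open>Substituting W in the joint event at both times gives an integral of thinning
  probabilities. Their binomial factor depends only on q(s)/q(t), not on the value of W, and comes
  out of the integral.\<close>

lemma genera_binomial:
  assumes s: "0 < s" "s < t" and n: "1 \<le> n" "j \<le> n"
  shows "prob {\<omega>\<in>space M. G s \<omega> = j \<and> G t \<omega> = n} = Bernstein n j ((s / t) powr \<nu>) * prob {\<omega>\<in>space M. G t \<omega> = n}"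
proof -
  obtain N W where N: "poisson_process M 1 N" and W[measurable]: "W \<in> borel_measurable M" and W0: "\<forall>\<omega>\<in>space M. 0 \<le> W \<omega>"
    and ind: "indep_set (sigma_process M (count_space UNIV) N) (sigma_rv M borel W)"
    and GN: "\<forall>t\<ge>0. \<forall>\<omega>\<in>space M. G t \<omega> = N (W \<omega> * q t) \<omega>"
    using ex_mixed_poisson by blast
  have q: "0 < q s" "q s < q t" "q s / q t = (s / t) powr \<nu>"
    using genera_time_change(2,4,5)[OF params] s by (auto simp: q_def)
  \<comment> \<open>The random time to be substituted is W, so right continuity is needed in the
    multiplier w at fixed times.\<close>
  have rc: "\<exists>\<delta>>0. \<forall>w'. w \<le> w' \<and> w' < w + \<delta> \<longrightarrow> N (w' * a) \<omega> = N (w * a) \<omega>" if "\<omega> \<in> space M" "0 \<le> w" "0 < a" for \<omega> w a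
  proof -
    have "continuous (at_right (w * a)) (\<lambda>s. N s \<omega>)" using N that by (simp add: poisson_process_def)
    from discrete_right_continuous[OF this] obtain d where d: "d > 0" "\<And>s. w * a \<le> s \<Longrightarrow> s < w * a + d \<Longrightarrow> N s \<omega> = N (w * a) \<omega>" by blast
    show ?thesis
    proof (intro exI[of _ "d / a"] conjI allI impI)
      fix w' assume "w \<le> w' \<and> w' < w + d / a"
      then show "N (w' * a) \<omega> = N (w * a) \<omega>" using \<open>0 < a\<close> by (intro d(2)) (auto simp: field_simps)
    qed (use d that in simp)
  qed
  have ev: "{\<omega>\<in>space M. P (N x \<omega>)} \<in> sigma_process M (count_space UNIV) N" if "0 \<le> x" for x P
    by (rule sigma_process_eventI[OF that])
  \<comment> \<open>The predicate P is left open because the substitution is made twice: with the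
    count at time s prescribed, and with no condition on it.\<close>
  have subst: "prob {\<omega>\<in>space M. P (N (W \<omega> * q s) \<omega>) \<and> N (W \<omega> * q t) \<omega> = n}
     = (\<integral>\<omega>. prob {\<omega>'\<in>space M. P (N (W \<omega> * q s) \<omega>') \<and> N (W \<omega> * q t) \<omega>' = n} \<partial>M)" (is "?L = ?R") for P
  proof -
    let ?A = "\<lambda>w. {\<omega>\<in>space M. P (N (w * q s) \<omega>) \<and> N (w * q t) \<omega> = n}"
    have A: "?A w \<in> sigma_process M (count_space UNIV) N" if "0 \<le> w" for w
    proof -
      have "{\<omega>\<in>space M. P (N (w * q s) \<omega>)} \<inter> {\<omega>\<in>space M. N (w * q t) \<omega> = n} \<in> sets (process_algebra M (count_space UNIV) N)"
        using that q ev[of "w * q s" P] ev[of "w * q t" "\<lambda>m. m = n"]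
        by (intro sets.Int) (auto simp: sets_process_algebra)
      then show ?thesis by (simp add: sets_process_algebra Int_def conj_ac)
    qed
    have "prob {\<omega>\<in>space M. \<omega> \<in> ?A (W \<omega>)} = (\<integral>\<omega>. indicator (space M) \<omega> * prob (?A (W \<omega>)) \<partial>M)"
    proof (rule random_time_substitution(3))
      show "?A w \<in> events" if "0 \<le> w" for w using A[OF that] indep_setD_ev1[OF ind] by blast
      show "\<exists>\<delta>>0. \<forall>w'. w \<le> w' \<and> w' < w + \<delta> \<longrightarrow> (\<omega> \<in> ?A w' \<longleftrightarrow> \<omega> \<in> ?A w)" if \<omega>: "\<omega> \<in> space M" and w: "0 \<le> w" for \<omega> w
      proof -
        have qt: "0 < q t" using q by simp
        obtain d1 d2 where d: "d1 > 0" "\<forall>w'. w \<le> w' \<and> w' < w + d1 \<longrightarrow> N (w' * q s) \<omega> = N (w * q s) \<omega>"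
            "d2 > 0" "\<forall>w'. w \<le> w' \<and> w' < w + d2 \<longrightarrow> N (w' * q t) \<omega> = N (w * q t) \<omega>"
          using rc[OF \<omega> w q(1)] rc[OF \<omega> w qt] by (elim exE conjE)
        show ?thesis
        proof (intro exI[of _ "min d1 d2"] conjI allI impI)
          fix w' assume "w \<le> w' \<and> w' < w + min d1 d2"
          then have "w \<le> w' \<and> w' < w + d1" "w \<le> w' \<and> w' < w + d2" by auto
          from d(2)[rule_format, OF this(1)] d(4)[rule_format, OF this(2)]
          have "N (w' * q s) \<omega> = N (w * q s) \<omega>" "N (w' * q t) \<omega> = N (w * q t) \<omega>" .
          then show "(\<omega> \<in> ?A w') = (\<omega> \<in> ?A w)" by simp
        qed (use d in simp)
      qed
      show "prob (?A w \<inter> (W -` J \<inter> space M)) = prob (?A w) * prob (W -` J \<inter> space M)" if "0 < w" "J \<in> sets borel" for w J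
        by (rule indep_setD[OF ind A]) (use that in \<open>auto simp: sigma_rv_def\<close>)
    qed (use W0 in auto)
    also have "\<dots> = ?R" by (rule Bochner_Integration.integral_cong) auto
    finally show ?thesis by simp
  qed
  have GN': "{\<omega>\<in>space M. G s \<omega> = j \<and> G t \<omega> = n} = {\<omega>\<in>space M. N (W \<omega> * q s) \<omega> = j \<and> N (W \<omega> * q t) \<omega> = n}"
     "{\<omega>\<in>space M. G t \<omega> = n} = {\<omega>\<in>space M. True \<and> N (W \<omega> * q t) \<omega> = n}"
    using GN s by auto
  have "prob {\<omega>\<in>space M. G s \<omega> = j \<and> G t \<omega> = n} = (\<integral>\<omega>. prob {\<omega>'\<in>space M. N (W \<omega> * q s) \<omega>' = j \<and> N (W \<omega> * q t) \<omega>' = n} \<partial>M)"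
    unfolding GN' by (rule subst)
  also have "\<dots> = (\<integral>\<omega>. Bernstein n j ((s / t) powr \<nu>) * prob {\<omega>'\<in>space M. True \<and> N (W \<omega> * q t) \<omega>' = n} \<partial>M)"
  proof (rule Bochner_Integration.integral_cong[OF refl])
    fix \<omega> assume "\<omega> \<in> space M"
    then show "prob {\<omega>'\<in>space M. N (W \<omega> * q s) \<omega>' = j \<and> N (W \<omega> * q t) \<omega>' = n}
      = Bernstein n j ((s / t) powr \<nu>) * prob {\<omega>'\<in>space M. True \<and> N (W \<omega> * q t) \<omega>' = n}"
      using poisson_process_thinning[OF N q(1,2) _ n, of "W \<omega>"] W0 unfolding q(3) by simp
  qed
  also have "\<dots> = Bernstein n j ((s / t) powr \<nu>) * prob {\<omega>\<in>space M. G t \<omega> = n}"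
    unfolding GN' subst[of "\<lambda>_. True"] by simp
  finally show ?thesis .
qed

text \<open>Summing the indicators of i \<le> G_s over i counts G_s itself, so the left side is the
  expectation of G_s on {G_t = n}, a binomial mean. Division by n averages over a uniform
  index.\<close>

lemma genera_mean:
  assumes ev: "\<And>t m. 0 \<le> t \<Longrightarrow> {\<omega>\<in>space M. G t \<omega> = m} \<in> events"
    and s: "0 < s" "s < t" and n: "1 \<le> n"
  shows "(\<Sum>i=1..n. prob {\<omega>\<in>space M. i \<le> G s \<omega> \<and> G t \<omega> = n}) = real n * (s / t) powr \<nu> * prob {\<omega>\<in>space M. G t \<omega> = n}"
proof -
  let ?p = "\<lambda>j. prob {\<omega>\<in>space M. G s \<omega> = j \<and> G t \<omega> = n}"
  have e: "{\<omega>\<in>space M. G s \<omega> = j \<and> G t \<omega> = n} \<in> events" for j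
    using sets.Int[OF ev[of s j] ev[of t n]] s by (simp add: Int_def conj_ac)
  have "prob {\<omega>\<in>space M. i \<le> G s \<omega> \<and> G t \<omega> = n} = (\<Sum>j\<le>n. (if i \<le> j then ?p j else 0))" for i
  proof -
    have "{\<omega>\<in>space M. i \<le> G s \<omega> \<and> G t \<omega> = n} = (\<Union>j\<in>{i..n}. {\<omega>\<in>space M. G s \<omega> = j \<and> G t \<omega> = n})"
      using genera_mono[of _ s t] s by fastforce
    also have "prob \<dots> = (\<Sum>j\<in>{i..n}. ?p j)"
      using e by (intro finite_measure_finite_Union) (auto simp: disjoint_family_on_def)
    also have "\<dots> = (\<Sum>j\<le>n. (if i \<le> j then ?p j else 0))"
      by (intro sum.mono_neutral_cong_left) auto
    finally show ?thesis .
  qed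
  then have "(\<Sum>i=1..n. prob {\<omega>\<in>space M. i \<le> G s \<omega> \<and> G t \<omega> = n}) = (\<Sum>j\<le>n. \<Sum>i=1..n. (if i \<le> j then ?p j else 0))"
    by (simp only: sum.swap[of _ "{..n}" "{1..n}"])
  also have "\<dots> = (\<Sum>j\<le>n. real j * ?p j)"
  proof (rule sum.cong[OF refl])
    fix j assume j: "j \<in> {..n}"
    have "(\<Sum>i=1..n. (if i \<le> j then ?p j else 0)) = (\<Sum>i=1..j. ?p j)"
      using j by (intro sum.mono_neutral_cong_right) auto
    then show "(\<Sum>i=1..n. (if i \<le> j then ?p j else 0)) = real j * ?p j" by simp
  qed
  also have "\<dots> = (\<Sum>j\<le>n. real j * Bernstein n j ((s / t) powr \<nu>)) * prob {\<omega>\<in>space M. G t \<omega> = n}"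
    unfolding sum_distrib_right using genera_binomial[OF s n] by (intro sum.cong refl) simp
  finally show ?thesis by simp
qed

end

section \<open>A uniformly chosen genus\<close>

locale yule_space = genera_space +
  fixes \<beta> t :: real and rate :: "nat \<Rightarrow> real" and Z :: "nat \<Rightarrow> real \<Rightarrow> 'a \<Rightarrow> enat" and I :: "'a \<Rightarrow> nat"
  assumes \<beta>: "0 < \<beta>" "\<beta> < 1"
    and rate: "\<And>j. j \<ge> 1 \<Longrightarrow> 0 < rate j" "inj_on rate {1..}"
    and Z: "\<And>i. i \<ge> 1 \<Longrightarrow> fractional_birth_process M \<beta> rate (Z i)"
    and ind: "indep_sets (\<lambda>i. if i = 0 then sigma_process M (count_space UNIV) G
            else sigma_process M (count_space UNIV) (Z i)) UNIV"
    and t: "0 < t"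
    and choice: "uniform_choice M (sigma_yule M G Z) (G t) I"
begin

abbreviation "\<G> \<equiv> sigma_process M (count_space UNIV) G"
abbreviation "\<Z> i \<equiv> sigma_process M (count_space UNIV) (Z i)"

section \<open>Sigma-algebras of the model and the conditioning on the number of genera\<close>

lemma G_events: "\<G> \<subseteq> events"
proof -
  have "\<forall>i. (if i = 0 then \<G> else \<Z> i) \<subseteq> events" using ind unfolding indep_sets_def by blast
  from this[rule_format, of 0] show ?thesis by simp
qed

lemma Z_events:
  assumes "1 \<le> i" shows "\<Z> i \<subseteq> events"
proof -
  have "\<forall>i. (if i = 0 then \<G> else \<Z> i) \<subseteq> events" using ind unfolding indep_sets_def by blast
  from this[rule_format, of i] show ?thesis using assms by simp
qed

lemma indep_G_Z:
  assumes "1 \<le> i" "a \<in> \<Z> i" "c \<in> \<G>"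
  shows "prob (a \<inter> c) = prob a * prob c"
proof -
  have "prob (\<Inter>j\<in>{0, i}. if j = 0 then c else a) = (\<Prod>j\<in>{0, i}. prob (if j = 0 then c else a))"
    by (rule indep_setsD[OF ind]) (use assms in auto)
  then show ?thesis using assms(1) by (simp add: Int_commute mult.commute)
qed

lemma sigma_yule_sigma_algebra: "sigma_algebra (space M) (sigma_yule M G Z)"
  unfolding sigma_yule_def
proof (rule sigma_algebra_sigma_sets)
  have "\<G> \<subseteq> Pow (space M)" "1 \<le> i \<Longrightarrow> \<Z> i \<subseteq> Pow (space M)" for i
    using G_events Z_events[of i] sets.space_closed by blast+
  then show "\<G> \<union> (\<Union>i\<in>{1..}. \<Z> i) \<subseteq> Pow (space M)" by auto
qed

lemma sigma_yule_events: "sigma_yule M G Z \<subseteq> events"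
  unfolding sigma_yule_def using G_events Z_events by (intro sets.sigma_sets_subset) auto

lemma sigma_yuleI: "c \<in> \<G> \<Longrightarrow> c \<in> sigma_yule M G Z" "1 \<le> i \<Longrightarrow> a \<in> \<Z> i \<Longrightarrow> a \<in> sigma_yule M G Z"
  unfolding sigma_yule_def by (auto intro: sigma_sets.Basic)

lemma sigma_yule_Int: "a \<in> sigma_yule M G Z \<Longrightarrow> c \<in> sigma_yule M G Z \<Longrightarrow> a \<inter> c \<in> sigma_yule M G Z"
proof -
  interpret Y: sigma_algebra "space M" "sigma_yule M G Z" by (rule sigma_yule_sigma_algebra)
  show "a \<in> sigma_yule M G Z \<Longrightarrow> c \<in> sigma_yule M G Z \<Longrightarrow> a \<inter> c \<in> sigma_yule M G Z" by (rule Y.Int)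
qed

lemma G_eventI: "0 \<le> s \<Longrightarrow> {\<omega>\<in>space M. P (G s \<omega>)} \<in> \<G>"
  by (rule sigma_process_eventI)

lemma I_measurable [measurable]: "I \<in> measurable M (count_space UNIV)"
  using choice by (simp add: uniform_choice_def)

lemma Gt_measurable [measurable]: "{\<omega>\<in>space M. P (G t \<omega>)} \<in> events"
  using G_eventI[of t P] G_events t by auto

lemma I_range: "\<omega> \<in> space M \<Longrightarrow> 1 \<le> G t \<omega> \<Longrightarrow> I \<omega> \<in> {1..G t \<omega>}"
  using choice by (simp add: uniform_choice_def)

text \<open>Forced by the uniform choice: on a null event \<open>cond_prob\<close> is a quotient by
  zero and hence 0, but it is prescribed to be 1/n.\<close>

lemma prob_Gt_pos:
  assumes "1 \<le> n" shows "prob {\<omega>\<in>space M. G t \<omega> = n} \<noteq> 0"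
proof
  assume "prob {\<omega>\<in>space M. G t \<omega> = n} = 0"
  then have "\<P>(\<omega> in M. I \<omega> = 1 \<bar> G t \<omega> = n) = 0" by (simp add: cond_prob_def)
  moreover have "\<P>(\<omega> in M. I \<omega> = 1 \<bar> G t \<omega> = n) = 1 / real n"
    using choice assms unfolding uniform_choice_def by auto
  ultimately show False using assms by simp
qed

lemma choice_prob:
  assumes n: "1 \<le> n" "i \<in> {1..n}" and C: "C \<in> sigma_yule M G Z"
  shows "prob {\<omega>\<in>space M. I \<omega> = i \<and> \<omega> \<in> C \<and> G t \<omega> = n} = prob {\<omega>\<in>space M. \<omega> \<in> C \<and> G t \<omega> = n} / real n"
proof -
  have "\<P>(\<omega> in M. I \<omega> = i \<and> \<omega> \<in> C \<bar> G t \<omega> = n) = \<P>(\<omega> in M. I \<omega> = i \<bar> G t \<omega> = n) * \<P>(\<omega> in M. \<omega> \<in> C \<bar> G t \<omega> = n)"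
    using choice n C unfolding uniform_choice_def by blast
  also have "\<P>(\<omega> in M. I \<omega> = i \<bar> G t \<omega> = n) = 1 / real n"
    using choice n unfolding uniform_choice_def by blast
  finally show ?thesis using prob_Gt_pos[OF n(1)] by (simp add: cond_prob_def conj_ac field_simps)
qed

definition "H = {\<omega>\<in>space M. 1 \<le> G t \<omega>}"

lemma H_event [measurable]: "H \<in> events" unfolding H_def by (rule Gt_measurable)

text \<open>Turns an event about the chosen genus into events about fixed indices, for which the
  independence of the model is stated. Splitting by n and by the value of I gives each index the
  weight 1/n.\<close>

lemma choice_formula:
  assumes C: "\<And>i. 1 \<le> i \<Longrightarrow> C i \<in> sigma_yule M G Z"
  shows "(\<lambda>n. if n = 0 then 0 else (\<Sum>i=1..n. prob {\<omega>\<in>space M. \<omega> \<in> C i \<and> G t \<omega> = n}) / real n)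
     sums prob {\<omega>\<in>H. \<omega> \<in> C (I \<omega>)}"
    and "{\<omega>\<in>H. \<omega> \<in> C (I \<omega>)} \<in> events"
proof -
  define E where "E n = {\<omega>\<in>H. \<omega> \<in> C (I \<omega>) \<and> G t \<omega> = n}" for n
  have e: "{\<omega>\<in>space M. I \<omega> = i \<and> \<omega> \<in> C i \<and> G t \<omega> = n} \<in> events" if "1 \<le> i" for i n
  proof -
    have "C i \<in> events" using C[OF that] sigma_yule_events by blast
    then show ?thesis by measurable
  qed
  have E: "E n = (\<Union>i\<in>{1..n}. {\<omega>\<in>space M. I \<omega> = i \<and> \<omega> \<in> C i \<and> G t \<omega> = n})" for n
  proof (rule set_eqI)
    fix \<omega>
    show "\<omega> \<in> E n \<longleftrightarrow> \<omega> \<in> (\<Union>i\<in>{1..n}. {\<omega>\<in>space M. I \<omega> = i \<and> \<omega> \<in> C i \<and> G t \<omega> = n})"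
      using I_range[of \<omega>] by (auto simp: E_def H_def)
  qed
  have Eev: "E n \<in> events" for n unfolding E using e by (intro sets.finite_UN) auto
  have pE: "prob (E n) = (if n = 0 then 0 else (\<Sum>i=1..n. prob {\<omega>\<in>space M. \<omega> \<in> C i \<and> G t \<omega> = n}) / real n)" for n
  proof (cases "n = 0")
    case False
    have "prob (E n) = (\<Sum>i=1..n. prob {\<omega>\<in>space M. I \<omega> = i \<and> \<omega> \<in> C i \<and> G t \<omega> = n})"
      unfolding E using e by (intro finite_measure_finite_Union) (auto simp: disjoint_family_on_def)
    also have "\<dots> = (\<Sum>i=1..n. prob {\<omega>\<in>space M. \<omega> \<in> C i \<and> G t \<omega> = n} / real n)"
      using False C by (intro sum.cong refl choice_prob) auto
    finally show ?thesis using False by (simp add: sum_divide_distrib)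
  qed (simp add: E)
  have U: "(\<Union>n. E n) = {\<omega>\<in>H. \<omega> \<in> C (I \<omega>)}" by (auto simp: E_def)
  have "(\<lambda>n. prob (E n)) sums prob (\<Union>n. E n)"
  proof (rule finite_measure_UNION)
    show "range E \<subseteq> events" using Eev by blast
    show "disjoint_family E" by (auto simp: disjoint_family_on_def E_def)
  qed
  then show "(\<lambda>n. if n = 0 then 0 else (\<Sum>i=1..n. prob {\<omega>\<in>space M. \<omega> \<in> C i \<and> G t \<omega> = n}) / real n)
     sums prob {\<omega>\<in>H. \<omega> \<in> C (I \<omega>)}"
    unfolding pE U .
  show "{\<omega>\<in>H. \<omega> \<in> C (I \<omega>)} \<in> events" unfolding U[symmetric] using Eev by auto
qed

section \<open>Appearance times and the age of the chosen genus\<close>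

lemma jump_time_measurable: "jump_time G i \<in> borel_measurable (process_algebra M (count_space UNIV) G)"
  unfolding jump_time_def[abs_def]
proof (rule hitting_time_measurable)
  show "{\<omega> \<in> space (process_algebra M (count_space UNIV) G). i \<le> G s \<omega>} \<in> sets (process_algebra M (count_space UNIV) G)" if "0 \<le> s" for s
    using G_eventI[OF that, of "\<lambda>m. i \<le> m"] by (simp add: sets_process_algebra)
  show "i \<le> G s' \<omega>" if "\<omega> \<in> space (process_algebra M (count_space UNIV) G)" "0 \<le> s" "s \<le> s'" "i \<le> G s \<omega>" for \<omega> s s'
    using genera_mono[of \<omega> s s'] that by simp
qed

lemma jump_time_measurable' [measurable]: "jump_time G i \<in> borel_measurable M"
proof (rule measurable_from_subalg[OF _ jump_time_measurable])
  show "subalgebra M (process_algebra M (count_space UNIV) G)"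
    using G_events by (simp add: subalgebra_def sets_process_algebra)
qed

lemma jump_time_event: "J \<in> sets borel \<Longrightarrow> {\<omega>\<in>space M. jump_time G i \<omega> \<in> J} \<in> \<G>"
  using measurable_sets[OF jump_time_measurable, of J i] by (simp add: sets_process_algebra vimage_def Int_def conj_commute)

lemma jump_time_le: "0 \<le> s \<Longrightarrow> i \<le> G s \<omega> \<Longrightarrow> jump_time G i \<omega> \<le> s"
  unfolding jump_time_def by (intro cInf_lower) (auto intro!: bdd_belowI[of _ 0])

lemma jump_time_nonneg: "i \<le> G t \<omega> \<Longrightarrow> 0 \<le> jump_time G i \<omega>"
  unfolding jump_time_def using t by (intro cInf_greatest) (auto intro: less_imp_le)

text \<open>\<open>i \<le> G t \<omega>\<close> puts t into the set, so the infimum is a genuine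
  one. With \<open>jump_time_le\<close> this places {i \<le> G_s} between {T_i < s} and {T_i \<le>
  s}.\<close>

lemma jump_time_less:
  assumes \<omega>: "\<omega> \<in> space M" and i: "i \<le> G t \<omega>" and s: "jump_time G i \<omega> < s"
  shows "i \<le> G s \<omega>"
proof -
  let ?S = "{s. 0 \<le> s \<and> i \<le> G s \<omega>}"
  have "t \<in> ?S" using i t by simp
  then have "?S \<noteq> {}" by blast
  then obtain x where x: "x \<in> ?S" "x < s"
    using s cInf_lessD[of ?S s] unfolding jump_time_def by blast
  then show ?thesis using genera_mono[OF \<omega>, of x s] by auto
qed

text \<open>The age at time t of the chosen genus.\<close>

definition "\<tau> \<omega> = t - jump_time G (I \<omega>) \<omega>"

lemma \<tau>_measurable [measurable]: "\<tau> \<in> borel_measurable M"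
proof -
  have "(\<lambda>\<omega>. jump_time G (I \<omega>) \<omega>) \<in> borel_measurable M"
    by (rule measurable_compose_countable[OF jump_time_measurable' I_measurable])
  then show ?thesis unfolding \<tau>_def[abs_def] by measurable
qed

lemma prob_H_pos: "prob H \<noteq> 0"
proof
  assume 0: "prob H = 0"
  have "prob {\<omega>\<in>space M. G t \<omega> = 1} \<le> prob H"
    by (intro finite_measure_mono) (auto simp: H_def)
  then have "prob {\<omega>\<in>space M. G t \<omega> = 1} = 0" unfolding 0 by (simp add: measure_le_0_iff)
  then show False using prob_Gt_pos[of 1] by simp
qed

text \<open>I \<le> G_(x t) says that the chosen genus exists by time x t. By
  \<open>genera_mean\<close> the n-th term of the choice formula is x^\<nu> P(G_t = n), with the
  same factor for every n.\<close>

lemma genus_age_distribution: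
  assumes x: "0 < x" "x < 1"
  shows "prob {\<omega>\<in>H. I \<omega> \<le> G (x * t) \<omega>} = x powr \<nu> * prob H"
    and "{\<omega>\<in>H. I \<omega> \<le> G (x * t) \<omega>} \<in> events"
proof -
  let ?C = "\<lambda>i. {\<omega>\<in>space M. i \<le> G (x * t) \<omega>}"
  have xt: "0 < x * t" "x * t < t" using x t by auto
  have C: "?C i \<in> sigma_yule M G Z" for i
    using xt by (intro sigma_yuleI(1) G_eventI) simp
  have S: "space M \<in> sigma_yule M G Z" using sigma_yuleI(1)[OF G_eventI[of t "\<lambda>_. True"]] t by simp
  have e: "{\<omega>\<in>H. \<omega> \<in> ?C (I \<omega>)} = {\<omega>\<in>H. I \<omega> \<le> G (x * t) \<omega>}" by (auto simp: H_def)
  show "{\<omega>\<in>H. I \<omega> \<le> G (x * t) \<omega>} \<in> events"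
    using choice_formula(2)[of ?C, OF C] unfolding e .
  have ev: "{\<omega>\<in>space M. G s \<omega> = m} \<in> events" if "0 \<le> s" for s m
    by (rule subsetD[OF G_events G_eventI[OF that]])
  have "(\<lambda>n. if n = 0 then 0 else (\<Sum>i=1..n. prob {\<omega>\<in>space M. \<omega> \<in> ?C i \<and> G t \<omega> = n}) / real n)
      sums prob {\<omega>\<in>H. \<omega> \<in> ?C (I \<omega>)}"
    by (rule choice_formula(1)) (rule C)
  moreover have "(if n = 0 then 0 else (\<Sum>i=1..n. prob {\<omega>\<in>space M. \<omega> \<in> ?C i \<and> G t \<omega> = n}) / real n)
    = x powr \<nu> * (if n = 0 then 0 else (\<Sum>i=1..n. prob {\<omega>\<in>space M. \<omega> \<in> space M \<and> G t \<omega> = n}) / real n)" for n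
  proof (cases "n = 0")
    case False
    have "(\<Sum>i=1..n. prob {\<omega>\<in>space M. \<omega> \<in> ?C i \<and> G t \<omega> = n}) = real n * x powr \<nu> * prob {\<omega>\<in>space M. G t \<omega> = n}"
      using genera_mean[OF ev xt, of n] False t by simp
    then show ?thesis using False by simp
  qed simp
  ultimately have 1: "(\<lambda>n. x powr \<nu> * (if n = 0 then 0 else (\<Sum>i=1..n. prob {\<omega>\<in>space M. \<omega> \<in> space M \<and> G t \<omega> = n}) / real n))
      sums prob {\<omega>\<in>H. I \<omega> \<le> G (x * t) \<omega>}"
    unfolding e by simp
  \<comment> \<open>The choice formula for the whole space: it shows that the series left after
    pulling out x^\<nu> sums to P(H).\<close>
  have "(\<lambda>n. if n = 0 then 0 else (\<Sum>i=1..n. prob {\<omega>\<in>space M. \<omega> \<in> space M \<and> G t \<omega> = n}) / real n)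
      sums prob {\<omega>\<in>H. \<omega> \<in> space M}"
    by (rule choice_formula(1)[of "\<lambda>_. space M"]) (rule S)
  moreover have "{\<omega>\<in>H. \<omega> \<in> space M} = H" by (auto simp: H_def)
  ultimately show "prob {\<omega>\<in>H. I \<omega> \<le> G (x * t) \<omega>} = x powr \<nu> * prob H"
    using sums_unique2[OF 1 sums_mult] by simp
qed

text \<open>The age s is deterministic here. For a fixed index, Z_i is independent of G, which
  determines both the appearance time and G_t. The resulting factor is the same for all indices, so
  it passes through the choice formula.\<close>

lemma chosen_size_indep_age:
  assumes s: "0 < s" and k: "1 \<le> k" and J: "J \<in> sets borel"
  shows "prob {\<omega>\<in>H. Z (I \<omega>) s \<omega> = enat k \<and> \<tau> \<omega> \<in> J} = fractional_birth_prob \<beta> rate k s * prob {\<omega>\<in>H. \<tau> \<omega> \<in> J}"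
proof -
  let ?f = "fractional_birth_prob \<beta> rate k s"
  let ?A = "\<lambda>i. {\<omega>\<in>space M. Z i s \<omega> = enat k}" and ?D = "\<lambda>i. {\<omega>\<in>space M. t - jump_time G i \<omega> \<in> J}"
  have D: "?D i \<in> \<G>" for i
  proof -
    have "(\<lambda>r. t - r) -` J \<in> sets borel" using J measurable_sets_borel[of "\<lambda>r. t - r" borel J] by simp
    from jump_time_event[OF this, of i] show ?thesis by simp
  qed
  have A: "?A i \<in> \<Z> i" for i using sigma_process_eventI[of s M "\<lambda>z. z = enat k" "Z i"] s by simp
  have CD: "?D i \<in> sigma_yule M G Z" for i using D by (rule sigma_yuleI(1))
  have CA: "?A i \<inter> ?D i \<in> sigma_yule M G Z" if "1 \<le> i" for i
    by (intro sigma_yule_Int CD sigma_yuleI(2)[OF that A])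
  have 1: "(\<lambda>n. if n = 0 then 0 else (\<Sum>i=1..n. prob {\<omega>\<in>space M. \<omega> \<in> ?A i \<inter> ?D i \<and> G t \<omega> = n}) / real n)
      sums prob {\<omega>\<in>H. \<omega> \<in> ?A (I \<omega>) \<inter> ?D (I \<omega>)}"
    by (rule choice_formula(1)[of "\<lambda>i. ?A i \<inter> ?D i"]) (rule CA)
  have 2: "(\<lambda>n. if n = 0 then 0 else (\<Sum>i=1..n. prob {\<omega>\<in>space M. \<omega> \<in> ?D i \<and> G t \<omega> = n}) / real n)
      sums prob {\<omega>\<in>H. \<omega> \<in> ?D (I \<omega>)}"
    by (rule choice_formula(1)[of ?D]) (rule CD)
  have "prob {\<omega>\<in>space M. \<omega> \<in> ?A i \<inter> ?D i \<and> G t \<omega> = n} = ?f * prob {\<omega>\<in>space M. \<omega> \<in> ?D i \<and> G t \<omega> = n}" if i: "1 \<le> i" for i n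
  proof -
    have "?D i \<inter> {\<omega>\<in>space M. G t \<omega> = n} \<in> sets (process_algebra M (count_space UNIV) G)"
      using D[of i] G_eventI[of t "\<lambda>m. m = n"] t by (intro sets.Int) (simp_all add: sets_process_algebra)
    then have "?D i \<inter> {\<omega>\<in>space M. G t \<omega> = n} \<in> \<G>" by (simp only: sets_process_algebra)
    then have "prob (?A i \<inter> (?D i \<inter> {\<omega>\<in>space M. G t \<omega> = n})) = prob (?A i) * prob (?D i \<inter> {\<omega>\<in>space M. G t \<omega> = n})"
      by (rule indep_G_Z[OF i A])
    moreover have "prob (?A i) = ?f" by (rule fractional_birth_law[OF rate \<beta> Z[OF i] s k])
    moreover have "?A i \<inter> (?D i \<inter> {\<omega>\<in>space M. G t \<omega> = n}) = {\<omega>\<in>space M. \<omega> \<in> ?A i \<inter> ?D i \<and> G t \<omega> = n}" by auto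
    moreover have "?D i \<inter> {\<omega>\<in>space M. G t \<omega> = n} = {\<omega>\<in>space M. \<omega> \<in> ?D i \<and> G t \<omega> = n}" by auto
    ultimately show ?thesis by simp
  qed
  then have "(if n = 0 then 0 else (\<Sum>i=1..n. prob {\<omega>\<in>space M. \<omega> \<in> ?A i \<inter> ?D i \<and> G t \<omega> = n}) / real n)
     = ?f * (if n = 0 then 0 else (\<Sum>i=1..n. prob {\<omega>\<in>space M. \<omega> \<in> ?D i \<and> G t \<omega> = n}) / real n)" for n
    by (simp add: sum_distrib_left)
  then have "prob {\<omega>\<in>H. \<omega> \<in> ?A (I \<omega>) \<inter> ?D (I \<omega>)} = ?f * prob {\<omega>\<in>H. \<omega> \<in> ?D (I \<omega>)}"
    using sums_unique2[OF 1] sums_mult[OF 2, of ?f] by presburger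
  moreover have "{\<omega>\<in>H. \<omega> \<in> ?A (I \<omega>) \<inter> ?D (I \<omega>)} = {\<omega>\<in>H. Z (I \<omega>) s \<omega> = enat k \<and> \<tau> \<omega> \<in> J}"
    "{\<omega>\<in>H. \<omega> \<in> ?D (I \<omega>)} = {\<omega>\<in>H. \<tau> \<omega> \<in> J}"
    by (auto simp: H_def \<tau>_def)
  ultimately show ?thesis by simp
qed

lemma chosen_size_event:
  assumes s: "0 \<le> s" shows "{\<omega>\<in>H. Z (I \<omega>) s \<omega> = enat k} \<in> events"
proof -
  have "{\<omega>\<in>H. \<omega> \<in> {\<omega>\<in>space M. Z (I \<omega>) s \<omega> = enat k}} \<in> events"
    using choice_formula(2)[of "\<lambda>i. {\<omega>\<in>space M. Z i s \<omega> = enat k}"] sigma_yuleI(2)[OF _ sigma_process_eventI[OF s, of M "\<lambda>z. z = enat k"]]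
    by (simp add: H_def)
  then show ?thesis by (rule back_subst[of "\<lambda>A. A \<in> events"]) (auto simp: H_def)
qed

text \<open>The conditional law given that there is a genus. The random time substitution is applied
  in this space, where the size at a fixed age is independent of \<tau>.\<close>

definition "Q = uniform_measure M H"

lemma Q_prob_space: "prob_space Q"
  unfolding Q_def using prob_H_pos by (intro prob_space_uniform_measure) (auto simp: emeasure_eq_measure)

lemma space_Q [simp]: "space Q = space M" by (simp add: Q_def)

lemma sets_Q [simp, measurable_cong]: "sets Q = events" by (simp add: Q_def)

lemma measure_Q: "A \<in> events \<Longrightarrow> measure Q A = prob (H \<inter> A) / prob H"
  unfolding Q_def using prob_H_pos by (subst measure_uniform_measure) (auto simp: emeasure_eq_measure)

lemma AE_Q_H: "AE \<omega> in Q. \<omega> \<in> H"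
  unfolding Q_def by (rule AE_uniform_measureI) auto

lemma AE_Q_space: "AE \<omega> in Q. \<omega> \<in> space M"
  using AE_space[of Q] by simp

text \<open>On H, {I \<le> G_(x t)} lies between {T_I < x t} and {T_I \<le> x t}, and its
  conditional probability is x^\<nu>. Outside 0 < x < 1 the comparison is trivial because 0 \<le>
  T_I \<le> t.\<close>

lemma relative_age_law: "distr Q borel (\<lambda>\<omega>. 1 - \<tau> \<omega> / t) = genus_age_law \<nu>"
proof (rule real_distribution_eq_sandwich)
  interpret Q: prob_space Q by (rule Q_prob_space)
  let ?U = "\<lambda>\<omega>. 1 - \<tau> \<omega> / t" and ?L = "genus_age_law \<nu>"
  have Um[measurable]: "?U \<in> borel_measurable Q" by measurable
  show "real_distribution (distr Q borel ?U)" by (rule Q.real_distribution_distr[OF Um])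
  show L: "real_distribution ?L" using params by (intro real_distribution_genus_age_law)
  interpret L: real_distribution ?L by (rule L)
  have U: "?U \<omega> = jump_time G (I \<omega>) \<omega> / t" for \<omega> using t by (simp add: \<tau>_def field_simps)
  have bounds: "AE \<omega> in Q. 0 \<le> ?U \<omega> \<and> ?U \<omega> \<le> 1"
    using AE_Q_H
  proof eventually_elim
    case (elim \<omega>)
    then have "I \<omega> \<le> G t \<omega>" using I_range[of \<omega>] by (auto simp: H_def)
    then show ?case unfolding U using jump_time_nonneg[of "I \<omega>" \<omega>] jump_time_le[of t "I \<omega>" \<omega>] t by simp
  qed
  have mU: "measure (distr Q borel ?U) {..<x} = measure Q {\<omega>\<in>space M. ?U \<omega> < x}"
     "measure (distr Q borel ?U) {..x} = measure Q {\<omega>\<in>space M. ?U \<omega> \<le> x}" for x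
    by (simp_all add: measure_distr vimage_def Int_def conj_commute)
  have Lx: "measure ?L {..<x} = x powr \<nu>" if "0 < x" "x < 1" for x
    using genus_age_law_atMost(2)[OF params(2), of x] that by (simp add: measure_def)
  have QB: "measure Q {\<omega>\<in>H. I \<omega> \<le> G (x * t) \<omega>} = x powr \<nu>" if "0 < x" "x < 1" for x
  proof -
    have "H \<inter> {\<omega>\<in>H. I \<omega> \<le> G (x * t) \<omega>} = {\<omega>\<in>H. I \<omega> \<le> G (x * t) \<omega>}" by auto
    then show ?thesis
      using measure_Q[OF genus_age_distribution(2)[OF that]] genus_age_distribution(1)[OF that] prob_H_pos by simp
  qed
  fix x :: real
  consider "x \<le> 0" | "0 < x" "x < 1" | "1 \<le> x" by linarith
  note cases = this
  show "measure (distr Q borel ?U) {..<x} \<le> measure ?L {..<x}"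
    using cases
  proof cases
    case 1
    have "measure Q {\<omega>\<in>space M. ?U \<omega> < x} = measure Q {}"
    proof (rule Q.finite_measure_eq_AE)
      show "AE \<omega> in Q. (\<omega> \<in> {\<omega>\<in>space M. ?U \<omega> < x}) = (\<omega> \<in> {})"
        using bounds by eventually_elim (use 1 in auto)
    qed simp_all
    then show ?thesis unfolding mU by simp
  next
    case 2
    have "measure Q {\<omega>\<in>space M. ?U \<omega> < x} \<le> measure Q {\<omega>\<in>H. I \<omega> \<le> G (x * t) \<omega>}"
    proof (rule Q.finite_measure_mono_AE)
      show "AE \<omega> in Q. \<omega> \<in> {\<omega>\<in>space M. ?U \<omega> < x} \<longrightarrow> \<omega> \<in> {\<omega>\<in>H. I \<omega> \<le> G (x * t) \<omega>}"
        using AE_Q_H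
      proof eventually_elim
        case (elim \<omega>)
        then have \<omega>: "\<omega> \<in> space M" "I \<omega> \<le> G t \<omega>" using I_range[of \<omega>] by (auto simp: H_def)
        show ?case
          using elim jump_time_less[OF \<omega>, of "x * t"] t unfolding U by (auto simp: divide_less_eq)
      qed
    qed (use genus_age_distribution(2)[OF 2] in simp)
    then show ?thesis unfolding mU Lx[OF 2] QB[OF 2] .
  next
    case 3
    have "measure ?L {..<x} = measure ?L (space ?L)"
    proof (rule L.finite_measure_eq_AE)
      show "AE u in ?L. (u \<in> {..<x}) = (u \<in> space ?L)"
        using AE_genus_age_law[of \<nu>] by eventually_elim (use 3 in auto)
    qed simp_all
    then have "measure ?L {..<x} = 1" by (simp only: L.prob_space)
    then show ?thesis unfolding mU by simp
  qed
  show "measure ?L {..<x} \<le> measure (distr Q borel ?U) {..x}"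
    using cases
  proof cases
    case 1
    have "measure ?L {..<x} = measure ?L {}"
    proof (rule L.finite_measure_eq_AE)
      show "AE u in ?L. (u \<in> {..<x}) = (u \<in> {})"
        using AE_genus_age_law[of \<nu>] by eventually_elim (use 1 in auto)
    qed simp_all
    then show ?thesis by simp
  next
    case 2
    have "measure Q {\<omega>\<in>H. I \<omega> \<le> G (x * t) \<omega>} \<le> measure Q {\<omega>\<in>space M. ?U \<omega> \<le> x}"
    proof (rule Q.finite_measure_mono)
      show "{\<omega>\<in>H. I \<omega> \<le> G (x * t) \<omega>} \<subseteq> {\<omega>\<in>space M. ?U \<omega> \<le> x}"
        using jump_time_le[of "x * t"] 2 t unfolding U by (auto simp: H_def divide_le_eq)
    qed simp
    then show ?thesis unfolding mU Lx[OF 2] QB[OF 2] .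
  next
    case 3
    have "measure Q {\<omega>\<in>space M. ?U \<omega> \<le> x} = measure Q (space Q)"
    proof (rule Q.finite_measure_eq_AE)
      show "AE \<omega> in Q. (\<omega> \<in> {\<omega>\<in>space M. ?U \<omega> \<le> x}) = (\<omega> \<in> space Q)"
        using bounds AE_Q_space by eventually_elim (use 3 in auto)
    qed simp_all
    then show ?thesis unfolding mU using Q.prob_space L.prob_le_1[of "{..<x}"] by simp
  qed
qed

theorem chosen_genus_size_law:
  assumes k: "1 \<le> k"
  shows "\<P>(\<omega> in M. chosen_genus_size G Z I t \<omega> = enat k \<bar> 1 \<le> G t \<omega>) =
    Gamma (\<nu> + 1) * (\<Prod>j=1..k-1. rate j) *
      (\<Sum>m=1..k. mittag_leffler \<beta> (\<nu> + 1) (- rate m * t powr \<beta>) * hypoexp_coeff rate k m)"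
proof -
  interpret Q: prob_space Q by (rule Q_prob_space)
  let ?f = "fractional_birth_prob \<beta> rate k"
  let ?A = "\<lambda>s. {\<omega>\<in>H. Z (I \<omega>) s \<omega> = enat k}"
  have \<tau>H: "0 \<le> \<tau> \<omega>" if "\<omega> \<in> H" for \<omega>
    using that I_range[of \<omega>] jump_time_le[of t "I \<omega>" \<omega>] t by (auto simp: H_def \<tau>_def)
  have Qf: "measure Q (?A s) = ?f s" if s: "0 < s" for s
  proof -
    have "H \<inter> ?A s = {\<omega>\<in>H. Z (I \<omega>) s \<omega> = enat k \<and> \<tau> \<omega> \<in> UNIV}" "{\<omega>\<in>H. \<tau> \<omega> \<in> UNIV} = H" by auto
    then show ?thesis
      using measure_Q[OF chosen_size_event[of s k]] s prob_H_pos chosen_size_indep_age[OF s k, of UNIV] by simp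
  qed
  have rc: "\<exists>\<delta>>0. \<forall>s'. s \<le> s' \<and> s' < s + \<delta> \<longrightarrow> (\<omega> \<in> ?A s' \<longleftrightarrow> \<omega> \<in> ?A s)"
    if \<omega>: "\<omega> \<in> space Q" and s: "0 \<le> s" for \<omega> s
    proof (cases "\<omega> \<in> H")
      case True
      then have "1 \<le> I \<omega>" "\<omega> \<in> space M" using I_range[of \<omega>] by (auto simp: H_def)
      from fractional_birth_right_continuous[OF Z[OF this(1)] this(2) s]
      obtain \<delta> where "\<delta> > 0" and \<delta>: "\<forall>s'. s \<le> s' \<and> s' < s + \<delta> \<longrightarrow> Z (I \<omega>) s' \<omega> = Z (I \<omega>) s \<omega>" by (elim exE conjE)
      then show ?thesis using \<open>\<delta> > 0\<close>
      proof (intro exI[of _ \<delta>] conjI allI impI)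
        fix s' assume "s \<le> s' \<and> s' < s + \<delta>"
        then have "Z (I \<omega>) s' \<omega> = Z (I \<omega>) s \<omega>" by (rule \<delta>[rule_format])
        then show "\<omega> \<in> ?A s' \<longleftrightarrow> \<omega> \<in> ?A s" by simp
      qed
    qed (auto intro: exI[of _ 1])
  have indep: "measure Q (?A s \<inter> (\<tau> -` J \<inter> H)) = measure Q (?A s) * measure Q (\<tau> -` J \<inter> H)"
    if s: "0 < s" and J: "J \<in> sets borel" for s J
  proof -
    have e1: "?A s \<inter> (\<tau> -` J \<inter> H) = {\<omega>\<in>H. Z (I \<omega>) s \<omega> = enat k \<and> \<tau> \<omega> \<in> J}"
      and e2: "\<tau> -` J \<inter> H = {\<omega>\<in>H. \<tau> \<omega> \<in> J}" by auto
    have Je: "{\<omega>\<in>H. \<tau> \<omega> \<in> J} \<in> events"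
    proof -
      have "\<tau> -` J \<inter> space M \<inter> H \<in> events" using J by measurable
      then show ?thesis by (rule back_subst[of "\<lambda>A. A \<in> events"]) (auto simp: H_def)
    qed
    have Ae: "?A s \<inter> (\<tau> -` J \<inter> H) \<in> events"
      unfolding e2 using chosen_size_event[of s k] s Je by (intro sets.Int) auto
    have "measure Q (?A s \<inter> (\<tau> -` J \<inter> H)) = prob (?A s \<inter> (\<tau> -` J \<inter> H)) / prob H"
      using measure_Q[OF Ae] by (simp add: Int_absorb1 Int_assoc inf_commute)
    also have "\<dots> = ?f s * (prob {\<omega>\<in>H. \<tau> \<omega> \<in> J} / prob H)"
      unfolding e1 chosen_size_indep_age[OF s k J] by simp
    also have "prob {\<omega>\<in>H. \<tau> \<omega> \<in> J} / prob H = measure Q (\<tau> -` J \<inter> H)"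
    proof -
      have "H \<inter> {\<omega>\<in>H. \<tau> \<omega> \<in> J} = {\<omega>\<in>H. \<tau> \<omega> \<in> J}" by auto
      then show ?thesis unfolding e2 measure_Q[OF Je] by simp
    qed
    finally show ?thesis unfolding Qf[OF s] .
  qed
  have pre: "H \<in> sets Q" "\<tau> \<in> borel_measurable Q" "\<And>s. 0 \<le> s \<Longrightarrow> ?A s \<in> sets Q"
    by (simp_all add: chosen_size_event)
  note rts = Q.random_time_substitution[of H \<tau> ?A, OF pre(1,2) \<tau>H pre(3) rc indep]
  have set_eq: "{\<omega>\<in>H. \<omega> \<in> ?A (\<tau> \<omega>)} = {\<omega>\<in>space M. chosen_genus_size G Z I t \<omega> = enat k \<and> 1 \<le> G t \<omega>}"
    by (auto simp: chosen_genus_size_def \<tau>_def H_def)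
  have "\<P>(\<omega> in M. chosen_genus_size G Z I t \<omega> = enat k \<bar> 1 \<le> G t \<omega>) = measure Q {\<omega>\<in>H. \<omega> \<in> ?A (\<tau> \<omega>)}"
  proof -
    have X: "{\<omega>\<in>H. \<omega> \<in> ?A (\<tau> \<omega>)} \<in> events" using rts(1) by (simp only: sets_Q)
    have HX: "H \<inter> {\<omega>\<in>H. \<omega> \<in> ?A (\<tau> \<omega>)} = {\<omega>\<in>H. \<omega> \<in> ?A (\<tau> \<omega>)}" by (rule Int_absorb1, rule Collect_restrict)
    have "\<P>(\<omega> in M. chosen_genus_size G Z I t \<omega> = enat k \<bar> 1 \<le> G t \<omega>) = prob {\<omega>\<in>H. \<omega> \<in> ?A (\<tau> \<omega>)} / prob H"
      unfolding cond_prob_def set_eq unfolding H_def ..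
    then show ?thesis using measure_Q[OF X] unfolding HX by (rule trans[OF _ sym])
  qed
  also have "\<dots> = (\<integral>\<omega>. indicator H \<omega> * measure Q (?A (\<tau> \<omega>)) \<partial>Q)"
    by (rule rts(3))
  \<comment> \<open>The age is written through the relative appearance time 1 - \<tau>/t, whose law
    is known. That law has no mass at 1, so the age is almost surely positive and \<open>Qf\<close>
    applies to it.\<close>
  also have "\<dots> = (\<integral>\<omega>. ?f (t * (1 - (1 - \<tau> \<omega> / t))) \<partial>Q)"
  proof (rule integral_cong_AE)
    have "AE u in distr Q borel (\<lambda>\<omega>. 1 - \<tau> \<omega> / t). 0 < u \<and> u < 1"
      unfolding relative_age_law by (rule AE_genus_age_law)
    then have "AE \<omega> in Q. 0 < 1 - \<tau> \<omega> / t \<and> 1 - \<tau> \<omega> / t < 1"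
      by (subst (asm) AE_distr_iff) auto
    then show "AE \<omega> in Q. indicator H \<omega> * measure Q (?A (\<tau> \<omega>)) = ?f (t * (1 - (1 - \<tau> \<omega> / t)))"
      using AE_Q_H
    proof eventually_elim
      case (elim \<omega>)
      then have "0 < \<tau> \<omega>" using t by (simp add: zero_less_divide_iff)
      have "t * (1 - (1 - \<tau> \<omega> / t)) = \<tau> \<omega>" using t by simp
      moreover have "indicator H \<omega> = (1::real)" using elim by simp
      ultimately show ?case by (simp only: Qf[OF \<open>0 < \<tau> \<omega>\<close>] mult_1_left)
    qed
    show "(\<lambda>\<omega>. ?f (t * (1 - (1 - \<tau> \<omega> / t)))) \<in> borel_measurable Q"
      unfolding fractional_birth_prob_def mittag_leffler_def by measurable
  qed (rule rts(2))
  also have "\<dots> = (\<integral>u. ?f (t * (1 - u)) \<partial>distr Q borel (\<lambda>\<omega>. 1 - \<tau> \<omega> / t))"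
    by (subst integral_distr) (simp_all add: fractional_birth_prob_def mittag_leffler_def)
  also have "\<dots> = (\<integral>u. ?f (t * (1 - u)) \<partial>genus_age_law \<nu>)"
    by (simp only: relative_age_law)
  also have "\<dots> = (\<Prod>j=1..k-1. rate j) * (\<Sum>m=1..k. (Gamma (\<nu> + 1) * mittag_leffler \<beta> (\<nu> + 1) (- rate m * t powr \<beta>)) * hypoexp_coeff rate k m)"
    unfolding fractional_birth_prob_def
    using integral_mittag_leffler_genus_age[OF params(2) \<beta> t] by simp
  also have "\<dots> = Gamma (\<nu> + 1) * (\<Prod>j=1..k-1. rate j) *
      (\<Sum>m=1..k. mittag_leffler \<beta> (\<nu> + 1) (- rate m * t powr \<beta>) * hypoexp_coeff rate k m)"
    by (simp add: sum_distrib_left mult_ac)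
  finally show ?thesis .
qed

end

theorem mainTheorem2:
  fixes \<Omega> :: "'a measure"
    and \<nu> \<beta> \<mu> t :: real
    and rate :: "nat \<Rightarrow> real"
    and M :: "real \<Rightarrow> 'a \<Rightarrow> nat"
    and Z :: "nat \<Rightarrow> real \<Rightarrow> 'a \<Rightarrow> enat"
    and I :: "'a \<Rightarrow> nat"
    and k :: nat
  assumes "prob_space \<Omega>"
    and "0 < \<nu>" "\<nu> < 1" "0 < \<beta>" "\<beta> < 1" "0 < \<mu>"
    and "\<forall>j\<ge>1. 0 < rate j" "inj_on rate {1..}"
    and "yule_model \<Omega> \<nu> \<mu> \<beta> rate M Z"
    and "0 < t" "1 \<le> k"
    and "uniform_choice \<Omega> (sigma_yule \<Omega> M Z) (M t) I"
  shows "\<P>(\<omega> in \<Omega>. chosen_genus_size M Z I t \<omega> = enat k \<bar> 1 \<le> M t \<omega>) =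
    Gamma (\<nu> + 1) * (\<Prod>j=1..k-1. rate j) *
      (\<Sum>m=1..k. mittag_leffler \<beta> (\<nu> + 1) (- rate m * t powr \<beta>) /
                  (\<Prod>l\<in>{1..k} - {m}. rate l - rate m))"
proof -
  interpret prob_space \<Omega> by fact
  interpret yule_space \<Omega> \<mu> \<nu> M \<beta> t rate Z I
    using assms by unfold_locales (auto simp: yule_model_def)
  show ?thesis
    using chosen_genus_size_law[OF \<open>1 \<le> k\<close>] by (simp add: hypoexp_coeff_def)
qed

end
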